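(* Let $m, n \in \mathbb{N}$ with $m \geq 3$, $n \geq 2$, and let $K$ be a field containing a primitive $m$-th root of unity $q$. A Hopf algebra $E$ over $K$ factorizes through $T_{m^{2}}(q)$ and $K[C_n]$ if and only if $E \cong T_{nm^{2}}^{\omega}(q)$ (as Hopf algebras) for some $\omega \in U_n(K)$, where $T_{nm^{2}}^{\omega}(q)$ denotes the Hopf algebra generated as an algebra by $g$, $h$ and $x$ subject to the relations $$g^{n} = h^{m} = 1,\quad x^{m} = 0,\quad x h = q h x, \quad h g = g h,\quad g x = \omega x g,$$ with the coalgebra structure and antipode given by $$\Delta(g) = g \otimes g, \quad \Delta(h) = h \otimes h, \quad \Delta(x) = x \otimes h + 1 \otimes x,$$ $$\varepsilon(h) = \varepsilon(g) = 1, \quad \varepsilon(x) = 0, \quad S(h) = h^{m-1}, \quad S(x) = -xh^{m-1}, \quad S(g) = g^{n-1}.$$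
   Context: All algebras, coalgebras, Hopf algebras and tensor products are over $K$. $U_n(K)=\{\omega\in K \mid \omega^n=1\}$. A primitive $m$-th root of unity is a generator of $U_m(K)$ when $|U_m(K)|=m$. $C_n$ is the cyclic group of order $n$ and $K[C_n]$ its group Hopf algebra. Taft algebra: $T_{m^2}(q)$ is the Hopf algebra generated as an algebra by $h$ and $x$ subject to $h^m=1$, $x^m=0$, $xh=qhx$, with $\Delta(h)=h\otimes h$, $\Delta(x)=x\otimes h+1\otimes x$, $\varepsilon(h)=1$, $\varepsilon(x)=0$, $S(h)=h^{-1}$, $S(x)=-xh^{-1}$. Factorization: a Hopf algebra $E$ factorizes through two Hopf algebras $A$ and $H$ if there exist injective Hopf algebra maps $i\colon A\to E$ and $j\colon H\to E$ such that the map $A\otimes H\to E$, $a\otimes y\mapsto i(a)j(y)$, is bijective. *)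

theory Defs
  imports
    "HOL-Library.Poly_Mapping"
    "HOL-Algebra.QuotRing"
    "HOL-Algebra.Module"
    "HOL-Algebra.Elementary_Groups"
    "HOL-Algebra.Algebraic_Closure_Type"
begin

section \<open>Algebras over a field\<close>

text \<open>
  The ground field is a type of class \<^class>\<open>field\<close>; algebras and Hopf algebras over it are
  HOL-Algebra records with a carrier set.
\<close>

locale assoc_algebra =
  Module.module "ring_of_type_algebra :: 'k ring" A + ring A
  for A :: "('k::field, 'a, 'z) module_scheme" (structure) +
  assumes smult_mult_left:
      "\<lbrakk>a \<in> carrier A; b \<in> carrier A\<rbrakk> \<Longrightarrow> (c \<odot> a) \<otimes> b = c \<odot> (a \<otimes> b)"
    and smult_mult_right:
      "\<lbrakk>a \<in> carrier A; b \<in> carrier A\<rbrakk> \<Longrightarrow> a \<otimes> (c \<odot> b) = c \<odot> (a \<otimes> b)"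

definition ground_algebra :: "('k::field, 'k) module" where
  "ground_algebra = ring.extend ring_of_type_algebra (module.fields (*))"

definition linear_hom ::
  "('k::field, 'a, 'y) module_scheme \<Rightarrow> ('k, 'b, 'z) module_scheme \<Rightarrow> ('a \<Rightarrow> 'b) set" where
  "linear_hom A B = {f \<in> carrier A \<rightarrow> carrier B.
     (\<forall>a\<in>carrier A. \<forall>b\<in>carrier A. f (a \<oplus>\<^bsub>A\<^esub> b) = f a \<oplus>\<^bsub>B\<^esub> f b) \<and>
     (\<forall>c. \<forall>a\<in>carrier A. f (c \<odot>\<^bsub>A\<^esub> a) = c \<odot>\<^bsub>B\<^esub> f a)}"

definition algebra_hom ::
  "('k::field, 'a, 'y) module_scheme \<Rightarrow> ('k, 'b, 'z) module_scheme \<Rightarrow> ('a \<Rightarrow> 'b) set" where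
  "algebra_hom A B = linear_hom A B \<inter> ring_hom A B"

definition opposite_algebra :: "('k::field, 'a, 'z) module_scheme \<Rightarrow> ('k, 'a, 'z) module_scheme" where
  "opposite_algebra A = A\<lparr>monoid.mult := \<lambda>a b. b \<otimes>\<^bsub>A\<^esub> a\<rparr>"

text \<open>
  Two-sided ring ideals of a unital algebra are subspaces, so the scalar action descends to the
  quotient ring.
\<close>

definition quot_algebra ::
  "('k::field, 'a, 'z) module_scheme \<Rightarrow> 'a set \<Rightarrow> ('k, 'a set) module" where
  "quot_algebra A I =
     ring.extend (A Quot I) (module.fields (\<lambda>c B. \<Union>a\<in>B. I +>\<^bsub>A\<^esub> (c \<odot>\<^bsub>A\<^esub> a)))"

definition monoid_algebra :: "('m, 'z) monoid_scheme \<Rightarrow> ('k::field, 'm \<Rightarrow>\<^sub>0 'k) module" where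
  "monoid_algebra M =
     \<lparr>carrier = {p. Poly_Mapping.keys p \<subseteq> carrier M},
      monoid.mult = (\<lambda>p q. \<Sum>a\<in>Poly_Mapping.keys p. \<Sum>b\<in>Poly_Mapping.keys q.
        Poly_Mapping.single (a \<otimes>\<^bsub>M\<^esub> b)
          (Poly_Mapping.lookup p a * Poly_Mapping.lookup q b)),
      one = Poly_Mapping.single \<one>\<^bsub>M\<^esub> 1,
      ring.zero = 0,
      add = (+),
      module.smult = (\<lambda>c. Poly_Mapping.map ((*) c))\<rparr>"

definition linear_extension ::
  "('k::field, 'b, 'z) module_scheme \<Rightarrow> ('a \<Rightarrow> 'b) \<Rightarrow> ('a \<Rightarrow>\<^sub>0 'k) \<Rightarrow> 'b" where
  "linear_extension V f p =
     (\<Oplus>\<^bsub>V\<^esub>a\<in>Poly_Mapping.keys p. Poly_Mapping.lookup p a \<odot>\<^bsub>V\<^esub> f a)"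


section \<open>Tensor products\<close>

text \<open>
  The free vector space on \<open>carrier A \<times> carrier B\<close> is the monoid algebra of the multiplicative
  monoid \<open>A \<times>\<times> B\<close>.  The product of a bilinearity relation with a basis pair is again such a
  relation, so the linear span of the relations coincides with the two-sided ideal they generate;
  hence the quotient below is the tensor product of vector spaces, together with the product
  \<open>(a \<otimes> b)(a' \<otimes> b') = aa' \<otimes> bb'\<close>.
\<close>

definition tensor_relations ::
  "('k::field, 'a, 'y) module_scheme \<Rightarrow> ('k, 'b, 'z) module_scheme \<Rightarrow> ('a \<times> 'b \<Rightarrow>\<^sub>0 'k) set" where
  "tensor_relations A B =
     {Poly_Mapping.single (a \<oplus>\<^bsub>A\<^esub> a', b) 1
        - Poly_Mapping.single (a, b) 1 - Poly_Mapping.single (a', b) 1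
      | a a' b. a \<in> carrier A \<and> a' \<in> carrier A \<and> b \<in> carrier B}
   \<union> {Poly_Mapping.single (a, b \<oplus>\<^bsub>B\<^esub> b') 1
        - Poly_Mapping.single (a, b) 1 - Poly_Mapping.single (a, b') 1
      | a b b'. a \<in> carrier A \<and> b \<in> carrier B \<and> b' \<in> carrier B}
   \<union> {Poly_Mapping.single (c \<odot>\<^bsub>A\<^esub> a, b) 1 - Poly_Mapping.single (a, b) c
      | c a b. a \<in> carrier A \<and> b \<in> carrier B}
   \<union> {Poly_Mapping.single (a, c \<odot>\<^bsub>B\<^esub> b) 1 - Poly_Mapping.single (a, b) c
      | c a b. a \<in> carrier A \<and> b \<in> carrier B}"

definition tensor_ideal ::
  "('k::field, 'a, 'y) module_scheme \<Rightarrow> ('k, 'b, 'z) module_scheme \<Rightarrow> ('a \<times> 'b \<Rightarrow>\<^sub>0 'k) set" where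
  "tensor_ideal A B = Idl\<^bsub>monoid_algebra (A \<times>\<times> B)\<^esub> (tensor_relations A B)"

definition tensor ::
  "('k::field, 'a, 'y) module_scheme \<Rightarrow> ('k, 'b, 'z) module_scheme
    \<Rightarrow> ('k, ('a \<times> 'b \<Rightarrow>\<^sub>0 'k) set) module" where
  "tensor A B = quot_algebra (monoid_algebra (A \<times>\<times> B)) (tensor_ideal A B)"

definition pure_tensor ::
  "('k::field, 'a, 'y) module_scheme \<Rightarrow> ('k, 'b, 'z) module_scheme
    \<Rightarrow> 'a \<Rightarrow> 'b \<Rightarrow> ('a \<times> 'b \<Rightarrow>\<^sub>0 'k) set" where
  "pure_tensor A B a b =
     tensor_ideal A B +>\<^bsub>monoid_algebra (A \<times>\<times> B)\<^esub> Poly_Mapping.single (a, b) 1"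

text \<open>
  The linear map out of a tensor product induced by a bilinear map \<open>f\<close> into \<open>V\<close>: for bilinear \<open>f\<close>
  its linear extension is constant on each coset \<open>t\<close>, so the image below is a singleton.
\<close>

definition tensor_lift ::
  "('k::field, 'c, 'z) module_scheme \<Rightarrow> ('a \<Rightarrow> 'b \<Rightarrow> 'c) \<Rightarrow> ('a \<times> 'b \<Rightarrow>\<^sub>0 'k) set \<Rightarrow> 'c" where
  "tensor_lift V f t = the_elem (linear_extension V (case_prod f) ` t)"

definition tensor_map ::
  "('k::field, 'c, 'y) module_scheme \<Rightarrow> ('k, 'd, 'z) module_scheme \<Rightarrow> ('a \<Rightarrow> 'c) \<Rightarrow> ('b \<Rightarrow> 'd)
    \<Rightarrow> ('a \<times> 'b \<Rightarrow>\<^sub>0 'k) set \<Rightarrow> ('c \<times> 'd \<Rightarrow>\<^sub>0 'k) set" where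
  "tensor_map C D f g = tensor_lift (tensor C D) (\<lambda>a b. pure_tensor C D (f a) (g b))"

text \<open>The canonical map from \<open>(A \<otimes> B) \<otimes> C\<close> to \<open>A \<otimes> (B \<otimes> C)\<close>.\<close>

definition tensor_assoc ::
  "('k::field, 'a, 'x) module_scheme \<Rightarrow> ('k, 'b, 'y) module_scheme \<Rightarrow> ('k, 'c, 'z) module_scheme
    \<Rightarrow> (('a \<times> 'b \<Rightarrow>\<^sub>0 'k) set \<times> 'c \<Rightarrow>\<^sub>0 'k) set \<Rightarrow> ('a \<times> ('b \<times> 'c \<Rightarrow>\<^sub>0 'k) set \<Rightarrow>\<^sub>0 'k) set" where
  "tensor_assoc A B C =
     tensor_lift (tensor A (tensor B C))
       (\<lambda>s c. tensor_lift (tensor A (tensor B C))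
         (\<lambda>a b. pure_tensor A (tensor B C) a (pure_tensor B C b c)) s)"


section \<open>Hopf algebras\<close>

record (overloaded) ('k, 'a) hopf = "('k::field, 'a) module" +
  comult :: "'a \<Rightarrow> ('a \<times> 'a \<Rightarrow>\<^sub>0 'k) set"
  counit :: "'a \<Rightarrow> 'k"
  antipode :: "'a \<Rightarrow> 'a"

locale hopf_algebra = assoc_algebra H
  for H :: "('k::field, 'a, 'z) hopf_scheme" (structure) +
  assumes comult_hom: "comult H \<in> algebra_hom H (tensor H H)"
    and counit_hom: "counit H \<in> algebra_hom H ground_algebra"
    and antipode_linear: "antipode H \<in> linear_hom H H"
    and coassoc: "a \<in> carrier H \<Longrightarrow>
      tensor_assoc H H H (tensor_map (tensor H H) H (comult H) id (comult H a))
        = tensor_map H (tensor H H) id (comult H) (comult H a)"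
    and counit_left: "a \<in> carrier H \<Longrightarrow>
      tensor_lift H (\<lambda>b c. counit H b \<odot> c) (comult H a) = a"
    and counit_right: "a \<in> carrier H \<Longrightarrow>
      tensor_lift H (\<lambda>b c. counit H c \<odot> b) (comult H a) = a"
    and antipode_left: "a \<in> carrier H \<Longrightarrow>
      tensor_lift H (\<lambda>b c. antipode H b \<otimes> c) (comult H a) = counit H a \<odot> \<one>"
    and antipode_right: "a \<in> carrier H \<Longrightarrow>
      tensor_lift H (\<lambda>b c. b \<otimes> antipode H c) (comult H a) = counit H a \<odot> \<one>"

definition hopf_hom ::
  "('k::field, 'a, 'y) hopf_scheme \<Rightarrow> ('k, 'b, 'z) hopf_scheme \<Rightarrow> ('a \<Rightarrow> 'b) set" where
  "hopf_hom H L = {f \<in> algebra_hom H L. \<forall>a\<in>carrier H.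
     comult L (f a) = tensor_map L L f f (comult H a) \<and>
     counit L (f a) = counit H a \<and>
     antipode L (f a) = f (antipode H a)}"

definition hopf_isomorphic ::
  "('k::field, 'a, 'y) hopf_scheme \<Rightarrow> ('k, 'b, 'z) hopf_scheme \<Rightarrow> bool" where
  "hopf_isomorphic H L \<longleftrightarrow> hopf_algebra H \<and> hopf_algebra L \<and>
     (\<exists>f \<in> hopf_hom H L. bij_betw f (carrier H) (carrier L))"

definition factorizes_through ::
  "('k::field, 'e, 'x) hopf_scheme \<Rightarrow> ('k, 'a, 'y) hopf_scheme \<Rightarrow> ('k, 'b, 'z) hopf_scheme
    \<Rightarrow> bool" where
  "factorizes_through E A H \<longleftrightarrow> hopf_algebra E \<and> hopf_algebra A \<and> hopf_algebra H \<and>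
     (\<exists>i \<in> hopf_hom A E. \<exists>j \<in> hopf_hom H E.
        inj_on i (carrier A) \<and> inj_on j (carrier H) \<and>
        bij_betw (tensor_lift E (\<lambda>a y. i a \<otimes>\<^bsub>E\<^esub> j y)) (carrier (tensor A H)) (carrier E))"

definition group_hopf_algebra :: "('g, 'z) monoid_scheme \<Rightarrow> ('k::field, 'g \<Rightarrow>\<^sub>0 'k) hopf" where
  "group_hopf_algebra G =
     (let A = monoid_algebra G; \<delta> = (\<lambda>g. Poly_Mapping.single g 1) in
      module.extend A (hopf.fields
        (linear_extension (tensor A A) (\<lambda>g. pure_tensor A A (\<delta> g) (\<delta> g)))
        (linear_extension ground_algebra (\<lambda>g. 1))
        (linear_extension A (\<lambda>g. \<delta> (inv\<^bsub>G\<^esub> g)))))"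


section \<open>Hopf algebras given by generators and relations\<close>

text \<open>The free algebra on all elements of the type \<^typ>\<open>'g\<close>; its basis consists of words.\<close>

definition free_algebra :: "('k::field, 'g list \<Rightarrow>\<^sub>0 'k) module" where
  "free_algebra = monoid_algebra \<lparr>carrier = UNIV, monoid.mult = (@), one = []\<rparr>"

definition presented_algebra ::
  "('g list \<Rightarrow>\<^sub>0 'k::field) set \<Rightarrow> ('k, ('g list \<Rightarrow>\<^sub>0 'k) set) module" where
  "presented_algebra R = quot_algebra free_algebra (Idl\<^bsub>free_algebra\<^esub> R)"

definition presented_gen :: "('g list \<Rightarrow>\<^sub>0 'k::field) set \<Rightarrow> 'g \<Rightarrow> ('g list \<Rightarrow>\<^sub>0 'k) set" where
  "presented_gen R s = Idl\<^bsub>free_algebra\<^esub> R +>\<^bsub>free_algebra\<^esub> Poly_Mapping.single [s] 1"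

text \<open>
  The algebra map out of a presented algebra sending each generator \<open>s\<close> to \<open>\<phi> s\<close>.  If the \<open>\<phi> s\<close>
  satisfy the relations, evaluation is constant on each coset \<open>t\<close>.
\<close>

definition presented_lift ::
  "('k::field, 'a, 'z) module_scheme \<Rightarrow> ('g \<Rightarrow> 'a) \<Rightarrow> ('g list \<Rightarrow>\<^sub>0 'k) set \<Rightarrow> 'a" where
  "presented_lift A \<phi> t = the_elem
     (linear_extension A (\<lambda>w. foldr (\<lambda>s a. \<phi> s \<otimes>\<^bsub>A\<^esub> a) w \<one>\<^bsub>A\<^esub>) ` t)"

text \<open>
  Comultiplication and counit are extended from the generators as algebra maps, the antipode as
  an algebra map into the opposite algebra.
\<close>

definition presented_hopf ::
  "('g list \<Rightarrow>\<^sub>0 'k::field) set \<Rightarrow> ('g \<Rightarrow> (('g list \<Rightarrow>\<^sub>0 'k) set \<times> ('g list \<Rightarrow>\<^sub>0 'k) set \<Rightarrow>\<^sub>0 'k) set)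
    \<Rightarrow> ('g \<Rightarrow> 'k) \<Rightarrow> ('g \<Rightarrow> ('g list \<Rightarrow>\<^sub>0 'k) set) \<Rightarrow> ('k, ('g list \<Rightarrow>\<^sub>0 'k) set) hopf" where
  "presented_hopf R \<Delta> \<epsilon> S =
     (let A = presented_algebra R in
      module.extend A (hopf.fields
        (presented_lift (tensor A A) \<Delta>)
        (presented_lift ground_algebra \<epsilon>)
        (presented_lift (opposite_algebra A) S)))"


section \<open>The Taft algebra and its extensions\<close>

datatype taft_gen = Taft_h | Taft_x

definition taft_relations :: "nat \<Rightarrow> 'k::field \<Rightarrow> (taft_gen list \<Rightarrow>\<^sub>0 'k) set" where
  "taft_relations m q =
     {Poly_Mapping.single (replicate m Taft_h) 1 - Poly_Mapping.single [] 1,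
      Poly_Mapping.single (replicate m Taft_x) 1,
      Poly_Mapping.single [Taft_x, Taft_h] 1 - Poly_Mapping.single [Taft_h, Taft_x] q}"

definition taft_hopf :: "nat \<Rightarrow> 'k::field \<Rightarrow> ('k, (taft_gen list \<Rightarrow>\<^sub>0 'k) set) hopf" where
  "taft_hopf m q =
     (let R = taft_relations m q; A = presented_algebra R; T = tensor A A; t = pure_tensor A A;
          h = presented_gen R Taft_h; x = presented_gen R Taft_x in
      presented_hopf R
        (\<lambda>s. case s of Taft_h \<Rightarrow> t h h | Taft_x \<Rightarrow> t x h \<oplus>\<^bsub>T\<^esub> t \<one>\<^bsub>A\<^esub> x)
        (\<lambda>s. case s of Taft_h \<Rightarrow> 1 | Taft_x \<Rightarrow> 0)
        (\<lambda>s. case s of Taft_h \<Rightarrow> inv\<^bsub>A\<^esub> h | Taft_x \<Rightarrow> \<ominus>\<^bsub>A\<^esub> (x \<otimes>\<^bsub>A\<^esub> inv\<^bsub>A\<^esub> h)))"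

datatype taft_ext_gen = Ext_g | Ext_h | Ext_x

definition taft_ext_relations ::
  "nat \<Rightarrow> nat \<Rightarrow> 'k::field \<Rightarrow> 'k \<Rightarrow> (taft_ext_gen list \<Rightarrow>\<^sub>0 'k) set" where
  "taft_ext_relations n m \<omega> q =
     {Poly_Mapping.single (replicate n Ext_g) 1 - Poly_Mapping.single [] 1,
      Poly_Mapping.single (replicate m Ext_h) 1 - Poly_Mapping.single [] 1,
      Poly_Mapping.single (replicate m Ext_x) 1,
      Poly_Mapping.single [Ext_x, Ext_h] 1 - Poly_Mapping.single [Ext_h, Ext_x] q,
      Poly_Mapping.single [Ext_h, Ext_g] 1 - Poly_Mapping.single [Ext_g, Ext_h] 1,
      Poly_Mapping.single [Ext_g, Ext_x] 1 - Poly_Mapping.single [Ext_x, Ext_g] \<omega>}"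

definition taft_ext_hopf ::
  "nat \<Rightarrow> nat \<Rightarrow> 'k::field \<Rightarrow> 'k \<Rightarrow> ('k, (taft_ext_gen list \<Rightarrow>\<^sub>0 'k) set) hopf" where
  "taft_ext_hopf n m \<omega> q =
     (let R = taft_ext_relations n m \<omega> q; A = presented_algebra R; T = tensor A A;
          t = pure_tensor A A;
          g = presented_gen R Ext_g; h = presented_gen R Ext_h; x = presented_gen R Ext_x in
      presented_hopf R
        (\<lambda>s. case s of Ext_g \<Rightarrow> t g g | Ext_h \<Rightarrow> t h h
           | Ext_x \<Rightarrow> t x h \<oplus>\<^bsub>T\<^esub> t \<one>\<^bsub>A\<^esub> x)
        (\<lambda>s. case s of Ext_g \<Rightarrow> 1 | Ext_h \<Rightarrow> 1 | Ext_x \<Rightarrow> 0)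
        (\<lambda>s. case s of
             Ext_g \<Rightarrow> g [^]\<^bsub>A\<^esub> (n - 1)
           | Ext_h \<Rightarrow> h [^]\<^bsub>A\<^esub> (m - 1)
           | Ext_x \<Rightarrow> \<ominus>\<^bsub>A\<^esub> (x \<otimes>\<^bsub>A\<^esub> h [^]\<^bsub>A\<^esub> (m - 1))))"


section \<open>Roots of unity\<close>

definition roots_of_unity :: "nat \<Rightarrow> 'k::field set" where
  "roots_of_unity n = {\<omega>. \<omega> ^ n = 1}"

definition primitive_root_of_unity :: "nat \<Rightarrow> 'k::field \<Rightarrow> bool" where
  "primitive_root_of_unity m q \<longleftrightarrow>
     card (roots_of_unity m :: 'k set) = m \<and> roots_of_unity m = range (\<lambda>i::nat. q ^ i)"

end

(*
  Let E factorize through the Taft algebra and K[C_n].  As a coalgebra E is their tensor product,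
  so the monomials h^a x^b g^c form a basis on which, by the q-binomial theorem,
    Delta(h^a x^b g^c) = sum_i [b choose i]_q  h^a x^i g^c (x) h^(a+i) x^(b-i) g^c.
  The element y = g x g^-1 satisfies Delta(y) = y (x) k + 1 (x) y with k = g h g^-1 grouplike.
  Comparing coordinates in E (x) E shows that k = h and that y - omega x is a combination of
  grouplikes for some nonzero omega; then y h = q h y forces y = omega x, and g^n = 1 gives
  omega^n = 1.  Conversely, all Hopf algebra axioms can be checked on generators, and a
  representation by weighted shifts shows that the monomials are linearly independent in the
  presented algebra, so the product map from the tensor product is bijective.
*)
theory Submission
  imports Defs
begin

text \<open>The order h, x, g in the monomials is deliberate: their coproducts follow from
  \<open>xh = qhx\<close>, \<open>h^m = 1\<close> and grouplikeness alone, before anything is known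
  about how g interacts with h and x. A coordinate of \<Delta>(y) at a pair of basis elements
  involves at most one coordinate of y; evaluating it again through
  \<open>\<Delta>(y) = y \<otimes> k + 1 \<otimes> y\<close> gives scalar equations, and well-chosen
  pairs isolate the coordinates needed. Primitivity of q has two opposite effects:
  \<open>[m choose i]_q = 0\<close> for 0 < i < m makes the m-th power of
  \<open>x \<otimes> h + 1 \<otimes> x\<close> vanish, so the coproduct respects
  \<open>x^m = 0\<close>, while \<open>[b choose 1]_q\<close> is nonzero for 0 < b < m and kills the
  coordinates of y of x-degree at least 2. Bases are carried together with coordinate functionals,
  because these multiply on tensor products and pull back along linear maps; this also yields the
  basis of the Taft algebra, from the case n = 1, \<omega> = 1 of the extension. Tensor products and
  presented algebras are quotients by generated ideals, so each map out of them requires an argument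
  that the ideal is annihilated.\<close>

section \<open>Algebras over a field and scalar arithmetic\<close>

lemma carrier_ground_ring [simp]: "carrier (ring_of_type_algebra :: 'k::field ring) = UNIV"
  and add_ground_ring [simp]: "add (ring_of_type_algebra :: 'k::field ring) = (+)"
  and mult_ground_ring [simp]: "monoid.mult (ring_of_type_algebra :: 'k::field ring) = (*)"
  and one_ground_ring [simp]: "\<one>\<^bsub>(ring_of_type_algebra :: 'k::field ring)\<^esub> = 1"
  and zero_ground_ring [simp]: "\<zero>\<^bsub>(ring_of_type_algebra :: 'k::field ring)\<^esub> = 0"
  by (simp_all add: ring_of_type_algebra_def)

text \<open>Negatives are not among the hypotheses: \<open>(- 1) \<odot> a\<close> is the inverse of
  a, since the two add up to \<open>0 \<odot> a\<close>, assumed to be zero.\<close>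

lemma assoc_algebraI:
  fixes A :: "('k::field, 'a, 'z) module_scheme" (structure)
  assumes closed: "\<zero> \<in> carrier A" "\<one> \<in> carrier A"
      "\<And>a b. \<lbrakk>a \<in> carrier A; b \<in> carrier A\<rbrakk> \<Longrightarrow> a \<oplus> b \<in> carrier A"
      "\<And>a b. \<lbrakk>a \<in> carrier A; b \<in> carrier A\<rbrakk> \<Longrightarrow> a \<otimes> b \<in> carrier A"
      "\<And>c a. a \<in> carrier A \<Longrightarrow> c \<odot> a \<in> carrier A"
    and add: "\<And>a b c. \<lbrakk>a \<in> carrier A; b \<in> carrier A; c \<in> carrier A\<rbrakk> \<Longrightarrow> a \<oplus> b \<oplus> c = a \<oplus> (b \<oplus> c)"
      "\<And>a b. \<lbrakk>a \<in> carrier A; b \<in> carrier A\<rbrakk> \<Longrightarrow> a \<oplus> b = b \<oplus> a"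
      "\<And>a. a \<in> carrier A \<Longrightarrow> \<zero> \<oplus> a = a"
    and mult: "\<And>a b c. \<lbrakk>a \<in> carrier A; b \<in> carrier A; c \<in> carrier A\<rbrakk> \<Longrightarrow> a \<otimes> b \<otimes> c = a \<otimes> (b \<otimes> c)"
      "\<And>a. a \<in> carrier A \<Longrightarrow> \<one> \<otimes> a = a" "\<And>a. a \<in> carrier A \<Longrightarrow> a \<otimes> \<one> = a"
    and distr: "\<And>a b c. \<lbrakk>a \<in> carrier A; b \<in> carrier A; c \<in> carrier A\<rbrakk> \<Longrightarrow> (a \<oplus> b) \<otimes> c = a \<otimes> c \<oplus> b \<otimes> c"
      "\<And>a b c. \<lbrakk>a \<in> carrier A; b \<in> carrier A; c \<in> carrier A\<rbrakk> \<Longrightarrow> c \<otimes> (a \<oplus> b) = c \<otimes> a \<oplus> c \<otimes> b"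
    and scale: "\<And>c d a. a \<in> carrier A \<Longrightarrow> (c + d) \<odot> a = c \<odot> a \<oplus> d \<odot> a"
      "\<And>c a b. \<lbrakk>a \<in> carrier A; b \<in> carrier A\<rbrakk> \<Longrightarrow> c \<odot> (a \<oplus> b) = c \<odot> a \<oplus> c \<odot> b"
      "\<And>c d a. a \<in> carrier A \<Longrightarrow> (c * d) \<odot> a = c \<odot> (d \<odot> a)"
      "\<And>a. a \<in> carrier A \<Longrightarrow> 1 \<odot> a = a" "\<And>a. a \<in> carrier A \<Longrightarrow> 0 \<odot> a = \<zero>"
      "\<And>c a b. \<lbrakk>a \<in> carrier A; b \<in> carrier A\<rbrakk> \<Longrightarrow> (c \<odot> a) \<otimes> b = c \<odot> (a \<otimes> b)"
      "\<And>c a b. \<lbrakk>a \<in> carrier A; b \<in> carrier A\<rbrakk> \<Longrightarrow> a \<otimes> (c \<odot> b) = c \<odot> (a \<otimes> b)"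
  shows "assoc_algebra A"
proof -
  have inv: "\<exists>b\<in>carrier A. b \<oplus> a = \<zero>" if "a \<in> carrier A" for a
    using that closed(5)[OF that, of "- 1"] scale(1)[OF that, of "- 1" 1, symmetric] scale(4,5)
    by (intro bexI[of _ "(- 1) \<odot> a"]) simp_all
  have group: "abelian_group A"
    by (rule abelian_groupI) (rule closed add inv | assumption)+
  have "ring A"
    by (intro ringI monoidI) (rule group closed mult distr | assumption)+
  with group show ?thesis
    by (intro assoc_algebra.intro assoc_algebra_axioms.intro moduleI cring_from_type_algebra)
      (simp_all add: closed scale)
qed

context assoc_algebra
begin

lemma scale_closed [simp, intro]: "a \<in> carrier A \<Longrightarrow> c \<odot> a \<in> carrier A"
  using smult_closed by simp

lemma scale_add_left: "a \<in> carrier A \<Longrightarrow> (c + d) \<odot> a = c \<odot> a \<oplus> d \<odot> a"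
  using smult_l_distr[of c d a] by simp

lemma scale_add_right:
  "a \<in> carrier A \<Longrightarrow> b \<in> carrier A \<Longrightarrow> c \<odot> (a \<oplus> b) = c \<odot> a \<oplus> c \<odot> b"
  using smult_r_distr[of c a b] by simp

lemma scale_scale [simp]: "a \<in> carrier A \<Longrightarrow> c \<odot> (d \<odot> a) = (c * d) \<odot> a"
  using smult_assoc1[of c d a] by simp

lemma scale_one [simp]: "a \<in> carrier A \<Longrightarrow> 1 \<odot> a = a"
  using smult_one by simp

lemma scale_zero_left [simp]: "a \<in> carrier A \<Longrightarrow> 0 \<odot> a = \<zero>"
  using smult_l_null by simp

lemma scale_zero_right [simp]: "c \<odot> \<zero> = \<zero>"
  using smult_r_null by simp

lemma scale_minus_one: "a \<in> carrier A \<Longrightarrow> (- 1) \<odot> a = \<ominus> a"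
  using scale_add_left[of a "- 1" 1] by (simp add: minus_equality)

lemma scale_minus_left: "a \<in> carrier A \<Longrightarrow> (- c) \<odot> a = \<ominus> (c \<odot> a)"
  using scale_add_left[of a "- c" c] by (simp add: minus_equality)

lemma scale_minus_right: "a \<in> carrier A \<Longrightarrow> c \<odot> (\<ominus> a) = \<ominus> (c \<odot> a)"
  by (simp add: scale_minus_one [symmetric])

lemma scale_cancel:
  assumes "a \<in> carrier A" "c \<odot> a = \<zero>" shows "c = 0 \<or> a = \<zero>"
proof (rule disjCI)
  assume "a \<noteq> \<zero>"
  show "c = 0"
  proof (rule ccontr)
    assume "c \<noteq> 0"
    then have "a = (inverse c) \<odot> (c \<odot> a)" using assms(1) by simp
    then show False using assms \<open>a \<noteq> \<zero>\<close> by simp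
  qed
qed

lemma scale_finsum:
  "finite I \<Longrightarrow> f \<in> I \<rightarrow> carrier A \<Longrightarrow> c \<odot> (\<Oplus>i\<in>I. f i) = (\<Oplus>i\<in>I. c \<odot> f i)"
  by (induction I rule: finite_induct) (simp_all add: scale_add_right Pi_def finsum_insert)

lemma scale_nat_pow: "a \<in> carrier A \<Longrightarrow> (c \<odot> a) [^] (k::nat) = (c ^ k) \<odot> (a [^] k)"
  by (induction k) (simp_all add: smult_mult_left smult_mult_right mult.commute)

end

lemma ground_algebra_simps [simp]:
  "carrier (ground_algebra :: ('k::field, 'k) module) = UNIV"
  "add (ground_algebra :: ('k::field, 'k) module) = (+)"
  "monoid.mult (ground_algebra :: ('k::field, 'k) module) = (*)"
  "\<one>\<^bsub>(ground_algebra :: ('k::field, 'k) module)\<^esub> = 1"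
  "\<zero>\<^bsub>(ground_algebra :: ('k::field, 'k) module)\<^esub> = 0"
  "module.smult (ground_algebra :: ('k::field, 'k) module) = (*)"
  by (simp_all add: ground_algebra_def ring.defs module.defs)


lemma assoc_algebra_ground: "assoc_algebra (ground_algebra :: ('k::field, 'k) module)"
  by (rule assoc_algebraI) (simp_all add: algebra_simps)

section \<open>Linear maps\<close>

lemma linear_homD:
  assumes "f \<in> linear_hom A B" "a \<in> carrier A"
  shows "f a \<in> carrier B" "b \<in> carrier A \<Longrightarrow> f (a \<oplus>\<^bsub>A\<^esub> b) = f a \<oplus>\<^bsub>B\<^esub> f b"
    "f (c \<odot>\<^bsub>A\<^esub> a) = c \<odot>\<^bsub>B\<^esub> f a"
  using assms by (auto simp: linear_hom_def)

lemma linear_homI: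
  assumes "\<And>a. a \<in> carrier A \<Longrightarrow> f a \<in> carrier B"
    and "\<And>a b. a \<in> carrier A \<Longrightarrow> b \<in> carrier A \<Longrightarrow> f (a \<oplus>\<^bsub>A\<^esub> b) = f a \<oplus>\<^bsub>B\<^esub> f b"
    and "\<And>c a. a \<in> carrier A \<Longrightarrow> f (c \<odot>\<^bsub>A\<^esub> a) = c \<odot>\<^bsub>B\<^esub> f a"
  shows "f \<in> linear_hom A B"
  using assms by (auto simp: linear_hom_def)

lemma linear_hom_zero:
  assumes "assoc_algebra A" "assoc_algebra B" "f \<in> linear_hom A B"
  shows "f \<zero>\<^bsub>A\<^esub> = \<zero>\<^bsub>B\<^esub>"
proof -
  interpret A: assoc_algebra A by fact
  interpret B: assoc_algebra B by fact
  have "f (0 \<odot>\<^bsub>A\<^esub> \<zero>\<^bsub>A\<^esub>) = 0 \<odot>\<^bsub>B\<^esub> f \<zero>\<^bsub>A\<^esub>"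
    using linear_homD[OF assms(3)] by blast
  then show ?thesis using linear_homD(1)[OF assms(3) A.zero_closed] by simp
qed

lemma linear_hom_minus:
  assumes "assoc_algebra A" "assoc_algebra B" "f \<in> linear_hom A B" "a \<in> carrier A"
  shows "f (\<ominus>\<^bsub>A\<^esub> a) = \<ominus>\<^bsub>B\<^esub> f a"
proof -
  interpret A: assoc_algebra A by fact
  interpret B: assoc_algebra B by fact
  show ?thesis
    using linear_homD[OF assms(3,4)]
    by (simp add: assms(4) A.scale_minus_one [symmetric] B.scale_minus_one [symmetric])
qed

lemma linear_hom_diff:
  assumes "assoc_algebra A" "assoc_algebra B" "f \<in> linear_hom A B" "a \<in> carrier A" "b \<in> carrier A"
  shows "f (a \<ominus>\<^bsub>A\<^esub> b) = f a \<ominus>\<^bsub>B\<^esub> f b"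
proof -
  interpret A: assoc_algebra A by fact
  show ?thesis
    using linear_homD[OF assms(3)] linear_hom_minus[OF assms(1-3)] assms(4,5)
    by (simp add: a_minus_def)
qed

lemma linear_hom_finsum:
  assumes "assoc_algebra A" "assoc_algebra B" "f \<in> linear_hom A B"
    and "finite I" "e \<in> I \<rightarrow> carrier A"
  shows "f (\<Oplus>\<^bsub>A\<^esub>i\<in>I. e i) = (\<Oplus>\<^bsub>B\<^esub>i\<in>I. f (e i))"
proof -
  interpret A: assoc_algebra A by fact
  interpret B: assoc_algebra B by fact
  show ?thesis
    using assms(4,5)
    by (induction rule: finite_induct)
      (simp_all add: linear_hom_zero[OF assms(1-3)] linear_homD[OF assms(3)] Pi_def)
qed

lemma linear_hom_comp:
  "f \<in> linear_hom A B \<Longrightarrow> g \<in> linear_hom B C \<Longrightarrow> (\<lambda>a. g (f a)) \<in> linear_hom A C"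
  by (rule linear_homI) (simp_all add: linear_homD)

lemma linear_hom_inv:
  assumes V: "assoc_algebra V" and f: "f \<in> linear_hom V W" and bij: "bij_betw f (carrier V) (carrier W)"
  shows "inv_into (carrier V) f \<in> linear_hom W V"
proof -
  interpret V: assoc_algebra V by fact
  let ?g = "inv_into (carrier V) f"
  have g_in: "?g b \<in> carrier V" if "b \<in> carrier W" for b
    using bij that by (metis bij_betw_def inv_into_into)
  have fg: "f (?g b) = b" if "b \<in> carrier W" for b using bij that by (rule bij_betw_inv_into_right)
  have gf: "?g (f a) = a" if "a \<in> carrier V" for a using bij that by (rule bij_betw_inv_into_left)
  show ?thesis
  proof (intro linear_homI g_in)
    fix a b c assume a: "a \<in> carrier W"
    show "?g (c \<odot>\<^bsub>W\<^esub> a) = c \<odot>\<^bsub>V\<^esub> ?g a"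
      using gf[of "c \<odot>\<^bsub>V\<^esub> ?g a"] g_in[OF a] by (simp add: linear_homD[OF f] fg[OF a])
    assume b: "b \<in> carrier W"
    show "?g (a \<oplus>\<^bsub>W\<^esub> b) = ?g a \<oplus>\<^bsub>V\<^esub> ?g b"
      using gf[of "?g a \<oplus>\<^bsub>V\<^esub> ?g b"] g_in[OF a] g_in[OF b] by (simp add: linear_homD[OF f] fg[OF a] fg[OF b])
  qed
qed

lemma linear_hom_id: "id \<in> linear_hom A A" "(\<lambda>a. a) \<in> linear_hom A A"
  by (auto simp: linear_hom_def)

lemma linear_hom_add:
  assumes "assoc_algebra B" "f \<in> linear_hom A B" "g \<in> linear_hom A B"
  shows "(\<lambda>a. f a \<oplus>\<^bsub>B\<^esub> g a) \<in> linear_hom A B"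
proof -
  interpret B: assoc_algebra B by fact
  show ?thesis
    using linear_homD[OF assms(2)] linear_homD[OF assms(3)]
    by (intro linear_homI) (auto simp: B.scale_add_right B.a_ac)
qed

lemma linear_hom_scale:
  assumes "assoc_algebra B" "f \<in> linear_hom A B"
  shows "(\<lambda>a. c \<odot>\<^bsub>B\<^esub> f a) \<in> linear_hom A B"
proof -
  interpret B: assoc_algebra B by fact
  show ?thesis
    using linear_homD[OF assms(2)]
    by (intro linear_homI) (auto simp: B.scale_add_right mult.commute)
qed

lemma linear_hom_mult_left:
  assumes "assoc_algebra B" "f \<in> linear_hom A B" "b \<in> carrier B"
  shows "(\<lambda>a. b \<otimes>\<^bsub>B\<^esub> f a) \<in> linear_hom A B"
proof -
  interpret B: assoc_algebra B by fact
  show ?thesis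
    using linear_homD[OF assms(2)] assms(3)
    by (intro linear_homI) (auto simp: B.r_distr B.smult_mult_right)
qed

lemma linear_hom_mult_right:
  assumes "assoc_algebra B" "f \<in> linear_hom A B" "b \<in> carrier B"
  shows "(\<lambda>a. f a \<otimes>\<^bsub>B\<^esub> b) \<in> linear_hom A B"
proof -
  interpret B: assoc_algebra B by fact
  show ?thesis
    using linear_homD[OF assms(2)] assms(3)
    by (intro linear_homI) (auto simp: B.l_distr B.smult_mult_left)
qed

lemma linear_hom_scale_fixed:
  assumes "assoc_algebra B" "f \<in> linear_hom A ground_algebra" "b \<in> carrier B"
  shows "(\<lambda>a. f a \<odot>\<^bsub>B\<^esub> b) \<in> linear_hom A B"
proof -
  interpret B: assoc_algebra B by fact
  show ?thesis
    using linear_homD[OF assms(2)] assms(3)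
    by (intro linear_homI) (auto simp: B.scale_add_left)
qed

lemma algebra_homD:
  assumes "f \<in> algebra_hom A B"
  shows "f \<in> linear_hom A B" "f \<in> ring_hom A B" "f \<one>\<^bsub>A\<^esub> = \<one>\<^bsub>B\<^esub>"
    "a \<in> carrier A \<Longrightarrow> f a \<in> carrier B"
    "a \<in> carrier A \<Longrightarrow> b \<in> carrier A \<Longrightarrow> f (a \<oplus>\<^bsub>A\<^esub> b) = f a \<oplus>\<^bsub>B\<^esub> f b"
    "a \<in> carrier A \<Longrightarrow> f (c \<odot>\<^bsub>A\<^esub> a) = c \<odot>\<^bsub>B\<^esub> f a"
    "a \<in> carrier A \<Longrightarrow> b \<in> carrier A \<Longrightarrow> f (a \<otimes>\<^bsub>A\<^esub> b) = f a \<otimes>\<^bsub>B\<^esub> f b"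
  using assms by (auto simp: algebra_hom_def linear_hom_def ring_hom_def)

lemma algebra_homI:
  assumes "f \<in> linear_hom A B" "f \<one>\<^bsub>A\<^esub> = \<one>\<^bsub>B\<^esub>"
    "\<And>a b. a \<in> carrier A \<Longrightarrow> b \<in> carrier A \<Longrightarrow> f (a \<otimes>\<^bsub>A\<^esub> b) = f a \<otimes>\<^bsub>B\<^esub> f b"
  shows "f \<in> algebra_hom A B"
  using assms by (auto simp: algebra_hom_def linear_hom_def ring_hom_def)

lemma algebra_hom_comp:
  "f \<in> algebra_hom A B \<Longrightarrow> g \<in> algebra_hom B C \<Longrightarrow> (\<lambda>a. g (f a)) \<in> algebra_hom A C"
  by (rule algebra_homI) (auto simp: algebra_homD intro: linear_hom_comp algebra_homD(1))

lemma algebra_hom_id: "id \<in> algebra_hom A A"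
  by (auto intro: algebra_homI simp: linear_hom_id)

lemma algebra_hom_pow:
  assumes "assoc_algebra A" "assoc_algebra B" "f \<in> algebra_hom A B" "a \<in> carrier A"
  shows "f (a [^]\<^bsub>A\<^esub> (k::nat)) = f a [^]\<^bsub>B\<^esub> k"
proof -
  interpret A: assoc_algebra A by fact
  interpret B: assoc_algebra B by fact
  show ?thesis by (induction k) (simp_all add: algebra_homD[OF assms(3)] assms(4))
qed


section \<open>Linear extension and monoid algebras\<close>

lemma lookup_map_scale [simp]:
  "Poly_Mapping.lookup (Poly_Mapping.map ((*) c) p) a = c * Poly_Mapping.lookup p a"
  for c :: "'k::field"
  by (simp add: Poly_Mapping.map.rep_eq when_def)

lemma keys_map_scale: "Poly_Mapping.keys (Poly_Mapping.map ((*) c) p) \<subseteq> Poly_Mapping.keys p"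
  for c :: "'k::field"
  by (auto simp: in_keys_iff)

context assoc_algebra
begin

text \<open>\<open>linear_extension\<close> sums over the keys of its argument, and these change
  under addition and scaling. Rewriting it over a finite superset, where the extra coefficients are
  0, gives a common index set on which such sums can be compared.\<close>

lemma linear_extension_superset:
  assumes "finite S" "Poly_Mapping.keys p \<subseteq> S" "f \<in> S \<rightarrow> carrier A"
  shows "linear_extension A f p = (\<Oplus>a\<in>S. Poly_Mapping.lookup p a \<odot> f a)"
proof -
  have "f a \<in> carrier A" if "a \<in> S" for a using that assms(3) by blast
  then show ?thesis
    unfolding linear_extension_def using assms
    by (intro add.finprod_mono_neutral_cong_left) (auto simp: in_keys_iff Pi_def)
qed

lemma linear_extension_closed:
  "Poly_Mapping.keys p \<subseteq> S \<Longrightarrow> f \<in> S \<rightarrow> carrier A \<Longrightarrow> linear_extension A f p \<in> carrier A"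
  unfolding linear_extension_def by (intro finsum_closed) auto

lemma linear_extension_add:
  assumes "Poly_Mapping.keys p \<subseteq> S" "Poly_Mapping.keys r \<subseteq> S" "f \<in> S \<rightarrow> carrier A"
  shows "linear_extension A f (p + r) = linear_extension A f p \<oplus> linear_extension A f r"
proof -
  let ?T = "Poly_Mapping.keys p \<union> Poly_Mapping.keys r"
  have f: "f \<in> ?T \<rightarrow> carrier A" using assms by blast
  have "Poly_Mapping.keys (p + r) \<subseteq> ?T" by (rule Poly_Mapping.keys_add)
  then have "linear_extension A f (p + r) = (\<Oplus>a\<in>?T. Poly_Mapping.lookup (p + r) a \<odot> f a)"
    using f by (intro linear_extension_superset) auto
  also have "\<dots> = (\<Oplus>a\<in>?T. Poly_Mapping.lookup p a \<odot> f a \<oplus> Poly_Mapping.lookup r a \<odot> f a)"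
    using f by (intro finsum_cong') (auto simp: lookup_add scale_add_left Pi_iff)
  also have "\<dots> = (\<Oplus>a\<in>?T. Poly_Mapping.lookup p a \<odot> f a) \<oplus> (\<Oplus>a\<in>?T. Poly_Mapping.lookup r a \<odot> f a)"
    using f by (intro finsum_addf) auto
  also have "\<dots> = linear_extension A f p \<oplus> linear_extension A f r"
    using f linear_extension_superset[of ?T p f] linear_extension_superset[of ?T r f] by simp
  finally show ?thesis .
qed

lemma linear_extension_scale:
  assumes "Poly_Mapping.keys p \<subseteq> S" "f \<in> S \<rightarrow> carrier A"
  shows "linear_extension A f (Poly_Mapping.map ((*) c) p) = c \<odot> linear_extension A f p"
proof -
  let ?T = "Poly_Mapping.keys p"
  have f: "f \<in> ?T \<rightarrow> carrier A" using assms by blast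
  have "linear_extension A f (Poly_Mapping.map ((*) c) p)
      = (\<Oplus>a\<in>?T. Poly_Mapping.lookup (Poly_Mapping.map ((*) c) p) a \<odot> f a)"
    using f by (intro linear_extension_superset keys_map_scale) auto
  also have "\<dots> = (\<Oplus>a\<in>?T. c \<odot> (Poly_Mapping.lookup p a \<odot> f a))"
    using f by (intro finsum_cong') (auto simp: Pi_iff)
  also have "\<dots> = c \<odot> linear_extension A f p"
    unfolding linear_extension_def using f by (intro scale_finsum [symmetric]) auto
  finally show ?thesis .
qed

lemma linear_extension_single [simp]:
  "f a \<in> carrier A \<Longrightarrow> linear_extension A f (Poly_Mapping.single a c) = c \<odot> f a"
  using linear_extension_superset[of "{a}" "Poly_Mapping.single a c" f] by simp

end

lemma monoid_algebra_simps [simp]: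
  "carrier (monoid_algebra M :: ('k::field, 'm \<Rightarrow>\<^sub>0 'k) module) = {p. Poly_Mapping.keys p \<subseteq> carrier M}"
  "\<one>\<^bsub>monoid_algebra M :: ('k::field, 'm \<Rightarrow>\<^sub>0 'k) module\<^esub> = Poly_Mapping.single \<one>\<^bsub>M\<^esub> 1"
  "\<zero>\<^bsub>monoid_algebra M :: ('k::field, 'm \<Rightarrow>\<^sub>0 'k) module\<^esub> = 0"
  "add (monoid_algebra M :: ('k::field, 'm \<Rightarrow>\<^sub>0 'k) module) = (+)"
  "module.smult (monoid_algebra M :: ('k::field, 'm \<Rightarrow>\<^sub>0 'k) module) = (\<lambda>c. Poly_Mapping.map ((*) c))"
  by (simp_all add: monoid_algebra_def)

text \<open>Counterpart for products of the rewriting of \<open>linear_extension\<close>: once the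
  factors are spread over common finite index sets, distributivity is termwise.\<close>

lemma monoid_algebra_mult_superset:
  assumes "finite S" "finite T" "Poly_Mapping.keys p \<subseteq> S" "Poly_Mapping.keys r \<subseteq> T"
  shows "p \<otimes>\<^bsub>monoid_algebra M :: ('k::field, 'm \<Rightarrow>\<^sub>0 'k) module\<^esub> r = (\<Sum>a\<in>S. \<Sum>b\<in>T.
    Poly_Mapping.single (a \<otimes>\<^bsub>M\<^esub> b) (Poly_Mapping.lookup p a * Poly_Mapping.lookup r b))"
proof -
  have "(\<Sum>b\<in>T. Poly_Mapping.single (a \<otimes>\<^bsub>M\<^esub> b) (Poly_Mapping.lookup p a * Poly_Mapping.lookup r b))
      = (\<Sum>b\<in>Poly_Mapping.keys r. Poly_Mapping.single (a \<otimes>\<^bsub>M\<^esub> b) (Poly_Mapping.lookup p a * Poly_Mapping.lookup r b))"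
    for a using assms by (intro sum.mono_neutral_right) (auto simp: in_keys_iff)
  then show ?thesis
    unfolding monoid_algebra_def using assms
    by (simp, intro sum.mono_neutral_left) (auto simp: in_keys_iff)
qed

lemma monoid_algebra_mult_single [simp]:
  "Poly_Mapping.single a c \<otimes>\<^bsub>monoid_algebra M :: ('k::field, 'm \<Rightarrow>\<^sub>0 'k) module\<^esub> Poly_Mapping.single b d
    = Poly_Mapping.single (a \<otimes>\<^bsub>M\<^esub> b) (c * d)"
  by (subst monoid_algebra_mult_superset[of "{a}" "{b}"]) auto

lemma monoid_algebra_mult_add_left:
  "(p + r) \<otimes>\<^bsub>monoid_algebra M :: ('k::field, 'm \<Rightarrow>\<^sub>0 'k) module\<^esub> s
    = p \<otimes>\<^bsub>monoid_algebra M\<^esub> s + r \<otimes>\<^bsub>monoid_algebra M\<^esub> s"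
proof -
  have "Poly_Mapping.keys (p + r) \<subseteq> Poly_Mapping.keys p \<union> Poly_Mapping.keys r"
    by (rule Poly_Mapping.keys_add)
  then show ?thesis
    by (subst (1 2 3) monoid_algebra_mult_superset[of "Poly_Mapping.keys p \<union> Poly_Mapping.keys r"
          "Poly_Mapping.keys s"]) (auto simp: lookup_add distrib_right single_add sum.distrib)
qed

lemma monoid_algebra_mult_add_right:
  "s \<otimes>\<^bsub>monoid_algebra M :: ('k::field, 'm \<Rightarrow>\<^sub>0 'k) module\<^esub> (p + r)
    = s \<otimes>\<^bsub>monoid_algebra M\<^esub> p + s \<otimes>\<^bsub>monoid_algebra M\<^esub> r"
proof -
  have "Poly_Mapping.keys (p + r) \<subseteq> Poly_Mapping.keys p \<union> Poly_Mapping.keys r"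
    by (rule Poly_Mapping.keys_add)
  then show ?thesis
    by (subst (1 2 3) monoid_algebra_mult_superset[of "Poly_Mapping.keys s"
          "Poly_Mapping.keys p \<union> Poly_Mapping.keys r"])
      (auto simp: lookup_add distrib_left single_add sum.distrib)
qed

lemma monoid_algebra_mult_zero [simp]:
  "0 \<otimes>\<^bsub>monoid_algebra M :: ('k::field, 'm \<Rightarrow>\<^sub>0 'k) module\<^esub> p = 0"
  "p \<otimes>\<^bsub>monoid_algebra M :: ('k::field, 'm \<Rightarrow>\<^sub>0 'k) module\<^esub> 0 = 0"
  by (simp_all add: monoid_algebra_def)

lemma map_scale_add: "Poly_Mapping.map ((*) c) (p + r) = Poly_Mapping.map ((*) c) p + Poly_Mapping.map ((*) c) r"
  and map_scale_add_left: "Poly_Mapping.map ((*) (c + d)) p = Poly_Mapping.map ((*) c) p + Poly_Mapping.map ((*) d) p"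
  and map_scale_scale [simp]: "Poly_Mapping.map ((*) c) (Poly_Mapping.map ((*) d) p) = Poly_Mapping.map ((*) (c * d)) p"
  and map_scale_one [simp]: "Poly_Mapping.map ((*) 1) p = p"
  and map_scale_zero [simp]: "Poly_Mapping.map ((*) 0) p = 0"
  and map_scale_single [simp]: "Poly_Mapping.map ((*) c) (Poly_Mapping.single a d) = Poly_Mapping.single a (c * d)"
  for p :: "'m \<Rightarrow>\<^sub>0 'k::field"
  by (auto intro!: poly_mapping_eqI simp: lookup_add algebra_simps lookup_single when_def)

text \<open>Induction on the number of keys, splitting off one term. The bound S on the keys is
  carried along, so that carrier membership is available in every case.\<close>

lemma poly_mapping_induct_keys [consumes 1, case_names zero add]:
  fixes p :: "'m \<Rightarrow>\<^sub>0 'k::field"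
  assumes "Poly_Mapping.keys p \<subseteq> S" "P 0"
    and step: "\<And>a c p. a \<in> S \<Longrightarrow> Poly_Mapping.keys p \<subseteq> S \<Longrightarrow> P p \<Longrightarrow> P (Poly_Mapping.single a c + p)"
  shows "P p"
  using assms(1)
proof (induction "card (Poly_Mapping.keys p)" arbitrary: p rule: less_induct)
  case less
  show ?case
  proof (cases "Poly_Mapping.keys p = {}")
    case True
    then have "p = 0" by (auto intro!: poly_mapping_eqI simp: in_keys_iff set_eq_iff)
    then show ?thesis using assms(2) by simp
  next
    case False
    then obtain a where a: "a \<in> Poly_Mapping.keys p" by blast
    define r where "r = p - Poly_Mapping.single a (Poly_Mapping.lookup p a)"
    have k: "Poly_Mapping.keys r = Poly_Mapping.keys p - {a}"
      by (auto simp: r_def in_keys_iff lookup_minus lookup_single when_def split: if_splits)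
    then have "P r" using less.prems card_Diff1_less[OF finite_keys a] by (intro less.hyps) auto
    then have "P (Poly_Mapping.single a (Poly_Mapping.lookup p a) + r)"
      using a less k by (intro step) auto
    then show ?thesis by (simp add: r_def)
  qed
qed

lemma monoid_algebra_mult_scale:
  fixes p r :: "'m \<Rightarrow>\<^sub>0 'k::field"
  shows "Poly_Mapping.map ((*) c) p \<otimes>\<^bsub>monoid_algebra M :: ('k::field, 'm \<Rightarrow>\<^sub>0 'k) module\<^esub> r
      = Poly_Mapping.map ((*) c) (p \<otimes>\<^bsub>monoid_algebra M\<^esub> r)"
    and "p \<otimes>\<^bsub>monoid_algebra M :: ('k::field, 'm \<Rightarrow>\<^sub>0 'k) module\<^esub> Poly_Mapping.map ((*) c) r
      = Poly_Mapping.map ((*) c) (p \<otimes>\<^bsub>monoid_algebra M\<^esub> r)"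
proof -
  have *: "Poly_Mapping.map ((*) c) (sum f I) = (\<Sum>i\<in>I. Poly_Mapping.map ((*) c) (f i))"
    for f :: "'x \<Rightarrow> 'm \<Rightarrow>\<^sub>0 'k" and I
    by (intro poly_mapping_eqI) (simp add: lookup_sum sum_distrib_left)
  show "Poly_Mapping.map ((*) c) p \<otimes>\<^bsub>monoid_algebra M :: ('k::field, 'm \<Rightarrow>\<^sub>0 'k) module\<^esub> r
      = Poly_Mapping.map ((*) c) (p \<otimes>\<^bsub>monoid_algebra M\<^esub> r)"
    by (subst (1 2) monoid_algebra_mult_superset[of "Poly_Mapping.keys p" "Poly_Mapping.keys r"])
      (auto simp: * keys_map_scale mult_ac)
  show "p \<otimes>\<^bsub>monoid_algebra M :: ('k::field, 'm \<Rightarrow>\<^sub>0 'k) module\<^esub> Poly_Mapping.map ((*) c) r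
      = Poly_Mapping.map ((*) c) (p \<otimes>\<^bsub>monoid_algebra M\<^esub> r)"
    by (subst (1 2) monoid_algebra_mult_superset[of "Poly_Mapping.keys p" "Poly_Mapping.keys r"])
      (auto simp: * keys_map_scale mult_ac)
qed

text \<open>Closure, associativity and the unit laws are additive in each argument, so nested
  inductions reduce them to single terms, where they are the laws of the monoid.\<close>

lemma assoc_algebra_monoid_algebra:
  fixes M :: "('m, 'z) monoid_scheme" (structure)
  assumes "Group.monoid M"
  shows "assoc_algebra (monoid_algebra M :: ('k::field, 'm \<Rightarrow>\<^sub>0 'k) module)"
proof -
  interpret Group.monoid M by fact
  let ?A = "monoid_algebra M :: ('k::field, 'm \<Rightarrow>\<^sub>0 'k) module"
  have add_in: "p + r \<in> carrier ?A" if "p \<in> carrier ?A" "r \<in> carrier ?A" for p r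
    using that Poly_Mapping.keys_add[of p r] by auto
  have mult_in: "p \<otimes>\<^bsub>?A\<^esub> r \<in> carrier ?A" if "p \<in> carrier ?A" "r \<in> carrier ?A" for p r
  proof -
    have "Poly_Mapping.keys p \<subseteq> carrier M" "Poly_Mapping.keys r \<subseteq> carrier M" using that by auto
    then show ?thesis
    proof (induction p rule: poly_mapping_induct_keys)
      case (add a c p)
      have "Poly_Mapping.single a c \<otimes>\<^bsub>?A\<^esub> r \<in> carrier ?A"
        using add(4) by (induction r rule: poly_mapping_induct_keys)
          (use add(1) in \<open>auto simp: monoid_algebra_mult_add_right dest!: subsetD[OF Poly_Mapping.keys_add] split: if_splits\<close>)
      then show ?case using add by (simp only: monoid_algebra_mult_add_left) (intro add_in, auto)
    qed simp
  qed
  have assoc: "p \<otimes>\<^bsub>?A\<^esub> r \<otimes>\<^bsub>?A\<^esub> s = p \<otimes>\<^bsub>?A\<^esub> (r \<otimes>\<^bsub>?A\<^esub> s)"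
    if "p \<in> carrier ?A" "r \<in> carrier ?A" "s \<in> carrier ?A" for p r s
  proof -
    have "Poly_Mapping.keys p \<subseteq> carrier M" "Poly_Mapping.keys r \<subseteq> carrier M"
      "Poly_Mapping.keys s \<subseteq> carrier M" using that by auto
    then show ?thesis
    proof (induction p rule: poly_mapping_induct_keys)
      case (add a c p)
      have "Poly_Mapping.single a c \<otimes>\<^bsub>?A\<^esub> r \<otimes>\<^bsub>?A\<^esub> s = Poly_Mapping.single a c \<otimes>\<^bsub>?A\<^esub> (r \<otimes>\<^bsub>?A\<^esub> s)"
        using add(4)
      proof (induction r rule: poly_mapping_induct_keys)
        case (add b d r)
        have "Poly_Mapping.single a c \<otimes>\<^bsub>?A\<^esub> Poly_Mapping.single b d \<otimes>\<^bsub>?A\<^esub> s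
            = Poly_Mapping.single a c \<otimes>\<^bsub>?A\<^esub> (Poly_Mapping.single b d \<otimes>\<^bsub>?A\<^esub> s)"
          using \<open>Poly_Mapping.keys s \<subseteq> carrier M\<close>
          by (induction s rule: poly_mapping_induct_keys)
            (use \<open>a \<in> carrier M\<close> \<open>b \<in> carrier M\<close> in \<open>simp_all add: monoid_algebra_mult_add_right m_assoc mult_ac\<close>)
        with add show ?case by (simp add: monoid_algebra_mult_add_right monoid_algebra_mult_add_left)
      qed simp
      with add show ?case by (simp add: monoid_algebra_mult_add_left)
    qed simp
  qed
  have one: "Poly_Mapping.single \<one> 1 \<otimes>\<^bsub>?A\<^esub> p = p" "p \<otimes>\<^bsub>?A\<^esub> Poly_Mapping.single \<one> 1 = p"
    if "p \<in> carrier ?A" for p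
  proof -
    have "Poly_Mapping.keys p \<subseteq> carrier M" using that by auto
    then show "Poly_Mapping.single \<one> 1 \<otimes>\<^bsub>?A\<^esub> p = p" "p \<otimes>\<^bsub>?A\<^esub> Poly_Mapping.single \<one> 1 = p"
      by (induction p rule: poly_mapping_induct_keys)
        (simp_all add: monoid_algebra_mult_add_right monoid_algebra_mult_add_left)
  qed
  have scale_in: "c \<odot>\<^bsub>?A\<^esub> p \<in> carrier ?A" if "p \<in> carrier ?A" for c p
    using that keys_map_scale[of c p] by auto
  show ?thesis
    by (rule assoc_algebraI) (use add_in mult_in scale_in assoc one in \<open>simp_all add: map_scale_add map_scale_add_left monoid_algebra_mult_scale monoid_algebra_mult_add_left
        monoid_algebra_mult_add_right ac_simps\<close>)
qed

lemma (in assoc_algebra) linear_extension_linear: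
  "f \<in> carrier M \<rightarrow> carrier A \<Longrightarrow> linear_extension A f \<in> linear_hom (monoid_algebra M) A"
  by (intro linear_homI) (auto intro: linear_extension_closed linear_extension_add linear_extension_scale)

lemma monoid_algebra_minus:
  assumes "Group.monoid M" "p \<in> carrier (monoid_algebra M :: ('k::field, 'm \<Rightarrow>\<^sub>0 'k) module)"
    "r \<in> carrier (monoid_algebra M :: ('k::field, 'm \<Rightarrow>\<^sub>0 'k) module)"
  shows "p \<ominus>\<^bsub>monoid_algebra M\<^esub> r = p - r"
proof -
  interpret assoc_algebra "monoid_algebra M :: ('k, 'm \<Rightarrow>\<^sub>0 'k) module"
    by (rule assoc_algebra_monoid_algebra) fact
  have "- r \<in> carrier (monoid_algebra M :: ('k, 'm \<Rightarrow>\<^sub>0 'k) module)"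
    using assms(3) by (auto simp: in_keys_iff subset_iff)
  then have "\<ominus>\<^bsub>monoid_algebra M\<^esub> r = - r"
    using assms(3) by (intro minus_equality) auto
  then show ?thesis by (simp add: a_minus_def)
qed

lemma monoid_algebra_hom_eqI:
  assumes "Group.monoid M" "assoc_algebra B"
    "f \<in> linear_hom (monoid_algebra M :: ('k::field, 'm \<Rightarrow>\<^sub>0 'k) module) B"
    "g \<in> linear_hom (monoid_algebra M :: ('k::field, 'm \<Rightarrow>\<^sub>0 'k) module) B"
    and eq: "\<And>a. a \<in> carrier M \<Longrightarrow> f (Poly_Mapping.single a 1) = g (Poly_Mapping.single a 1)"
    and "Poly_Mapping.keys p \<subseteq> carrier M"
  shows "f p = g p"
  using assms(6)
proof (induction p rule: poly_mapping_induct_keys)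
  case zero
  show ?case
    using linear_hom_zero[OF assoc_algebra_monoid_algebra[OF assms(1)] assms(2,3)]
      linear_hom_zero[OF assoc_algebra_monoid_algebra[OF assms(1)] assms(2,4)] by simp
next
  case (add a c p)
  have s: "Poly_Mapping.single a c = c \<odot>\<^bsub>monoid_algebra M\<^esub> Poly_Mapping.single a 1" by simp
  have "f (Poly_Mapping.single a c) = g (Poly_Mapping.single a c)"
    unfolding s using add(1)
    by (subst linear_homD(3)[OF assms(3)] linear_homD(3)[OF assms(4)], simp)+ (simp add: eq)
  then show ?case
    using add linear_homD(2)[OF assms(3), of "Poly_Mapping.single a c" p]
      linear_homD(2)[OF assms(4), of "Poly_Mapping.single a c" p] by auto
qed

section \<open>Quotient algebras\<close>

lemma linear_hom_cong:
  assumes "\<And>a. a \<in> carrier A \<Longrightarrow> f a = g a" "assoc_algebra A"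
  shows "f \<in> linear_hom A B \<longleftrightarrow> g \<in> linear_hom A B"
proof -
  interpret assoc_algebra A by fact
  show ?thesis using assms(1) by (auto simp: linear_hom_def Pi_iff)
qed

lemma linear_hom_congI:
  assumes "g \<in> linear_hom A B" "assoc_algebra A" "\<And>a. a \<in> carrier A \<Longrightarrow> f a = g a"
  shows "f \<in> linear_hom A B"
  using linear_hom_cong[where f = f and g = g and B = B, OF assms(3,2)] assms(1) by simp

lemma linear_hom_zero_map: "assoc_algebra B \<Longrightarrow> (\<lambda>a. \<zero>\<^bsub>B\<^esub>) \<in> linear_hom A B"
proof -
  assume "assoc_algebra B"
  then interpret assoc_algebra B .
  show ?thesis by (auto simp: linear_hom_def)
qed

lemma quot_algebra_simps:
  "carrier (quot_algebra A I) = a_rcosets\<^bsub>A\<^esub> I"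
  "monoid.mult (quot_algebra A I) = rcoset_mult A I"
  "\<one>\<^bsub>quot_algebra A I\<^esub> = I +>\<^bsub>A\<^esub> \<one>\<^bsub>A\<^esub>"
  "\<zero>\<^bsub>quot_algebra A I\<^esub> = I"
  "add (quot_algebra A I) = set_add A"
  "c \<odot>\<^bsub>quot_algebra A I\<^esub> B = (\<Union>a\<in>B. I +>\<^bsub>A\<^esub> (c \<odot>\<^bsub>A\<^esub> a))"
  by (simp_all add: quot_algebra_def FactRing_def ring.defs module.defs)

context assoc_algebra
begin

text \<open>Scaling by c is multiplication by \<open>c \<odot> \<one>\<close>, so absorption
  applies.\<close>

lemma ideal_scale_closed: "ideal I A \<Longrightarrow> a \<in> I \<Longrightarrow> c \<odot> a \<in> I"
proof -
  assume I: "ideal I A" and a: "a \<in> I"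
  interpret I: ideal I A by fact
  have "(c \<odot> \<one>) \<otimes> a \<in> I" using a by (intro I.I_l_closed) auto
  then show ?thesis using I.a_Hcarr[OF a] by (simp add: smult_mult_left)
qed

text \<open>All cosets united in the definition of the quotient action coincide: two representatives
  differ by an element of I, and scaling keeps that element in I.\<close>

lemma quot_scale:
  assumes "ideal I A" "a \<in> carrier A"
  shows "c \<odot>\<^bsub>quot_algebra A I\<^esub> (I +> a) = I +> (c \<odot> a)"
proof -
  interpret I: ideal I A by fact
  have "I +> (c \<odot> b) = I +> (c \<odot> a)" if b: "b \<in> I +> a" for b
  proof -
    obtain i where i: "i \<in> I" "b = i \<oplus> a" using b by (auto simp: a_r_coset_def')
    have "i \<in> carrier A" using i by (simp add: I.a_Hcarr)
    then have "c \<odot> b \<ominus> c \<odot> a = c \<odot> i" using i assms(2)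
      by (simp add: scale_add_right a_minus_def a_assoc r_neg)
    then have "c \<odot> b \<ominus> c \<odot> a \<in> I" using i by (simp add: ideal_scale_closed assms(1))
    then show ?thesis
      using assms i \<open>i \<in> carrier A\<close> by (subst (asm) quotient_eq_iff_same_a_r_cos) auto
  qed
  then have "(\<Union>b\<in>I +> a. I +> (c \<odot> b)) = (\<Union>b\<in>I +> a. I +> (c \<odot> a))"
    by (intro SUP_cong refl)
  moreover have "a \<in> I +> a" using assms(2) by (rule I.a_rcos_self)
  ultimately show ?thesis by (simp only: quot_algebra_simps) blast
qed

lemma carrier_quot_algebra:
  assumes "ideal I A"
  shows "carrier (quot_algebra A I) = (\<lambda>a. I +> a) ` carrier A"
  by (auto simp: quot_algebra_simps A_RCOSETS_def')

lemma assoc_algebra_quot: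
  assumes "ideal I A"
  shows "assoc_algebra (quot_algebra A I)"
proof -
  interpret I: ideal I A by fact
  note simps = carrier_quot_algebra[OF assms] quot_scale[OF assms] quot_algebra_simps(2-5)
    I.rcoset_mult_add I.a_rcos_sum
  have zero: "I = I +> \<zero>" using a_coset_add_zero[OF I.a_subset] by simp
  have zero_in: "I \<in> (\<lambda>a. I +> a) ` carrier A" using zero zero_closed by (rule image_eqI)
  have plus_zero: "I <+> (I +> a) = I +> a" if "a \<in> carrier A" for a
    using I.a_rcos_sum[OF zero_closed that] that by (simp add: zero [symmetric])
  show ?thesis
  proof (rule assoc_algebraI)
    fix B assume "B \<in> carrier (quot_algebra A I)"
    then show "0 \<odot>\<^bsub>quot_algebra A I\<^esub> B = \<zero>\<^bsub>quot_algebra A I\<^esub>"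
      by (auto simp: simps zero [symmetric])
  qed (auto simp: simps plus_zero zero_in a_ac m_assoc l_distr r_distr smult_mult_left smult_mult_right
      scale_add_left scale_add_right)
qed

lemma quot_proj_hom:
  assumes "ideal I A"
  shows "(\<lambda>a. I +> a) \<in> algebra_hom A (quot_algebra A I)"
  by (intro algebra_homI linear_homI)
    (auto simp: carrier_quot_algebra[OF assms] quot_scale[OF assms]
      quot_algebra_simps(2,3,5) ideal.rcoset_mult_add[OF assms]
      abelian_subgroup.a_rcos_sum[OF abelian_subgroupI3[OF ideal.axioms(1)[OF assms] is_abelian_group]])

lemma quot_proj_eq_iff:
  assumes "ideal I A" "a \<in> carrier A" "b \<in> carrier A"
  shows "I +> a = I +> b \<longleftrightarrow> a \<ominus> b \<in> I"
  using quotient_eq_iff_same_a_r_cos[OF assms] by simp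

text \<open>f is constant on each coset of I, so the image of a coset is a singleton and
  \<open>the_elem\<close> returns the common value. Both \<open>tensor_lift\<close> and
  \<open>presented_lift\<close> are evaluated through this.\<close>

lemma quot_lift_eq:
  assumes "ideal I A" "assoc_algebra V" "f \<in> linear_hom A V"
    and "\<And>p. p \<in> I \<Longrightarrow> f p = \<zero>\<^bsub>V\<^esub>" "a \<in> carrier A"
  shows "the_elem (f ` (I +> a)) = f a"
proof -
  interpret I: ideal I A by fact
  interpret V: assoc_algebra V by fact
  have "f b = f a" if b: "b \<in> I +> a" for b
  proof -
    obtain i where i: "i \<in> I" "b = i \<oplus> a" using b by (auto simp: a_r_coset_def')
    then show ?thesis
      using linear_homD[OF assms(3)] assms(4,5) I.a_Hcarr[OF i(1)] by simp
  qed
  moreover have "a \<in> I +> a" using assms(5) by (rule I.a_rcos_self)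
  ultimately have "f ` (I +> a) = {f a}" by blast
  then show ?thesis by simp
qed

text \<open>The kernel of a single linear map has no reason to be an ideal. For a family stable
  under translation, \<open>f (a \<otimes> x)\<close> is the value at x of another member, so the
  common zeros absorb products. This bounds a generated ideal from above by maps that are not
  multiplicative.\<close>

lemma ideal_common_kernel:
  assumes "assoc_algebra V" and F: "F \<subseteq> linear_hom A V"
    and left: "\<And>f a. f \<in> F \<Longrightarrow> a \<in> carrier A \<Longrightarrow> (\<lambda>x. f (a \<otimes> x)) \<in> F"
    and right: "\<And>f a. f \<in> F \<Longrightarrow> a \<in> carrier A \<Longrightarrow> (\<lambda>x. f (x \<otimes> a)) \<in> F"
  shows "ideal {a \<in> carrier A. \<forall>f\<in>F. f a = \<zero>\<^bsub>V\<^esub>} A"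
proof (rule idealI)
  interpret V: assoc_algebra V by fact
  note lin = linear_homD[OF subsetD[OF F]]
  note z = linear_hom_zero[OF assoc_algebra_axioms assms(1) subsetD[OF F]]
  note mi = linear_hom_minus[OF assoc_algebra_axioms assms(1) subsetD[OF F]]
  show "ring A" by (rule ring_axioms)
  show "subgroup {a \<in> carrier A. \<forall>f\<in>F. f a = \<zero>\<^bsub>V\<^esub>} (add_monoid A)"
    by (rule add.subgroupI) (auto simp: lin mi a_inv_def[symmetric] intro!: exI[of _ \<zero>] z)
  fix a x assume a: "a \<in> {a \<in> carrier A. \<forall>f\<in>F. f a = \<zero>\<^bsub>V\<^esub>}" and x: "x \<in> carrier A"
  show "x \<otimes> a \<in> {a \<in> carrier A. \<forall>f\<in>F. f a = \<zero>\<^bsub>V\<^esub>}"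
    using a x left by fastforce
  show "a \<otimes> x \<in> {a \<in> carrier A. \<forall>f\<in>F. f a = \<zero>\<^bsub>V\<^esub>}"
    using a x right by fastforce
qed

end

lemma ideal_kernel:
  assumes "assoc_algebra A" "assoc_algebra B" "f \<in> algebra_hom A B"
  shows "ideal {a \<in> carrier A. f a = \<zero>\<^bsub>B\<^esub>} A"
proof -
  interpret ring_hom_ring A B f
    using assms by (intro ring_hom_ringI2 algebra_homD) (simp_all add: assoc_algebra_def)
  show ?thesis using kernel_is_ideal unfolding a_kernel_def' .
qed


section \<open>Tensor products\<close>

definition bilinear_maps ::
  "('k::field, 'a, 'x) module_scheme \<Rightarrow> ('k, 'b, 'y) module_scheme \<Rightarrow> ('k, 'c, 'z) module_scheme
    \<Rightarrow> ('a \<Rightarrow> 'b \<Rightarrow> 'c) set" where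
  "bilinear_maps A B V = {f. (\<forall>a\<in>carrier A. f a \<in> linear_hom B V) \<and>
     (\<forall>b\<in>carrier B. (\<lambda>a. f a b) \<in> linear_hom A V)}"

lemma bilinear_mapsI:
  assumes "\<And>a. a \<in> carrier A \<Longrightarrow> f a \<in> linear_hom B V"
    "\<And>b. b \<in> carrier B \<Longrightarrow> (\<lambda>a. f a b) \<in> linear_hom A V"
  shows "f \<in> bilinear_maps A B V"
  using assms by (auto simp: bilinear_maps_def)

lemma bilinear_mapsD:
  assumes "f \<in> bilinear_maps A B V"
  shows "a \<in> carrier A \<Longrightarrow> f a \<in> linear_hom B V" "b \<in> carrier B \<Longrightarrow> (\<lambda>a. f a b) \<in> linear_hom A V"
    "a \<in> carrier A \<Longrightarrow> b \<in> carrier B \<Longrightarrow> f a b \<in> carrier V"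
  using assms by (auto simp: bilinear_maps_def linear_hom_def)

lemma bilinear_maps_precomp:
  assumes "f \<in> bilinear_maps C D V" "g \<in> linear_hom A C" "h \<in> linear_hom B D"
  shows "(\<lambda>a b. f (g a) (h b)) \<in> bilinear_maps A B V"
  by (intro bilinear_mapsI linear_hom_comp[OF assms(2)] linear_hom_comp[OF assms(3)]
      bilinear_mapsD[OF assms(1)] linear_homD(1)[OF assms(2)] linear_homD(1)[OF assms(3)])

lemma bilinear_mult:
  assumes "assoc_algebra A"
  shows "(\<lambda>a b. a \<otimes>\<^bsub>A\<^esub> b) \<in> bilinear_maps A A A"
  by (intro bilinear_mapsI linear_hom_mult_left[OF assms linear_hom_id(2)]
      linear_hom_mult_right[OF assms linear_hom_id(2)])

locale algebra_pair = A: assoc_algebra A + B: assoc_algebra B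
  for A :: "('k::field, 'a, 'y) module_scheme" and B :: "('k, 'b, 'z) module_scheme"
begin

abbreviation F :: "('k, 'a \<times> 'b \<Rightarrow>\<^sub>0 'k) module" where "F \<equiv> monoid_algebra (A \<times>\<times> B)"

lemma monoid_DirProd: "Group.monoid (A \<times>\<times> B)"
  by (rule DirProd_monoid) (rule A.monoid_axioms B.monoid_axioms)+

sublocale F: assoc_algebra F
  by (rule assoc_algebra_monoid_algebra) (rule monoid_DirProd)

lemma tensor_relations_carrier: "tensor_relations A B \<subseteq> carrier F"
proof -
  have *: "p - r \<in> carrier F" if "p \<in> carrier F" "r \<in> carrier F" for p r
    using F.minus_closed[OF that] by (simp only: monoid_algebra_minus[OF monoid_DirProd that])
  show ?thesis unfolding tensor_relations_def by (intro Un_least) (safe intro!: *, auto)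
qed

sublocale I: ideal "tensor_ideal A B" F
  unfolding tensor_ideal_def by (rule F.genideal_ideal) (rule tensor_relations_carrier)

sublocale T: assoc_algebra "tensor A B"
  unfolding tensor_def by (rule F.assoc_algebra_quot) (rule I.ideal_axioms)

abbreviation pure where "pure \<equiv> pure_tensor A B"

lemma proj_hom: "(\<lambda>p. tensor_ideal A B +>\<^bsub>F\<^esub> p) \<in> algebra_hom F (tensor A B)"
  unfolding tensor_def by (rule F.quot_proj_hom) (rule I.ideal_axioms)

lemma relation_eq:
  assumes "p - r \<in> tensor_relations A B" "p \<in> carrier F" "r \<in> carrier F"
  shows "tensor_ideal A B +>\<^bsub>F\<^esub> p = tensor_ideal A B +>\<^bsub>F\<^esub> r"
  using assms F.genideal_self[OF tensor_relations_carrier]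
  by (subst F.quot_proj_eq_iff[OF I.ideal_axioms])
    (auto simp: monoid_algebra_minus[OF monoid_DirProd] tensor_ideal_def)

lemma pure_closed [simp, intro]:
  "a \<in> carrier A \<Longrightarrow> b \<in> carrier B \<Longrightarrow> pure a b \<in> carrier (tensor A B)"
  unfolding pure_tensor_def by (rule algebra_homD(4)[OF proj_hom]) auto

lemma proj_add:
  "p \<in> carrier F \<Longrightarrow> r \<in> carrier F \<Longrightarrow>
   (tensor_ideal A B +>\<^bsub>F\<^esub> p) \<oplus>\<^bsub>tensor A B\<^esub> (tensor_ideal A B +>\<^bsub>F\<^esub> r) = tensor_ideal A B +>\<^bsub>F\<^esub> (p + r)"
  using algebra_homD(5)[OF proj_hom, of p r] by simp

lemma proj_scale:
  "p \<in> carrier F \<Longrightarrow> c \<odot>\<^bsub>tensor A B\<^esub> (tensor_ideal A B +>\<^bsub>F\<^esub> p)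
    = tensor_ideal A B +>\<^bsub>F\<^esub> Poly_Mapping.map ((*) c) p"
  using algebra_homD(6)[OF proj_hom, of p c] by simp

lemma keys_single_add:
  "a \<in> S \<Longrightarrow> b \<in> S \<Longrightarrow> Poly_Mapping.keys (Poly_Mapping.single a c + Poly_Mapping.single b d) \<subseteq> S"
  by (rule order_trans[OF Poly_Mapping.keys_add]) auto

lemma pure_bilinear: "pure \<in> bilinear_maps A B (tensor A B)"
proof (intro bilinear_mapsI linear_homI)
  fix a b b' assume "a \<in> carrier A" "b \<in> carrier B" "b' \<in> carrier B"
  moreover from this have "Poly_Mapping.single (a, b \<oplus>\<^bsub>B\<^esub> b') 1
      - (Poly_Mapping.single (a, b) 1 + Poly_Mapping.single (a, b') 1) \<in> tensor_relations A B"
    unfolding tensor_relations_def diff_diff_eq [symmetric] by blast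
  ultimately show "pure a (b \<oplus>\<^bsub>B\<^esub> b') = pure a b \<oplus>\<^bsub>tensor A B\<^esub> pure a b'"
    by (simp add: pure_tensor_def proj_add relation_eq keys_single_add)
next
  fix a a' b assume "a \<in> carrier A" "a' \<in> carrier A" "b \<in> carrier B"
  moreover from this have "Poly_Mapping.single (a \<oplus>\<^bsub>A\<^esub> a', b) 1
      - (Poly_Mapping.single (a, b) 1 + Poly_Mapping.single (a', b) 1) \<in> tensor_relations A B"
    unfolding tensor_relations_def diff_diff_eq [symmetric] by blast
  ultimately show "pure (a \<oplus>\<^bsub>A\<^esub> a') b = pure a b \<oplus>\<^bsub>tensor A B\<^esub> pure a' b"
    by (simp add: pure_tensor_def proj_add relation_eq keys_single_add)
next
  fix c a b assume "a \<in> carrier A" "b \<in> carrier B"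
  moreover from this have
    "Poly_Mapping.single (c \<odot>\<^bsub>A\<^esub> a, b) 1 - Poly_Mapping.single (a, b) c \<in> tensor_relations A B"
    "Poly_Mapping.single (a, c \<odot>\<^bsub>B\<^esub> b) 1 - Poly_Mapping.single (a, b) c \<in> tensor_relations A B"
    unfolding tensor_relations_def by blast+
  ultimately show "pure (c \<odot>\<^bsub>A\<^esub> a) b = c \<odot>\<^bsub>tensor A B\<^esub> pure a b"
    "pure a (c \<odot>\<^bsub>B\<^esub> b) = c \<odot>\<^bsub>tensor A B\<^esub> pure a b"
    by (simp_all add: pure_tensor_def proj_scale relation_eq)
qed auto

lemmas pure_add_left = linear_homD(2)[OF bilinear_mapsD(2)[OF pure_bilinear]]
  and pure_add_right = linear_homD(2)[OF bilinear_mapsD(1)[OF pure_bilinear]]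
  and pure_scale_left = linear_homD(3)[OF bilinear_mapsD(2)[OF pure_bilinear]]
  and pure_scale_right = linear_homD(3)[OF bilinear_mapsD(1)[OF pure_bilinear]]

lemma pure_mult [simp]:
  assumes "a \<in> carrier A" "a' \<in> carrier A" "b \<in> carrier B" "b' \<in> carrier B"
  shows "pure a b \<otimes>\<^bsub>tensor A B\<^esub> pure a' b' = pure (a \<otimes>\<^bsub>A\<^esub> a') (b \<otimes>\<^bsub>B\<^esub> b')"
  using assms algebra_homD(7)[OF proj_hom, of "Poly_Mapping.single (a, b) 1" "Poly_Mapping.single (a', b') 1"]
  by (simp add: pure_tensor_def)

lemma pure_one: "pure \<one>\<^bsub>A\<^esub> \<one>\<^bsub>B\<^esub> = \<one>\<^bsub>tensor A B\<^esub>"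
  using algebra_homD(3)[OF proj_hom] by (simp add: pure_tensor_def)

lemma pure_pow [simp]:
  "a \<in> carrier A \<Longrightarrow> b \<in> carrier B \<Longrightarrow>
    pure a b [^]\<^bsub>tensor A B\<^esub> (k::nat) = pure (a [^]\<^bsub>A\<^esub> k) (b [^]\<^bsub>B\<^esub> k)"
  by (induction k) (simp_all add: pure_one)

lemma pure_zero_left: "b \<in> carrier B \<Longrightarrow> pure \<zero>\<^bsub>A\<^esub> b = \<zero>\<^bsub>tensor A B\<^esub>"
  using linear_hom_zero[OF A.assoc_algebra_axioms T.assoc_algebra_axioms bilinear_mapsD(2)[OF pure_bilinear]] .

lemma pure_zero_right: "a \<in> carrier A \<Longrightarrow> pure a \<zero>\<^bsub>B\<^esub> = \<zero>\<^bsub>tensor A B\<^esub>"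
  using linear_hom_zero[OF B.assoc_algebra_axioms T.assoc_algebra_axioms bilinear_mapsD(1)[OF pure_bilinear]] .

lemma tensor_cases:
  assumes "t \<in> carrier (tensor A B)"
  obtains p where "p \<in> carrier F" "t = tensor_ideal A B +>\<^bsub>F\<^esub> p"
  using assms F.carrier_quot_algebra[OF I.ideal_axioms] by (auto simp: tensor_def)

text \<open>Scalars need no case of their own: a scalar multiple of a pure tensor is pure, the
  scalar moving into the first factor.\<close>

lemma tensor_induct [consumes 1, case_names zero add]:
  assumes t: "t \<in> carrier (tensor A B)" and zero: "P \<zero>\<^bsub>tensor A B\<^esub>"
    and add: "\<And>a b s. \<lbrakk>a \<in> carrier A; b \<in> carrier B; s \<in> carrier (tensor A B); P s\<rbrakk>
      \<Longrightarrow> P (pure a b \<oplus>\<^bsub>tensor A B\<^esub> s)"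
  shows "P t"
proof -
  obtain p where p: "p \<in> carrier F" and t': "t = tensor_ideal A B +>\<^bsub>F\<^esub> p"
    using t by (rule tensor_cases)
  have "Poly_Mapping.keys p \<subseteq> carrier (A \<times>\<times> B)" using p by simp
  then show ?thesis unfolding t'
  proof (induction p rule: poly_mapping_induct_keys)
    case zero
    show ?case
      using linear_hom_zero[OF F.assoc_algebra_axioms T.assoc_algebra_axioms algebra_homD(1)[OF proj_hom]]
        assms(2) by simp
  next
    case (add u c p)
    obtain a b where u: "u = (a, b)" "a \<in> carrier A" "b \<in> carrier B" using add(1) by auto
    have "tensor_ideal A B +>\<^bsub>F\<^esub> (Poly_Mapping.single u c + p)
        = (c \<odot>\<^bsub>tensor A B\<^esub> pure a b) \<oplus>\<^bsub>tensor A B\<^esub> (tensor_ideal A B +>\<^bsub>F\<^esub> p)"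
      using u add by (simp add: pure_tensor_def proj_scale proj_add)
    also have "c \<odot>\<^bsub>tensor A B\<^esub> pure a b = pure (c \<odot>\<^bsub>A\<^esub> a) b"
      using u by (simp add: pure_scale_left)
    finally show ?case
      using assms(3)[of "c \<odot>\<^bsub>A\<^esub> a" b] u add algebra_homD(4)[OF proj_hom] by simp
  qed
qed

lemma tensor_hom_eqI:
  assumes "assoc_algebra V" "f \<in> linear_hom (tensor A B) V" "g \<in> linear_hom (tensor A B) V"
    and "\<And>a b. a \<in> carrier A \<Longrightarrow> b \<in> carrier B \<Longrightarrow> f (pure a b) = g (pure a b)"
    and "t \<in> carrier (tensor A B)"
  shows "f t = g t"
  using assms(5)
  by (induction rule: tensor_induct)
    (simp_all add: linear_hom_zero[OF T.assoc_algebra_axioms assms(1)] assms(2-4) linear_homD(2)[OF assms(2)]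
      linear_homD(2)[OF assms(3)])

text \<open>
  The functionals on the free vector space that are bilinear in the basis pair are stable under
  translation by the multiplication, so their common kernel is an ideal and contains the one
  generated by the tensor relations.
\<close>

lemma linear_hom_F_bilinear_mult:
  assumes V: "assoc_algebra V" and \<phi>: "\<phi> \<in> linear_hom F V"
    and bil: "(\<lambda>a b. \<phi> (Poly_Mapping.single (a, b) 1)) \<in> bilinear_maps A B V" and s: "s \<in> carrier F"
  shows "(\<lambda>a b. \<phi> (s \<otimes>\<^bsub>F\<^esub> Poly_Mapping.single (a, b) 1)) \<in> bilinear_maps A B V"
    and "(\<lambda>a b. \<phi> (Poly_Mapping.single (a, b) 1 \<otimes>\<^bsub>F\<^esub> s)) \<in> bilinear_maps A B V"
proof -
  interpret V: assoc_algebra V by fact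
  let ?l = "\<lambda>s a b. \<phi> (s \<otimes>\<^bsub>F\<^esub> Poly_Mapping.single (a, b) 1)"
  let ?r = "\<lambda>s a b. \<phi> (Poly_Mapping.single (a, b) 1 \<otimes>\<^bsub>F\<^esub> s)"
  have "Poly_Mapping.keys s \<subseteq> carrier (A \<times>\<times> B)" using s by simp
  then have "?l s \<in> bilinear_maps A B V \<and> ?r s \<in> bilinear_maps A B V"
  proof (induction s rule: poly_mapping_induct_keys)
    case zero
    have "\<phi> 0 = \<zero>\<^bsub>V\<^esub>" using linear_hom_zero[OF F.assoc_algebra_axioms V \<phi>] by simp
    then show ?case by (auto intro!: bilinear_mapsI linear_hom_zero_map V)
  next
    case (add u c s)
    obtain x y where u: "u = (x, y)" "x \<in> carrier A" "y \<in> carrier B" using add(1) by auto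
    have sF: "s \<in> carrier F" using add by simp
    have single: "Poly_Mapping.single (a, b) c \<in> carrier F" if "a \<in> carrier A" "b \<in> carrier B" for a b c
      using that by simp
    have \<phi>s: "\<phi> (Poly_Mapping.single (a, b) c) = c \<odot>\<^bsub>V\<^esub> \<phi> (Poly_Mapping.single (a, b) 1)"
      if "a \<in> carrier A" "b \<in> carrier B" for a b c
      using linear_homD(3)[OF \<phi>, of "Poly_Mapping.single (a, b) 1" c] that by simp
    \<comment> \<open>Multiplying by the single pair (x, y) replaces (a, b) by a pair of products,
      which is a precomposition with a linear map in each variable. The other summand is covered by
      the induction hypothesis.\<close>
    have l: "?l (Poly_Mapping.single u c + s) a b
        = c \<odot>\<^bsub>V\<^esub> \<phi> (Poly_Mapping.single (x \<otimes>\<^bsub>A\<^esub> a, y \<otimes>\<^bsub>B\<^esub> b) 1) \<oplus>\<^bsub>V\<^esub> ?l s a b"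
      and r: "?r (Poly_Mapping.single u c + s) a b
        = c \<odot>\<^bsub>V\<^esub> \<phi> (Poly_Mapping.single (a \<otimes>\<^bsub>A\<^esub> x, b \<otimes>\<^bsub>B\<^esub> y) 1) \<oplus>\<^bsub>V\<^esub> ?r s a b"
      if ab: "a \<in> carrier A" "b \<in> carrier B" for a b
      using linear_homD(2)[OF \<phi> single[of "x \<otimes>\<^bsub>A\<^esub> a" "y \<otimes>\<^bsub>B\<^esub> b" c] F.m_closed[OF sF single[OF ab, of 1]]]
        linear_homD(2)[OF \<phi> single[of "a \<otimes>\<^bsub>A\<^esub> x" "b \<otimes>\<^bsub>B\<^esub> y" c] F.m_closed[OF single[OF ab, of 1] sF]]
        u ab \<phi>s[of "x \<otimes>\<^bsub>A\<^esub> a" "y \<otimes>\<^bsub>B\<^esub> b" c] \<phi>s[of "a \<otimes>\<^bsub>A\<^esub> x" "b \<otimes>\<^bsub>B\<^esub> y" c]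
      by (simp_all add: monoid_algebra_mult_add_left monoid_algebra_mult_add_right)
    note lin = linear_hom_id(2) linear_hom_mult_left linear_hom_mult_right
      A.assoc_algebra_axioms B.assoc_algebra_axioms
    have bl: "(\<lambda>a b. \<phi> (Poly_Mapping.single (x \<otimes>\<^bsub>A\<^esub> a, y \<otimes>\<^bsub>B\<^esub> b) 1)) \<in> bilinear_maps A B V"
      using u by (intro bilinear_maps_precomp[OF bil] lin)
    have br: "(\<lambda>a b. \<phi> (Poly_Mapping.single (a \<otimes>\<^bsub>A\<^esub> x, b \<otimes>\<^bsub>B\<^esub> y) 1)) \<in> bilinear_maps A B V"
      using u by (intro bilinear_maps_precomp[OF bil] lin)
    note D = bilinear_mapsD(1,2)[OF bl] bilinear_mapsD(1,2)[OF br]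
      bilinear_mapsD(1,2)[OF conjunct1[OF add(3)]] bilinear_mapsD(1,2)[OF conjunct2[OF add(3)]]
    show ?case
      by (intro conjI bilinear_mapsI;
          subst linear_hom_cong[OF l] linear_hom_cong[OF r];
          (intro linear_hom_add linear_hom_scale D V | rule A.assoc_algebra_axioms B.assoc_algebra_axioms)?)
  qed
  then show "?l s \<in> bilinear_maps A B V" "?r s \<in> bilinear_maps A B V" by auto
qed

text \<open>This is the well-definedness of \<open>tensor_lift\<close>: the linear extension of f
  vanishes on the ideal by which the free space is divided.\<close>

lemma tensor_ideal_bilinear:
  assumes V: "assoc_algebra V" and f: "f \<in> bilinear_maps A B V" and p: "p \<in> tensor_ideal A B"
  shows "linear_extension V (case_prod f) p = \<zero>\<^bsub>V\<^esub>"
proof -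
  interpret V: assoc_algebra V by fact
  define G where "G = {\<phi> \<in> linear_hom F V. (\<lambda>a b. \<phi> (Poly_Mapping.single (a, b) 1)) \<in> bilinear_maps A B V}"
  let ?J = "{a \<in> carrier F. \<forall>\<phi>\<in>G. \<phi> a = \<zero>\<^bsub>V\<^esub>}"
  have J: "ideal ?J F"
  proof (rule F.ideal_common_kernel[OF V])
    show "G \<subseteq> linear_hom F V" by (auto simp: G_def)
    fix \<phi> s assume \<phi>: "\<phi> \<in> G" and s: "s \<in> carrier F"
    have "(\<lambda>x. \<phi> (s \<otimes>\<^bsub>F\<^esub> x)) \<in> linear_hom F V" "(\<lambda>x. \<phi> (x \<otimes>\<^bsub>F\<^esub> s)) \<in> linear_hom F V"
      using \<phi> linear_hom_comp[OF linear_hom_mult_left[OF F.assoc_algebra_axioms linear_hom_id(2) s]]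
        linear_hom_comp[OF linear_hom_mult_right[OF F.assoc_algebra_axioms linear_hom_id(2) s]]
      by (auto simp: G_def)
    then show "(\<lambda>x. \<phi> (s \<otimes>\<^bsub>F\<^esub> x)) \<in> G" "(\<lambda>x. \<phi> (x \<otimes>\<^bsub>F\<^esub> s)) \<in> G"
      using \<phi> linear_hom_F_bilinear_mult[OF V _ _ s] by (auto simp: G_def)
  qed
  have "tensor_relations A B \<subseteq> ?J"
  proof
    fix r assume r: "r \<in> tensor_relations A B"
    have "\<phi> r = \<zero>\<^bsub>V\<^esub>" if \<phi>: "\<phi> \<in> G" for \<phi>
    proof -
      have lin: "\<phi> \<in> linear_hom F V" using \<phi> by (simp add: G_def)
      define g where "g = (\<lambda>a b. \<phi> (Poly_Mapping.single (a, b) 1))"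
      have g: "g \<in> bilinear_maps A B V" using \<phi> by (simp add: G_def g_def)
      note g_lin = linear_homD[OF bilinear_mapsD(1)[OF g]] linear_homD[OF bilinear_mapsD(2)[OF g]]
      have diff: "\<phi> (p - s) = \<phi> p \<ominus>\<^bsub>V\<^esub> \<phi> s" if "p \<in> carrier F" "s \<in> carrier F" for p s
        using linear_hom_diff[OF F.assoc_algebra_axioms V lin that]
        by (simp only: monoid_algebra_minus[OF monoid_DirProd that])
      have *: "p - s \<in> carrier F" if "p \<in> carrier F" "s \<in> carrier F" for p s
        using F.minus_closed[OF that] by (simp only: monoid_algebra_minus[OF monoid_DirProd that])
      have single: "Poly_Mapping.single (a, b) c \<in> carrier F"
        if "a \<in> carrier A" "b \<in> carrier B" for a b c using that by simp
      have \<phi>s: "\<phi> (Poly_Mapping.single (a, b) c) = c \<odot>\<^bsub>V\<^esub> g a b"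
        if "a \<in> carrier A" "b \<in> carrier B" for a b c
        using linear_homD(3)[OF lin, of "Poly_Mapping.single (a, b) 1" c] that by (simp add: g_def)
      have cancel: "x \<oplus>\<^bsub>V\<^esub> y \<ominus>\<^bsub>V\<^esub> x \<ominus>\<^bsub>V\<^esub> y = \<zero>\<^bsub>V\<^esub>" if "x \<in> carrier V" "y \<in> carrier V" for x y
      proof -
        have "x \<oplus>\<^bsub>V\<^esub> y \<ominus>\<^bsub>V\<^esub> x \<ominus>\<^bsub>V\<^esub> y = x \<oplus>\<^bsub>V\<^esub> y \<oplus>\<^bsub>V\<^esub> (\<ominus>\<^bsub>V\<^esub> x \<oplus>\<^bsub>V\<^esub> \<ominus>\<^bsub>V\<^esub> y)"
          using that by (simp add: a_minus_def V.a_assoc)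
        also have "\<dots> = \<zero>\<^bsub>V\<^esub>" using that by (simp add: V.minus_add [symmetric] V.r_neg)
        finally show ?thesis .
      qed
      show ?thesis
        using r g_lin(1)
        by (auto simp: tensor_relations_def diff * single \<phi>s g_lin cancel V.r_neg a_minus_def[symmetric]
            V.r_right_minus_eq simp del: monoid_algebra_simps)
    qed
    then show "r \<in> ?J" using r tensor_relations_carrier by blast
  qed
  then have "tensor_ideal A B \<subseteq> ?J"
    unfolding tensor_ideal_def by (rule F.genideal_minimal[OF J])
  moreover have "linear_extension V (case_prod f) \<in> G"
  proof -
    have fc: "case_prod f \<in> carrier (A \<times>\<times> B) \<rightarrow> carrier V" using bilinear_mapsD(3)[OF f] by auto
    have eq: "linear_extension V (case_prod f) (Poly_Mapping.single (a, b) 1) = f a b"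
      if "a \<in> carrier A" "b \<in> carrier B" for a b
      using bilinear_mapsD(3)[OF f that] by simp
    have "(\<lambda>a b. linear_extension V (case_prod f) (Poly_Mapping.single (a, b) 1)) \<in> bilinear_maps A B V"
      using bilinear_mapsD(1,2)[OF f] eq
      by (intro bilinear_mapsI; subst linear_hom_cong[OF eq]; simp add: A.assoc_algebra_axioms B.assoc_algebra_axioms)
    then show ?thesis using V.linear_extension_linear[OF fc] by (simp add: G_def)
  qed
  ultimately show ?thesis using p by blast
qed

lemma tensor_lift:
  assumes V: "assoc_algebra V" and f: "f \<in> bilinear_maps A B V"
  shows tensor_lift_linear: "tensor_lift V f \<in> linear_hom (tensor A B) V"
    and tensor_lift_pure: "\<And>a b. a \<in> carrier A \<Longrightarrow> b \<in> carrier B \<Longrightarrow> tensor_lift V f (pure a b) = f a b"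
proof -
  interpret V: assoc_algebra V by fact
  let ?L = "linear_extension V (case_prod f)"
  have fc: "case_prod f \<in> carrier (A \<times>\<times> B) \<rightarrow> carrier V" using bilinear_mapsD(3)[OF f] by auto
  have L: "?L \<in> linear_hom F V" by (rule V.linear_extension_linear[OF fc])
  have eq: "tensor_lift V f (tensor_ideal A B +>\<^bsub>F\<^esub> p) = ?L p" if "p \<in> carrier F" for p
    unfolding tensor_lift_def
    by (rule F.quot_lift_eq[OF I.ideal_axioms V L tensor_ideal_bilinear[OF V f] that])
  show "tensor_lift V f (pure a b) = f a b" if "a \<in> carrier A" "b \<in> carrier B" for a b
    using that bilinear_mapsD(3)[OF f that] by (simp add: pure_tensor_def eq)
  note P = algebra_homD[OF proj_hom]
  show "tensor_lift V f \<in> linear_hom (tensor A B) V"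
  proof (rule linear_homI)
    fix s t c assume s: "s \<in> carrier (tensor A B)"
    then obtain p where p: "p \<in> carrier F" "s = tensor_ideal A B +>\<^bsub>F\<^esub> p" by (rule tensor_cases)
    show "tensor_lift V f s \<in> carrier V" using p linear_homD(1)[OF L] by (simp add: eq del: monoid_algebra_simps)
    show "tensor_lift V f (c \<odot>\<^bsub>tensor A B\<^esub> s) = c \<odot>\<^bsub>V\<^esub> tensor_lift V f s"
      unfolding p(2) using p(1) linear_homD(3)[OF L p(1), of c] F.scale_closed[OF p(1), of c]
      by (simp only: P(6) [symmetric] eq)
    assume "t \<in> carrier (tensor A B)"
    then obtain r where r: "r \<in> carrier F" "t = tensor_ideal A B +>\<^bsub>F\<^esub> r" by (rule tensor_cases)
    show "tensor_lift V f (s \<oplus>\<^bsub>tensor A B\<^esub> t) = tensor_lift V f s \<oplus>\<^bsub>V\<^esub> tensor_lift V f t"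
      unfolding p(2) r(2) using p(1) r(1) linear_homD(2)[OF L p(1) r(1)] F.a_closed[OF p(1) r(1)]
      by (simp only: P(5) [symmetric] eq)
  qed
qed

lemma tensor_lift_eqI:
  assumes "assoc_algebra V" "f \<in> bilinear_maps A B V" "g \<in> linear_hom (tensor A B) V"
    and "\<And>a b. a \<in> carrier A \<Longrightarrow> b \<in> carrier B \<Longrightarrow> g (pure a b) = f a b" "t \<in> carrier (tensor A B)"
  shows "tensor_lift V f t = g t"
  by (rule tensor_hom_eqI[OF assms(1) tensor_lift_linear[OF assms(1,2)] assms(3) _ assms(5)])
    (simp add: tensor_lift_pure[OF assms(1,2)] assms(4))

text \<open>Both sides of the product rule are linear in each factor. Fixing the second factor, and
  then a pure tensor in the first, reduces the rule to pure tensors in two stages.\<close>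

lemma linear_hom_tensor_multiplicative:
  assumes V: "assoc_algebra V" and f: "f \<in> linear_hom (tensor A B) V"
    and mult: "\<And>a b a' b'. \<lbrakk>a \<in> carrier A; a' \<in> carrier A; b \<in> carrier B; b' \<in> carrier B\<rbrakk>
      \<Longrightarrow> f (pure (a \<otimes>\<^bsub>A\<^esub> a') (b \<otimes>\<^bsub>B\<^esub> b')) = f (pure a b) \<otimes>\<^bsub>V\<^esub> f (pure a' b')"
    and one: "f (pure \<one>\<^bsub>A\<^esub> \<one>\<^bsub>B\<^esub>) = \<one>\<^bsub>V\<^esub>"
  shows "f \<in> algebra_hom (tensor A B) V"
proof (rule algebra_homI[OF f])
  interpret V: assoc_algebra V by fact
  show "f \<one>\<^bsub>tensor A B\<^esub> = \<one>\<^bsub>V\<^esub>" using one by (simp add: pure_one)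
  note D = linear_homD[OF f]
  fix s t assume s: "s \<in> carrier (tensor A B)" and t: "t \<in> carrier (tensor A B)"
  show "f (s \<otimes>\<^bsub>tensor A B\<^esub> t) = f s \<otimes>\<^bsub>V\<^esub> f t"
  proof (rule tensor_hom_eqI[OF V _ _ _ s])
    show "(\<lambda>s. f (s \<otimes>\<^bsub>tensor A B\<^esub> t)) \<in> linear_hom (tensor A B) V"
      using t by (intro linear_hom_comp[OF _ f] linear_hom_mult_right T.assoc_algebra_axioms linear_hom_id(2))
    show "(\<lambda>s. f s \<otimes>\<^bsub>V\<^esub> f t) \<in> linear_hom (tensor A B) V"
      using t D by (intro linear_hom_mult_right V f)
    fix a b assume ab: "a \<in> carrier A" "b \<in> carrier B"
    show "f (pure a b \<otimes>\<^bsub>tensor A B\<^esub> t) = f (pure a b) \<otimes>\<^bsub>V\<^esub> f t"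
    proof (rule tensor_hom_eqI[OF V _ _ _ t])
      show "(\<lambda>t. f (pure a b \<otimes>\<^bsub>tensor A B\<^esub> t)) \<in> linear_hom (tensor A B) V"
        using ab by (intro linear_hom_comp[OF _ f] linear_hom_mult_left T.assoc_algebra_axioms linear_hom_id(2)) auto
      show "(\<lambda>t. f (pure a b) \<otimes>\<^bsub>V\<^esub> f t) \<in> linear_hom (tensor A B) V"
        using ab D by (intro linear_hom_mult_left V f) auto
    qed (use ab mult in simp)
  qed
qed

lemma tensor_lift_algebra_hom:
  assumes V: "assoc_algebra V" and f: "f \<in> bilinear_maps A B V"
    and "\<And>a b a' b'. \<lbrakk>a \<in> carrier A; a' \<in> carrier A; b \<in> carrier B; b' \<in> carrier B\<rbrakk>
      \<Longrightarrow> f (a \<otimes>\<^bsub>A\<^esub> a') (b \<otimes>\<^bsub>B\<^esub> b') = f a b \<otimes>\<^bsub>V\<^esub> f a' b'"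
    and "f \<one>\<^bsub>A\<^esub> \<one>\<^bsub>B\<^esub> = \<one>\<^bsub>V\<^esub>"
  shows "tensor_lift V f \<in> algebra_hom (tensor A B) V"
  using assms
  by (intro linear_hom_tensor_multiplicative tensor_lift_linear) (simp_all add: tensor_lift_pure)

end

lemma algebra_pairI: "assoc_algebra A \<Longrightarrow> assoc_algebra B \<Longrightarrow> algebra_pair A B"
  by (rule algebra_pair.intro)

lemma tensor_map:
  assumes "assoc_algebra A" "assoc_algebra B" "assoc_algebra C" "assoc_algebra D"
    and f: "f \<in> linear_hom A C" and g: "g \<in> linear_hom B D"
  shows tensor_map_linear: "tensor_map C D f g \<in> linear_hom (tensor A B) (tensor C D)"
    and tensor_map_pure: "\<And>a b. a \<in> carrier A \<Longrightarrow> b \<in> carrier B \<Longrightarrow>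
      tensor_map C D f g (pure_tensor A B a b) = pure_tensor C D (f a) (g b)"
proof -
  interpret AB: algebra_pair A B using assms(1,2) by (rule algebra_pairI)
  interpret CD: algebra_pair C D using assms(3,4) by (rule algebra_pairI)
  note b = bilinear_maps_precomp[OF CD.pure_bilinear f g]
  show "tensor_map C D f g \<in> linear_hom (tensor A B) (tensor C D)"
    unfolding tensor_map_def by (rule AB.tensor_lift_linear[OF CD.T.assoc_algebra_axioms b])
  show "tensor_map C D f g (pure_tensor A B a b) = pure_tensor C D (f a) (g b)"
    if "a \<in> carrier A" "b \<in> carrier B" for a b
    unfolding tensor_map_def by (rule AB.tensor_lift_pure[OF CD.T.assoc_algebra_axioms b that])
qed

lemma tensor_map_algebra_hom:
  assumes "assoc_algebra A" "assoc_algebra B" "assoc_algebra C" "assoc_algebra D"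
    and f: "f \<in> algebra_hom A C" and g: "g \<in> algebra_hom B D"
  shows "tensor_map C D f g \<in> algebra_hom (tensor A B) (tensor C D)"
proof -
  interpret AB: algebra_pair A B using assms(1,2) by (rule algebra_pairI)
  interpret CD: algebra_pair C D using assms(3,4) by (rule algebra_pairI)
  note F = algebra_homD[OF f] and G = algebra_homD[OF g]
  note p = tensor_map_pure[OF assms(1-4) F(1) G(1)]
  show ?thesis
    by (rule AB.linear_hom_tensor_multiplicative[OF CD.T.assoc_algebra_axioms
          tensor_map_linear[OF assms(1-4) F(1) G(1)]])
      (simp_all add: p F G CD.pure_one)
qed

lemma tensor_map_comp:
  assumes "assoc_algebra A" "assoc_algebra B" "assoc_algebra C" "assoc_algebra D"
    "assoc_algebra A'" "assoc_algebra B'"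
    and f: "f \<in> linear_hom A C" and g: "g \<in> linear_hom B D"
    and f': "f' \<in> linear_hom C A'" and g': "g' \<in> linear_hom D B'"
    and t: "t \<in> carrier (tensor A B)"
  shows "tensor_map A' B' f' g' (tensor_map C D f g t) = tensor_map A' B' (\<lambda>a. f' (f a)) (\<lambda>b. g' (g b)) t"
proof -
  interpret AB: algebra_pair A B using assms(1,2) by (rule algebra_pairI)
  interpret AB': algebra_pair A' B' using assms(5,6) by (rule algebra_pairI)
  note m = tensor_map[OF assms(1-4) f g] and m' = tensor_map[OF assms(3-6) f' g']
    and m'' = tensor_map[OF assms(1,2,5,6) linear_hom_comp[OF f f'] linear_hom_comp[OF g g']]
  show ?thesis
    by (rule AB.tensor_hom_eqI[OF AB'.T.assoc_algebra_axioms linear_hom_comp[OF m(1) m'(1)] m''(1) _ t])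
      (simp add: m m' m'' linear_homD(1)[OF f] linear_homD(1)[OF g])
qed

lemma tensor_map_ident:
  assumes "assoc_algebra A" "assoc_algebra B" "t \<in> carrier (tensor A B)"
    and "\<And>a. a \<in> carrier A \<Longrightarrow> f a = a" "\<And>b. b \<in> carrier B \<Longrightarrow> g b = b"
  shows "tensor_map A B f g t = t"
proof -
  interpret AB: algebra_pair A B using assms(1,2) by (rule algebra_pairI)
  have "f \<in> linear_hom A A" "g \<in> linear_hom B B"
    using linear_hom_congI[OF linear_hom_id(2)] assms by blast+
  note m = tensor_map[OF assms(1,2,1,2) this]
  show ?thesis
    by (rule AB.tensor_hom_eqI[OF AB.T.assoc_algebra_axioms m(1) linear_hom_id(2) _ assms(3)])
      (simp add: m assms)
qed

text \<open>A lift is known only through its values on pure tensors, hence the induction on s. The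
  associator needs this, because its inner lift depends on the third variable as a
  parameter.\<close>

lemma (in algebra_pair) tensor_lift_param_linear:
  assumes V: "assoc_algebra V" and C: "assoc_algebra C"
    and f: "\<And>c. c \<in> carrier C \<Longrightarrow> f c \<in> bilinear_maps A B V"
    and lin: "\<And>a b. a \<in> carrier A \<Longrightarrow> b \<in> carrier B \<Longrightarrow> (\<lambda>c. f c a b) \<in> linear_hom C V"
    and s: "s \<in> carrier (tensor A B)"
  shows "(\<lambda>c. tensor_lift V (f c) s) \<in> linear_hom C V"
  using s
proof (induction rule: tensor_induct)
  case zero
  have "tensor_lift V (f c) \<zero>\<^bsub>tensor A B\<^esub> = \<zero>\<^bsub>V\<^esub>" if "c \<in> carrier C" for c
    by (rule linear_hom_zero[OF T.assoc_algebra_axioms V tensor_lift_linear[OF V f[OF that]]])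
  with linear_hom_zero_map[OF V] C show ?case by (rule linear_hom_congI)
next
  case (add a b s)
  have "tensor_lift V (f c) (pure a b \<oplus>\<^bsub>tensor A B\<^esub> s) = f c a b \<oplus>\<^bsub>V\<^esub> tensor_lift V (f c) s"
    if "c \<in> carrier C" for c
    using add linear_homD(2)[OF tensor_lift_linear[OF V f[OF that]]]
    by (simp add: tensor_lift_pure[OF V f[OF that]])
  with linear_hom_add[OF V lin[OF add(1,2)] add(4)] C show ?case by (rule linear_hom_congI)
qed

text \<open>The values on pure tensors determine the map. Multiplicativity is proved as well because
  coassociativity will be checked on generators, which requires both of its sides to be algebra
  maps.\<close>

lemma tensor_assoc:
  assumes A: "assoc_algebra A" and B: "assoc_algebra B" and C: "assoc_algebra C"
  shows tensor_assoc_pure: "\<And>a b c. a \<in> carrier A \<Longrightarrow> b \<in> carrier B \<Longrightarrow> c \<in> carrier C \<Longrightarrow>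
      tensor_assoc A B C (pure_tensor (tensor A B) C (pure_tensor A B a b) c)
        = pure_tensor A (tensor B C) a (pure_tensor B C b c)"
    and tensor_assoc_hom: "tensor_assoc A B C
      \<in> algebra_hom (tensor (tensor A B) C) (tensor A (tensor B C))"
proof -
  interpret AB: algebra_pair A B using A B by (rule algebra_pairI)
  interpret BC: algebra_pair B C using B C by (rule algebra_pairI)
  interpret A_BC: algebra_pair A "tensor B C" using A BC.T.assoc_algebra_axioms by (rule algebra_pairI)
  interpret AB_C: algebra_pair "tensor A B" C using AB.T.assoc_algebra_axioms C by (rule algebra_pairI)
  let ?V = "tensor A (tensor B C)"
  note V = A_BC.T.assoc_algebra_axioms
  let ?f = "\<lambda>c a b. pure_tensor A (tensor B C) a (pure_tensor B C b c)"
  let ?g = "\<lambda>s c. tensor_lift ?V (?f c) s"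
  have f: "?f c \<in> bilinear_maps A B ?V" if "c \<in> carrier C" for c
    by (rule bilinear_maps_precomp[OF A_BC.pure_bilinear linear_hom_id(2)
          bilinear_mapsD(2)[OF BC.pure_bilinear that]])
  have f_lin: "(\<lambda>c. ?f c a b) \<in> linear_hom C ?V" if "a \<in> carrier A" "b \<in> carrier B" for a b
    by (rule linear_hom_comp[OF bilinear_mapsD(1)[OF BC.pure_bilinear that(2)]
          bilinear_mapsD(1)[OF A_BC.pure_bilinear that(1)]])
  note g_lin = AB.tensor_lift_linear[OF V f] and g_pure = AB.tensor_lift_pure[OF V f]
  have g: "?g \<in> bilinear_maps (tensor A B) C ?V"
    by (intro bilinear_mapsI g_lin AB.tensor_lift_param_linear[OF V C f f_lin])
  note G_lin = AB_C.tensor_lift_linear[OF V g] and G_pure = AB_C.tensor_lift_pure[OF V g]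
  have eq: "tensor_assoc A B C = tensor_lift ?V ?g" by (simp add: tensor_assoc_def)
  show "tensor_assoc A B C (pure_tensor (tensor A B) C (pure_tensor A B a b) c)
        = pure_tensor A (tensor B C) a (pure_tensor B C b c)"
    if "a \<in> carrier A" "b \<in> carrier B" "c \<in> carrier C" for a b c
    using that by (simp add: eq G_pure g_pure)
  have g_mult: "?g (s \<otimes>\<^bsub>tensor A B\<^esub> s') (c \<otimes>\<^bsub>C\<^esub> c') = ?g s c \<otimes>\<^bsub>?V\<^esub> ?g s' c'"
    if s: "s \<in> carrier (tensor A B)" and s': "s' \<in> carrier (tensor A B)"
      and c: "c \<in> carrier C" and c': "c' \<in> carrier C" for s s' c c'
  proof (rule AB.tensor_hom_eqI[OF V _ _ _ s])
    note T = AB.T.assoc_algebra_axioms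
    have cc: "c \<otimes>\<^bsub>C\<^esub> c' \<in> carrier C" using c c' by simp
    show "(\<lambda>s. ?g (s \<otimes>\<^bsub>tensor A B\<^esub> s') (c \<otimes>\<^bsub>C\<^esub> c')) \<in> linear_hom (tensor A B) ?V"
      by (rule linear_hom_comp[OF linear_hom_mult_right[OF T linear_hom_id(2) s'] g_lin[OF cc]])
    show "(\<lambda>s. ?g s c \<otimes>\<^bsub>?V\<^esub> ?g s' c') \<in> linear_hom (tensor A B) ?V"
      by (rule linear_hom_mult_right[OF V g_lin[OF c] linear_homD(1)[OF g_lin[OF c'] s']])
    fix a b assume ab: "a \<in> carrier A" "b \<in> carrier B"
    then have p: "pure_tensor A B a b \<in> carrier (tensor A B)" by simp
    show "?g (pure_tensor A B a b \<otimes>\<^bsub>tensor A B\<^esub> s') (c \<otimes>\<^bsub>C\<^esub> c')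
        = ?g (pure_tensor A B a b) c \<otimes>\<^bsub>?V\<^esub> ?g s' c'"
    proof (rule AB.tensor_hom_eqI[OF V _ _ _ s'])
      show "(\<lambda>s'. ?g (pure_tensor A B a b \<otimes>\<^bsub>tensor A B\<^esub> s') (c \<otimes>\<^bsub>C\<^esub> c')) \<in> linear_hom (tensor A B) ?V"
        by (rule linear_hom_comp[OF linear_hom_mult_left[OF T linear_hom_id(2) p] g_lin[OF cc]])
      show "(\<lambda>s'. ?g (pure_tensor A B a b) c \<otimes>\<^bsub>?V\<^esub> ?g s' c') \<in> linear_hom (tensor A B) ?V"
        by (rule linear_hom_mult_left[OF V g_lin[OF c'] linear_homD(1)[OF g_lin[OF c] p]])
    qed (use ab c c' in \<open>simp add: g_pure\<close>)
  qed
  have "tensor_lift ?V ?g \<in> algebra_hom (tensor (tensor A B) C) ?V"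
  proof (rule AB_C.tensor_lift_algebra_hom[OF V g])
    show "?g (s \<otimes>\<^bsub>tensor A B\<^esub> s') (c \<otimes>\<^bsub>C\<^esub> c') = ?g s c \<otimes>\<^bsub>?V\<^esub> ?g s' c'"
      if "s \<in> carrier (tensor A B)" "s' \<in> carrier (tensor A B)" "c \<in> carrier C" "c' \<in> carrier C"
      for s s' c c' using that by (rule g_mult)
    have "?g \<one>\<^bsub>tensor A B\<^esub> \<one>\<^bsub>C\<^esub> = ?g (pure_tensor A B \<one>\<^bsub>A\<^esub> \<one>\<^bsub>B\<^esub>) \<one>\<^bsub>C\<^esub>" by (simp add: AB.pure_one)
    also have "\<dots> = \<one>\<^bsub>?V\<^esub>" by (simp only: g_pure AB.A.one_closed AB.B.one_closed BC.B.one_closed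
        BC.pure_one A_BC.pure_one)
    finally show "?g \<one>\<^bsub>tensor A B\<^esub> \<one>\<^bsub>C\<^esub> = \<one>\<^bsub>?V\<^esub>" .
  qed
  then show "tensor_assoc A B C \<in> algebra_hom (tensor (tensor A B) C) ?V" by (simp add: eq)
qed


section \<open>Opposite algebras\<close>

lemma opposite_algebra_simps [simp]:
  "carrier (opposite_algebra A) = carrier A"
  "a \<otimes>\<^bsub>opposite_algebra A\<^esub> b = b \<otimes>\<^bsub>A\<^esub> a"
  "\<one>\<^bsub>opposite_algebra A\<^esub> = \<one>\<^bsub>A\<^esub>"
  "\<zero>\<^bsub>opposite_algebra A\<^esub> = \<zero>\<^bsub>A\<^esub>"
  "add (opposite_algebra A) = add A"
  "module.smult (opposite_algebra A) = module.smult A"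
  by (simp_all add: opposite_algebra_def)

lemma assoc_algebra_opposite:
  assumes "assoc_algebra A" shows "assoc_algebra (opposite_algebra A)"
proof -
  interpret A: assoc_algebra A by fact
  show ?thesis
    by (rule assoc_algebraI) (simp_all add: A.a_ac A.m_assoc A.l_distr A.r_distr A.scale_add_left A.scale_add_right
        A.smult_mult_left A.smult_mult_right)
qed

lemma opposite_algebra_pow:
  assumes "assoc_algebra A" "a \<in> carrier A"
  shows "a [^]\<^bsub>opposite_algebra A\<^esub> (k::nat) = a [^]\<^bsub>A\<^esub> k"
proof -
  interpret A: assoc_algebra A by fact
  interpret O: assoc_algebra "opposite_algebra A" using assms(1) by (rule assoc_algebra_opposite)
  show ?thesis
    by (induction k) (use assms(2) in \<open>simp_all add: A.nat_pow_Suc2 [symmetric]\<close>)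
qed


section \<open>Algebras presented by generators and relations\<close>

lemma monoid_algebra_homI:
  assumes M: "Group.monoid M" and B: "assoc_algebra B"
    and f: "f \<in> linear_hom (monoid_algebra M :: ('k::field, 'm \<Rightarrow>\<^sub>0 'k) module) B"
    and mult: "\<And>a b. a \<in> carrier M \<Longrightarrow> b \<in> carrier M \<Longrightarrow>
      f (Poly_Mapping.single (a \<otimes>\<^bsub>M\<^esub> b) 1) = f (Poly_Mapping.single a 1) \<otimes>\<^bsub>B\<^esub> f (Poly_Mapping.single b 1)"
    and one: "f (Poly_Mapping.single \<one>\<^bsub>M\<^esub> 1) = \<one>\<^bsub>B\<^esub>"
  shows "f \<in> algebra_hom (monoid_algebra M) B"
proof (rule algebra_homI[OF f])
  let ?A = "monoid_algebra M :: ('k, 'm \<Rightarrow>\<^sub>0 'k) module"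
  interpret A: assoc_algebra ?A using M by (rule assoc_algebra_monoid_algebra)
  interpret B: assoc_algebra B by fact
  note L = A.assoc_algebra_axioms
  show "f \<one>\<^bsub>?A\<^esub> = \<one>\<^bsub>B\<^esub>" using one by simp
  fix p r assume p: "p \<in> carrier ?A" and r: "r \<in> carrier ?A"
  show "f (p \<otimes>\<^bsub>?A\<^esub> r) = f p \<otimes>\<^bsub>B\<^esub> f r"
  proof (rule monoid_algebra_hom_eqI[OF M B, where p = p])
    show "(\<lambda>p. f (p \<otimes>\<^bsub>?A\<^esub> r)) \<in> linear_hom ?A B"
      by (rule linear_hom_comp[OF linear_hom_mult_right[OF L linear_hom_id(2) r] f])
    show "(\<lambda>p. f p \<otimes>\<^bsub>B\<^esub> f r) \<in> linear_hom ?A B"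
      by (rule linear_hom_mult_right[OF B f linear_homD(1)[OF f r]])
    show "Poly_Mapping.keys p \<subseteq> carrier M" using p by simp
    fix a assume a: "a \<in> carrier M"
    then have s: "Poly_Mapping.single a 1 \<in> carrier ?A" by simp
    show "f (Poly_Mapping.single a 1 \<otimes>\<^bsub>?A\<^esub> r) = f (Poly_Mapping.single a 1) \<otimes>\<^bsub>B\<^esub> f r"
    proof (rule monoid_algebra_hom_eqI[OF M B, where p = r])
      show "(\<lambda>r. f (Poly_Mapping.single a 1 \<otimes>\<^bsub>?A\<^esub> r)) \<in> linear_hom ?A B"
        by (rule linear_hom_comp[OF linear_hom_mult_left[OF L linear_hom_id(2) s] f])
      show "(\<lambda>r. f (Poly_Mapping.single a 1) \<otimes>\<^bsub>B\<^esub> f r) \<in> linear_hom ?A B"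
        by (rule linear_hom_mult_left[OF B f linear_homD(1)[OF f s]])
      show "Poly_Mapping.keys r \<subseteq> carrier M" using r by simp
    qed (use a mult in simp)
  qed
qed

text \<open>Generation as a unital algebra, phrased with one-sided closure: words in G are built by
  multiplying on the left, so a subspace that contains the unit and is stable under left
  multiplication by G contains all of them. Inductions then meet only products whose left factor is
  a generator.\<close>

definition generates :: "('k::field, 'a, 'z) module_scheme \<Rightarrow> 'a set \<Rightarrow> bool" where
  "generates A G \<longleftrightarrow> G \<subseteq> carrier A \<and> (\<forall>S \<subseteq> carrier A. \<one>\<^bsub>A\<^esub> \<in> S \<longrightarrow>
     (\<forall>a\<in>S. \<forall>b\<in>S. a \<oplus>\<^bsub>A\<^esub> b \<in> S) \<longrightarrow> (\<forall>c. \<forall>a\<in>S. c \<odot>\<^bsub>A\<^esub> a \<in> S) \<longrightarrow>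
     (\<forall>g\<in>G. \<forall>a\<in>S. g \<otimes>\<^bsub>A\<^esub> a \<in> S) \<longrightarrow> S = carrier A)"

lemma generates_induct [consumes 2, case_names one add scale mult]:
  assumes "generates A G" "a \<in> carrier A" "P \<one>\<^bsub>A\<^esub>"
    and "\<And>a b. \<lbrakk>a \<in> carrier A; b \<in> carrier A; P a; P b\<rbrakk> \<Longrightarrow> P (a \<oplus>\<^bsub>A\<^esub> b)"
    and "\<And>c a. \<lbrakk>a \<in> carrier A; P a\<rbrakk> \<Longrightarrow> P (c \<odot>\<^bsub>A\<^esub> a)"
    and "\<And>g a. \<lbrakk>g \<in> G; g \<in> carrier A; a \<in> carrier A; P a\<rbrakk> \<Longrightarrow> P (g \<otimes>\<^bsub>A\<^esub> a)"
    and A: "assoc_algebra A"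
  shows "P a"
proof -
  interpret assoc_algebra A by fact
  have G: "G \<subseteq> carrier A" using assms(1) by (simp add: generates_def)
  let ?S = "{a \<in> carrier A. P a}"
  have "?S = carrier A"
    using assms(1)[unfolded generates_def, THEN conjunct2, rule_format, of ?S] assms(3-6) G
    by (auto simp: subset_iff)
  then show ?thesis using assms(2) by auto
qed

lemma generates_hom_eqI:
  assumes "generates A G" "assoc_algebra A" "f \<in> algebra_hom A B" "g \<in> algebra_hom A B"
    and "\<And>s. s \<in> G \<Longrightarrow> f s = g s" "a \<in> carrier A"
  shows "f a = g a"
  using assms(1,6)
  by (induction rule: generates_induct)
    (simp_all add: algebra_homD[OF assms(3)] algebra_homD[OF assms(4)] assms(2,5))

abbreviation word_monoid :: "'g list monoid" where
  "word_monoid \<equiv> \<lparr>carrier = UNIV, monoid.mult = (@), one = []\<rparr>"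

lemma monoid_word_monoid: "Group.monoid word_monoid"
  by (rule monoidI) auto

lemma assoc_algebra_free: "assoc_algebra free_algebra"
  unfolding free_algebra_def by (rule assoc_algebra_monoid_algebra[OF monoid_word_monoid])

abbreviation eval_word :: "('k::field, 'a, 'z) module_scheme \<Rightarrow> ('g \<Rightarrow> 'a) \<Rightarrow> 'g list \<Rightarrow> 'a" where
  "eval_word A \<phi> w \<equiv> foldr (\<lambda>s a. \<phi> s \<otimes>\<^bsub>A\<^esub> a) w \<one>\<^bsub>A\<^esub>"

abbreviation eval_free :: "('k::field, 'a, 'z) module_scheme \<Rightarrow> ('g \<Rightarrow> 'a) \<Rightarrow> ('g list \<Rightarrow>\<^sub>0 'k) \<Rightarrow> 'a" where
  "eval_free A \<phi> \<equiv> linear_extension A (eval_word A \<phi>)"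

context assoc_algebra
begin

lemma eval_word_closed: "(\<And>s. \<phi> s \<in> carrier A) \<Longrightarrow> eval_word A \<phi> w \<in> carrier A"
  by (induction w) simp_all

lemma eval_word_append:
  "(\<And>s. \<phi> s \<in> carrier A) \<Longrightarrow> eval_word A \<phi> (v @ w) = eval_word A \<phi> v \<otimes> eval_word A \<phi> w"
proof -
  assume \<phi>: "\<And>s. \<phi> s \<in> carrier A"
  have "foldr (\<lambda>s a. \<phi> s \<otimes> a) v x = eval_word A \<phi> v \<otimes> x" if "x \<in> carrier A" for x
  proof (induction v)
    case (Cons s v)
    have "eval_word A \<phi> v \<in> carrier A" using \<phi> by (rule eval_word_closed)
    with Cons \<phi>[of s] that show ?case by (simp only: foldr.simps comp_def m_assoc)
  qed (use that in simp)
  from this[OF eval_word_closed[OF \<phi>]] show ?thesis unfolding foldr_append .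
qed

lemma eval_word_replicate [simp]:
  "\<phi> s \<in> carrier A \<Longrightarrow> eval_word A \<phi> (replicate k s) = \<phi> s [^] k"
  by (induction k) (simp_all add: nat_pow_Suc2 [symmetric])

lemma eval_free_hom:
  assumes \<phi>: "\<And>s. \<phi> s \<in> carrier A"
  shows "eval_free A \<phi> \<in> algebra_hom free_algebra A"
  unfolding free_algebra_def
proof (rule monoid_algebra_homI[OF monoid_word_monoid assoc_algebra_axioms linear_extension_linear])
  show "eval_word A \<phi> \<in> carrier word_monoid \<rightarrow> carrier A" by (simp add: \<phi> eval_word_closed)
  have single: "eval_free A \<phi> (Poly_Mapping.single w 1) = eval_word A \<phi> w" for w
    using linear_extension_single[where f = "eval_word A \<phi>" and a = w and c = 1] eval_word_closed[of \<phi> w, OF \<phi>] by simp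
  show "eval_free A \<phi> (Poly_Mapping.single (v \<otimes>\<^bsub>word_monoid\<^esub> w) 1)
      = eval_free A \<phi> (Poly_Mapping.single v 1) \<otimes> eval_free A \<phi> (Poly_Mapping.single w 1)" for v w
    unfolding single monoid.simps by (rule eval_word_append[of \<phi>, OF \<phi>])
qed simp_all

end

context
  fixes R :: "('g list \<Rightarrow>\<^sub>0 'k::field) set"
begin

interpretation Free: assoc_algebra "free_algebra :: ('k, 'g list \<Rightarrow>\<^sub>0 'k) module"
  by (rule assoc_algebra_free)

abbreviation "rel_ideal \<equiv> Idl\<^bsub>free_algebra\<^esub> R"

lemma rel_ideal: "ideal rel_ideal (free_algebra :: ('k, 'g list \<Rightarrow>\<^sub>0 'k) module)"
  by (rule Free.genideal_ideal) (simp add: free_algebra_def)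

lemma assoc_algebra_presented: "assoc_algebra (presented_algebra R)"
  unfolding presented_algebra_def by (rule Free.assoc_algebra_quot[OF rel_ideal])

interpretation P: assoc_algebra "presented_algebra R" by (rule assoc_algebra_presented)

lemma presented_proj_hom:
  "(\<lambda>p. rel_ideal +>\<^bsub>free_algebra\<^esub> p) \<in> algebra_hom free_algebra (presented_algebra R)"
  unfolding presented_algebra_def by (rule Free.quot_proj_hom[OF rel_ideal])

lemma presented_gen_closed [simp]: "presented_gen R s \<in> carrier (presented_algebra R)"
  unfolding presented_gen_def
  by (rule algebra_homD(4)[OF presented_proj_hom]) (simp add: free_algebra_def)

lemma generates_free:
  "generates (free_algebra :: ('k, 'g list \<Rightarrow>\<^sub>0 'k) module) (range (\<lambda>s. Poly_Mapping.single [s] 1))"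
  unfolding generates_def
proof (intro conjI allI impI)
  let ?F = "free_algebra :: ('k, 'g list \<Rightarrow>\<^sub>0 'k) module"
  show "range (\<lambda>s. Poly_Mapping.single [s] 1) \<subseteq> carrier ?F" by (simp add: free_algebra_def)
  fix S assume S: "S \<subseteq> carrier ?F" "\<one>\<^bsub>?F\<^esub> \<in> S" "\<forall>a\<in>S. \<forall>b\<in>S. a \<oplus>\<^bsub>?F\<^esub> b \<in> S"
    "\<forall>c. \<forall>a\<in>S. c \<odot>\<^bsub>?F\<^esub> a \<in> S" "\<forall>g\<in>range (\<lambda>s. Poly_Mapping.single [s] 1). \<forall>a\<in>S. g \<otimes>\<^bsub>?F\<^esub> a \<in> S"
  have single: "Poly_Mapping.single w 1 \<in> S" for w
  proof (induction w)
    case Nil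
    show ?case using S(2) by (simp add: free_algebra_def)
  next
    case (Cons s w)
    have "Poly_Mapping.single [s] 1 \<otimes>\<^bsub>?F\<^esub> Poly_Mapping.single w 1 \<in> S" using S(5) Cons by blast
    then show ?case by (simp add: free_algebra_def)
  qed
  have "p \<in> S" for p
  proof -
    have "Poly_Mapping.keys p \<subseteq> UNIV" by simp
    then show ?thesis
    proof (induction p rule: poly_mapping_induct_keys)
      case zero
      have "0 \<odot>\<^bsub>?F\<^esub> \<one>\<^bsub>?F\<^esub> \<in> S" using S(2,4) by blast
      then show ?case by (simp add: free_algebra_def)
    next
      case (add w c p)
      have "c \<odot>\<^bsub>?F\<^esub> Poly_Mapping.single w 1 \<in> S" using S(4) single by blast
      then show ?case using S(3) add by (fastforce simp: free_algebra_def)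
    qed
  qed
  then show "S = carrier ?F" using S(1) by auto
qed

lemma generates_presented: "generates (presented_algebra R) (range (presented_gen R))"
  unfolding generates_def
proof (intro conjI allI impI)
  let ?F = "free_algebra :: ('k, 'g list \<Rightarrow>\<^sub>0 'k) module" and ?P = "presented_algebra R"
  let ?\<pi> = "\<lambda>p. rel_ideal +>\<^bsub>free_algebra\<^esub> p"
  note \<pi> = algebra_homD[OF presented_proj_hom]
  show "range (presented_gen R) \<subseteq> carrier ?P" by auto
  fix S assume S: "S \<subseteq> carrier ?P" "\<one>\<^bsub>?P\<^esub> \<in> S" "\<forall>a\<in>S. \<forall>b\<in>S. a \<oplus>\<^bsub>?P\<^esub> b \<in> S"
    "\<forall>c. \<forall>a\<in>S. c \<odot>\<^bsub>?P\<^esub> a \<in> S" "\<forall>g\<in>range (presented_gen R). \<forall>a\<in>S. g \<otimes>\<^bsub>?P\<^esub> a \<in> S"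
  have "?\<pi> p \<in> S" if "p \<in> carrier ?F" for p
    using generates_free that
  proof (induction rule: generates_induct)
    case (mult g a)
    then show ?case using S(5) by (auto simp: \<pi> presented_gen_def)
  qed (use S in \<open>auto simp: \<pi> assoc_algebra_free\<close>)
  then show "S = carrier ?P"
    using S(1) Free.carrier_quot_algebra[OF rel_ideal] by (auto simp: presented_algebra_def)
qed

text \<open>Both sides are algebra maps on the free algebra and agree on the letters. Through this
  identity the relations, which lie in the ideal, evaluate to zero in the quotient.\<close>

lemma presented_proj_eq_eval:
  "eval_free (presented_algebra R) (presented_gen R) p = rel_ideal +>\<^bsub>free_algebra\<^esub> p"
  by (rule generates_hom_eqI[OF generates_free assoc_algebra_free P.eval_free_hom presented_proj_hom])
    (auto simp: presented_gen_def [symmetric], simp add: free_algebra_def)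

lemma presented_relation:
  assumes "r \<in> R"
  shows "eval_free (presented_algebra R) (presented_gen R) r = \<zero>\<^bsub>presented_algebra R\<^esub>"
proof -
  interpret ideal rel_ideal "free_algebra :: ('k, 'g list \<Rightarrow>\<^sub>0 'k) module" by (rule rel_ideal)
  have "r \<in> rel_ideal" using assms Free.genideal_self[of R] by (auto simp: free_algebra_def)
  then have "rel_ideal +>\<^bsub>free_algebra\<^esub> r = rel_ideal" by (rule a_rcos_const)
  moreover have "\<zero>\<^bsub>presented_algebra R\<^esub> = rel_ideal" by (simp add: presented_algebra_def quot_algebra_simps)
  ultimately show ?thesis by (simp only: presented_proj_eq_eval)
qed

text \<open>The kernel of evaluation is an ideal containing R. It therefore contains the ideal
  generated by R, and evaluation factors through the quotient.\<close>

lemma presented_lift: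
  assumes A: "assoc_algebra A" and \<phi>: "\<And>s. \<phi> s \<in> carrier A"
    and rel: "\<And>r. r \<in> R \<Longrightarrow> eval_free A \<phi> r = \<zero>\<^bsub>A\<^esub>"
  shows presented_lift_hom: "presented_lift A \<phi> \<in> algebra_hom (presented_algebra R) A"
    and presented_lift_gen: "presented_lift A \<phi> (presented_gen R s) = \<phi> s"
proof -
  interpret A: assoc_algebra A by fact
  let ?F = "free_algebra :: ('k, 'g list \<Rightarrow>\<^sub>0 'k) module"
  let ?\<pi> = "\<lambda>p. rel_ideal +>\<^bsub>?F\<^esub> p"
  note E = A.eval_free_hom[of \<phi>, OF \<phi>]
  have F: "carrier ?F = UNIV" by (simp add: free_algebra_def)
  have "rel_ideal \<subseteq> {p \<in> carrier ?F. eval_free A \<phi> p = \<zero>\<^bsub>A\<^esub>}"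
    by (rule Free.genideal_minimal[OF ideal_kernel[OF assoc_algebra_free A E]]) (auto simp: F rel)
  then have eq: "presented_lift A \<phi> (?\<pi> p) = eval_free A \<phi> p" for p
    unfolding presented_lift_def
    by (intro Free.quot_lift_eq[OF rel_ideal A algebra_homD(1)[OF E]]) (auto simp: F)
  show "presented_lift A \<phi> (presented_gen R s) = \<phi> s"
    using \<phi> by (simp add: presented_gen_def eq)
  have surj: "\<exists>p. a = ?\<pi> p" if "a \<in> carrier (presented_algebra R)" for a
    using that Free.carrier_quot_algebra[OF rel_ideal] by (auto simp: presented_algebra_def)
  note \<pi> = algebra_homD[OF presented_proj_hom] and E' = algebra_homD[OF E]
  show "presented_lift A \<phi> \<in> algebra_hom (presented_algebra R) A"
  proof (intro algebra_homI linear_homI)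
    show "presented_lift A \<phi> \<one>\<^bsub>presented_algebra R\<^esub> = \<one>\<^bsub>A\<^esub>"
      by (simp only: \<pi>(3) [symmetric] eq E')
    fix a c assume "a \<in> carrier (presented_algebra R)"
    then obtain p where p: "a = ?\<pi> p" using surj by blast
    show "presented_lift A \<phi> a \<in> carrier A" using E'(4) by (simp add: p eq F)
    show "presented_lift A \<phi> (c \<odot>\<^bsub>presented_algebra R\<^esub> a) = c \<odot>\<^bsub>A\<^esub> presented_lift A \<phi> a"
      using \<pi>(6)[of p c] E'(6)[of p c] by (simp add: p F eq flip: \<pi>(6))
    fix b assume "b \<in> carrier (presented_algebra R)"
    then obtain r where r: "b = ?\<pi> r" using surj by blast
    show "presented_lift A \<phi> (a \<oplus>\<^bsub>presented_algebra R\<^esub> b) = presented_lift A \<phi> a \<oplus>\<^bsub>A\<^esub> presented_lift A \<phi> b"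
      using E'(5)[of p r] by (simp add: p r F eq flip: \<pi>(5))
    show "presented_lift A \<phi> (a \<otimes>\<^bsub>presented_algebra R\<^esub> b) = presented_lift A \<phi> a \<otimes>\<^bsub>A\<^esub> presented_lift A \<phi> b"
      using E'(7)[of p r] by (simp add: p r F eq flip: \<pi>(7))
  qed
qed

end

section \<open>Hopf algebras from generators\<close>

text \<open>The Hopf identities at a single element, isolated so that they can be verified on
  generators and then propagated.\<close>

definition hopf_axioms_at :: "('k::field, 'a, 'z) hopf_scheme \<Rightarrow> 'a \<Rightarrow> bool" where
  "hopf_axioms_at H a \<longleftrightarrow>
     tensor_assoc H H H (tensor_map (tensor H H) H (comult H) id (comult H a))
       = tensor_map H (tensor H H) id (comult H) (comult H a) \<and>
     tensor_lift H (\<lambda>b c. counit H b \<odot>\<^bsub>H\<^esub> c) (comult H a) = a \<and>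
     tensor_lift H (\<lambda>b c. counit H c \<odot>\<^bsub>H\<^esub> b) (comult H a) = a \<and>
     tensor_lift H (\<lambda>b c. antipode H b \<otimes>\<^bsub>H\<^esub> c) (comult H a) = counit H a \<odot>\<^bsub>H\<^esub> \<one>\<^bsub>H\<^esub> \<and>
     tensor_lift H (\<lambda>b c. b \<otimes>\<^bsub>H\<^esub> antipode H c) (comult H a) = counit H a \<odot>\<^bsub>H\<^esub> \<one>\<^bsub>H\<^esub>"

text \<open>The structure maps are multiplicative, but no Hopf identity is assumed yet. That the
  antipode reverses products, a consequence of the axioms in general, is available here by
  construction and serves to propagate the antipode identities.\<close>

locale pre_hopf = algebra_pair H H
  for H :: "('k::field, 'a, 'z) hopf_scheme" +
  assumes comult: "comult H \<in> algebra_hom H (tensor H H)"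
    and counit: "counit H \<in> algebra_hom H ground_algebra"
    and antipode: "antipode H \<in> algebra_hom H (opposite_algebra H)"
begin

sublocale T_H: algebra_pair "tensor H H" H
  by (rule algebra_pairI) (rule T.assoc_algebra_axioms A.assoc_algebra_axioms)+

sublocale H_T: algebra_pair H "tensor H H"
  by (rule algebra_pairI) (rule T.assoc_algebra_axioms A.assoc_algebra_axioms)+

lemmas \<Delta> = algebra_homD[OF comult]
lemmas \<epsilon> = algebra_homD[OF counit, unfolded ground_algebra_simps]
lemmas S = algebra_homD[OF antipode, unfolded opposite_algebra_simps]

lemma S_lin: "antipode H \<in> linear_hom H H"
  using S(1) by (simp add: linear_hom_def)

lemma counit_left_bil: "(\<lambda>b c. counit H b \<odot>\<^bsub>H\<^esub> c) \<in> bilinear_maps H H H"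
  by (intro bilinear_mapsI linear_hom_scale linear_hom_scale_fixed \<epsilon>(1) linear_hom_id A.assoc_algebra_axioms)

lemma counit_right_bil: "(\<lambda>b c. counit H c \<odot>\<^bsub>H\<^esub> b) \<in> bilinear_maps H H H"
  by (intro bilinear_mapsI linear_hom_scale linear_hom_scale_fixed \<epsilon>(1) linear_hom_id A.assoc_algebra_axioms)

lemma antipode_left_bil: "(\<lambda>b c. antipode H b \<otimes>\<^bsub>H\<^esub> c) \<in> bilinear_maps H H H"
  by (rule bilinear_maps_precomp[OF bilinear_mult[OF A.assoc_algebra_axioms] S_lin linear_hom_id(2)])

lemma antipode_right_bil: "(\<lambda>b c. b \<otimes>\<^bsub>H\<^esub> antipode H c) \<in> bilinear_maps H H H"
  by (rule bilinear_maps_precomp[OF bilinear_mult[OF A.assoc_algebra_axioms] linear_hom_id(2) S_lin])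

lemmas lifts = tensor_lift[OF A.assoc_algebra_axioms counit_left_bil]
  tensor_lift[OF A.assoc_algebra_axioms counit_right_bil]
  tensor_lift[OF A.assoc_algebra_axioms antipode_left_bil]
  tensor_lift[OF A.assoc_algebra_axioms antipode_right_bil]

lemmas map_left = tensor_map[OF A.assoc_algebra_axioms A.assoc_algebra_axioms T.assoc_algebra_axioms
    A.assoc_algebra_axioms \<Delta>(1) linear_hom_id(1)]
lemmas map_right = tensor_map[OF A.assoc_algebra_axioms A.assoc_algebra_axioms A.assoc_algebra_axioms
    T.assoc_algebra_axioms linear_hom_id(1) \<Delta>(1)]
lemmas assoc3 = tensor_assoc[OF A.assoc_algebra_axioms A.assoc_algebra_axioms A.assoc_algebra_axioms]

lemma hopf_axioms_at_grouplike:
  assumes g: "g \<in> carrier H" and D: "comult H g = pure_tensor H H g g" and e: "counit H g = 1"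
    and "antipode H g \<otimes>\<^bsub>H\<^esub> g = \<one>\<^bsub>H\<^esub>" "g \<otimes>\<^bsub>H\<^esub> antipode H g = \<one>\<^bsub>H\<^esub>"
  shows "hopf_axioms_at H g"
  unfolding hopf_axioms_at_def using assms
  by (simp add: D lifts map_left map_right assoc3)

text \<open>Both iterated coproducts equal \<open>x \<otimes> h \<otimes> h + 1 \<otimes> x
  \<otimes> h + 1 \<otimes> 1 \<otimes> x\<close>. The antipode identities read
  \<open>- x S(h) h + x = 0\<close> and \<open>x S(h) - x S(h) = 0\<close>.\<close>

lemma hopf_axioms_at_skew_primitive:
  assumes x: "x \<in> carrier H" and h: "h \<in> carrier H"
    and Dx: "comult H x = pure_tensor H H x h \<oplus>\<^bsub>tensor H H\<^esub> pure_tensor H H \<one>\<^bsub>H\<^esub> x"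
    and Dh: "comult H h = pure_tensor H H h h"
    and ex: "counit H x = 0" and eh: "counit H h = 1"
    and Sx: "antipode H x = \<ominus>\<^bsub>H\<^esub> (x \<otimes>\<^bsub>H\<^esub> antipode H h)"
    and Sh: "antipode H h \<otimes>\<^bsub>H\<^esub> h = \<one>\<^bsub>H\<^esub>"
  shows "hopf_axioms_at H x"
proof -
  have Sh_in: "antipode H h \<in> carrier H" using h S(4) by blast
  have D1: "comult H \<one>\<^bsub>H\<^esub> = pure_tensor H H \<one>\<^bsub>H\<^esub> \<one>\<^bsub>H\<^esub>" using \<Delta>(3) by (simp add: pure_one)
  have p: "pure_tensor H H x h \<in> carrier (tensor H H)" "pure_tensor H H \<one>\<^bsub>H\<^esub> x \<in> carrier (tensor H H)"
    "pure_tensor H H h h \<in> carrier (tensor H H)" "pure_tensor H H \<one>\<^bsub>H\<^esub> \<one>\<^bsub>H\<^esub> \<in> carrier (tensor H H)"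
    using x h by auto
  have pp: "pure_tensor (tensor H H) H (pure_tensor H H x h) h \<in> carrier (tensor (tensor H H) H)"
    "pure_tensor (tensor H H) H (pure_tensor H H \<one>\<^bsub>H\<^esub> x) h \<in> carrier (tensor (tensor H H) H)"
    "pure_tensor (tensor H H) H (pure_tensor H H \<one>\<^bsub>H\<^esub> \<one>\<^bsub>H\<^esub>) x \<in> carrier (tensor (tensor H H) H)"
    "pure_tensor H (tensor H H) x (pure_tensor H H h h) \<in> carrier (tensor H (tensor H H))"
    "pure_tensor H (tensor H H) \<one>\<^bsub>H\<^esub> (pure_tensor H H x h) \<in> carrier (tensor H (tensor H H))"
    "pure_tensor H (tensor H H) \<one>\<^bsub>H\<^esub> (pure_tensor H H \<one>\<^bsub>H\<^esub> x) \<in> carrier (tensor H (tensor H H))"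
    using x h p by auto
  have coassoc: "tensor_assoc H H H (tensor_map (tensor H H) H (comult H) id (comult H x))
       = tensor_map H (tensor H H) id (comult H) (comult H x)"
    using x h p pp
    by (simp add: Dx linear_homD(2)[OF map_left(1)] linear_homD(2)[OF map_right(1)] map_left(2) map_right(2)
        Dh D1 T_H.pure_add_left H_T.pure_add_right algebra_homD(5)[OF assoc3(2)] assoc3(1)
        T_H.T.a_assoc H_T.T.a_assoc del: pure_one)
  have SxV: "\<ominus>\<^bsub>H\<^esub> (x \<otimes>\<^bsub>H\<^esub> antipode H h) \<otimes>\<^bsub>H\<^esub> h = \<ominus>\<^bsub>H\<^esub> x"
    using x h Sh_in Sh by (simp add: A.l_minus A.m_assoc)
  show ?thesis
    unfolding hopf_axioms_at_def
    using x h p Sh_in coassoc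
    by (simp add: Dx linear_homD(2)[OF lifts(1)] linear_homD(2)[OF lifts(3)] linear_homD(2)[OF lifts(5)]
        linear_homD(2)[OF lifts(7)] lifts(2,4,6,8) ex eh \<epsilon>(3) S(3) Sx SxV A.l_neg A.r_neg)
qed

text \<open>Coassociativity and the counit laws equate algebra maps and extend from generators at
  once. The maps in the antipode laws are not multiplicative, so those laws are propagated along
  products, one generator at a time.\<close>

lemma hopf_algebraI:
  assumes gen: "generates H G" and ax: "\<And>g. g \<in> G \<Longrightarrow> hopf_axioms_at H g"
  shows "hopf_algebra H"
proof -
  note HA = A.assoc_algebra_axioms and TA = T.assoc_algebra_axioms
  note ax' = ax[unfolded hopf_axioms_at_def]
  have coassoc: "tensor_assoc H H H (tensor_map (tensor H H) H (comult H) id (comult H a))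
        = tensor_map H (tensor H H) id (comult H) (comult H a)" if "a \<in> carrier H" for a
  proof (rule generates_hom_eqI[OF gen HA _ _ _ that])
    show "(\<lambda>a. tensor_assoc H H H (tensor_map (tensor H H) H (comult H) id (comult H a)))
        \<in> algebra_hom H (tensor H (tensor H H))"
      by (intro algebra_hom_comp[OF _ tensor_assoc_hom] algebra_hom_comp[OF comult]
          tensor_map_algebra_hom HA TA comult algebra_hom_id)
    show "(\<lambda>a. tensor_map H (tensor H H) id (comult H) (comult H a)) \<in> algebra_hom H (tensor H (tensor H H))"
      by (intro algebra_hom_comp[OF comult] tensor_map_algebra_hom HA TA comult algebra_hom_id)
  qed (use ax' in blast)
  have counit_left: "tensor_lift H (\<lambda>b c. counit H b \<odot>\<^bsub>H\<^esub> c) (comult H a) = a" if "a \<in> carrier H" for a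
  proof -
    have "tensor_lift H (\<lambda>b c. counit H b \<odot>\<^bsub>H\<^esub> c) \<in> algebra_hom (tensor H H) H"
      by (rule tensor_lift_algebra_hom[OF HA counit_left_bil])
        (simp_all add: \<epsilon> A.smult_mult_left A.smult_mult_right mult.commute)
    from generates_hom_eqI[OF gen HA algebra_hom_comp[OF comult this] algebra_hom_id _ that] ax'
    show ?thesis by simp
  qed
  have counit_right: "tensor_lift H (\<lambda>b c. counit H c \<odot>\<^bsub>H\<^esub> b) (comult H a) = a" if "a \<in> carrier H" for a
  proof -
    have "tensor_lift H (\<lambda>b c. counit H c \<odot>\<^bsub>H\<^esub> b) \<in> algebra_hom (tensor H H) H"
      by (rule tensor_lift_algebra_hom[OF HA counit_right_bil])
        (simp_all add: \<epsilon> A.smult_mult_left A.smult_mult_right mult.commute)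
    from generates_hom_eqI[OF gen HA algebra_hom_comp[OF comult this] algebra_hom_id _ that] ax'
    show ?thesis by simp
  qed
  let ?l = "tensor_lift H (\<lambda>b c. antipode H b \<otimes>\<^bsub>H\<^esub> c)" and ?r = "tensor_lift H (\<lambda>b c. b \<otimes>\<^bsub>H\<^esub> antipode H c)"
  note l = lifts(5,6) and r = lifts(7,8)
  \<comment> \<open>For \<open>s = \<Sum> s1 \<otimes> s2\<close> the value at
    \<open>s (b \<otimes> c)\<close> is \<open>S(b) (\<Sum> S(s1) s2) c\<close>, because S reverses
    products. A scalar inner sum can therefore be pulled out.\<close>
  have l_mult: "?l (s \<otimes>\<^bsub>tensor H H\<^esub> t) = e \<odot>\<^bsub>H\<^esub> ?l t"
    if s: "s \<in> carrier (tensor H H)" and t: "t \<in> carrier (tensor H H)" and e: "?l s = e \<odot>\<^bsub>H\<^esub> \<one>\<^bsub>H\<^esub>" for s t e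
  proof (rule tensor_hom_eqI[OF HA _ _ _ t])
    show "(\<lambda>t. ?l (s \<otimes>\<^bsub>tensor H H\<^esub> t)) \<in> linear_hom (tensor H H) H"
      by (rule linear_hom_comp[OF linear_hom_mult_left[OF TA linear_hom_id(2) s] l(1)])
    show "(\<lambda>t. e \<odot>\<^bsub>H\<^esub> ?l t) \<in> linear_hom (tensor H H) H" by (rule linear_hom_scale[OF HA l(1)])
    fix b c assume bc: "b \<in> carrier H" "c \<in> carrier H"
    have Sb: "antipode H b \<in> carrier H" using bc S(4) by blast
    have p: "pure_tensor H H b c \<in> carrier (tensor H H)" using bc by simp
    have "?l (s \<otimes>\<^bsub>tensor H H\<^esub> pure_tensor H H b c) = antipode H b \<otimes>\<^bsub>H\<^esub> ?l s \<otimes>\<^bsub>H\<^esub> c"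
    proof (rule tensor_hom_eqI[OF HA _ _ _ s])
      show "(\<lambda>s. ?l (s \<otimes>\<^bsub>tensor H H\<^esub> pure_tensor H H b c)) \<in> linear_hom (tensor H H) H"
        by (rule linear_hom_comp[OF linear_hom_mult_right[OF TA linear_hom_id(2) p] l(1)])
      show "(\<lambda>s. antipode H b \<otimes>\<^bsub>H\<^esub> ?l s \<otimes>\<^bsub>H\<^esub> c) \<in> linear_hom (tensor H H) H"
        by (rule linear_hom_mult_right[OF HA linear_hom_mult_left[OF HA l(1) Sb] bc(2)])
    qed (use bc S(4,7) in \<open>simp add: l(2) A.m_assoc\<close>)
    also have "\<dots> = e \<odot>\<^bsub>H\<^esub> ?l (pure_tensor H H b c)"
      using bc Sb by (simp add: e l(2) A.smult_mult_left A.smult_mult_right)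
    finally show "?l (s \<otimes>\<^bsub>tensor H H\<^esub> pure_tensor H H b c) = e \<odot>\<^bsub>H\<^esub> ?l (pure_tensor H H b c)" .
  qed
  \<comment> \<open>Mirror image: now the second factor t ends up in the middle and has to collapse
    to a scalar. For a product of a generator g with a, the middle factor belongs to a, whereas in
    \<open>l_mult\<close> it belongs to g.\<close>
  have r_mult: "?r (s \<otimes>\<^bsub>tensor H H\<^esub> t) = e \<odot>\<^bsub>H\<^esub> ?r s"
    if s: "s \<in> carrier (tensor H H)" and t: "t \<in> carrier (tensor H H)" and e: "?r t = e \<odot>\<^bsub>H\<^esub> \<one>\<^bsub>H\<^esub>" for s t e
  proof (rule tensor_hom_eqI[OF HA _ _ _ s])
    show "(\<lambda>s. ?r (s \<otimes>\<^bsub>tensor H H\<^esub> t)) \<in> linear_hom (tensor H H) H"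
      by (rule linear_hom_comp[OF linear_hom_mult_right[OF TA linear_hom_id(2) t] r(1)])
    show "(\<lambda>s. e \<odot>\<^bsub>H\<^esub> ?r s) \<in> linear_hom (tensor H H) H" by (rule linear_hom_scale[OF HA r(1)])
    fix b c assume bc: "b \<in> carrier H" "c \<in> carrier H"
    have Sc: "antipode H c \<in> carrier H" using bc S(4) by blast
    have p: "pure_tensor H H b c \<in> carrier (tensor H H)" using bc by simp
    have "?r (pure_tensor H H b c \<otimes>\<^bsub>tensor H H\<^esub> t) = b \<otimes>\<^bsub>H\<^esub> ?r t \<otimes>\<^bsub>H\<^esub> antipode H c"
    proof (rule tensor_hom_eqI[OF HA _ _ _ t])
      show "(\<lambda>t. ?r (pure_tensor H H b c \<otimes>\<^bsub>tensor H H\<^esub> t)) \<in> linear_hom (tensor H H) H"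
        by (rule linear_hom_comp[OF linear_hom_mult_left[OF TA linear_hom_id(2) p] r(1)])
      show "(\<lambda>t. b \<otimes>\<^bsub>H\<^esub> ?r t \<otimes>\<^bsub>H\<^esub> antipode H c) \<in> linear_hom (tensor H H) H"
        by (rule linear_hom_mult_right[OF HA linear_hom_mult_left[OF HA r(1) bc(1)] Sc])
    qed (use bc S(4,7) in \<open>simp add: r(2) A.m_assoc\<close>)
    also have "\<dots> = e \<odot>\<^bsub>H\<^esub> ?r (pure_tensor H H b c)"
      using bc Sc by (simp add: e r(2) A.smult_mult_left A.smult_mult_right)
    finally show "?r (pure_tensor H H b c \<otimes>\<^bsub>tensor H H\<^esub> t) = e \<odot>\<^bsub>H\<^esub> ?r (pure_tensor H H b c)" .
  qed
  have antipode: "?l (comult H a) = counit H a \<odot>\<^bsub>H\<^esub> \<one>\<^bsub>H\<^esub> \<and> ?r (comult H a) = counit H a \<odot>\<^bsub>H\<^esub> \<one>\<^bsub>H\<^esub>"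
    if "a \<in> carrier H" for a
    using gen that
  proof (induction rule: generates_induct)
    case one
    have "comult H \<one>\<^bsub>H\<^esub> = pure_tensor H H \<one>\<^bsub>H\<^esub> \<one>\<^bsub>H\<^esub>" by (simp add: \<Delta>(3) pure_one)
    then show ?case by (simp add: l r \<epsilon>(3) S(3))
  next
    case (add a b)
    then show ?case
      by (simp add: \<Delta>(4,5) linear_homD(2)[OF l(1)] linear_homD(2)[OF r(1)] \<epsilon>(5) A.scale_add_left)
  next
    case (scale c a)
    then show ?case
      by (simp add: \<Delta>(4,6) linear_homD(3)[OF l(1)] linear_homD(3)[OF r(1)] \<epsilon>(6))
  next
    case (mult g a)
    then show ?case
      using ax'[OF mult(1)] l_mult[of "comult H g" "comult H a" "counit H g"]
        r_mult[of "comult H g" "comult H a" "counit H a"] by (simp add: \<Delta>(4,7) \<epsilon>(7) mult.commute)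
  qed (rule HA)
  show ?thesis
    by (intro hopf_algebra.intro hopf_algebra_axioms.intro HA comult counit S_lin coassoc
        counit_left counit_right conjunct1[OF antipode] conjunct2[OF antipode])
qed

end


section \<open>Extending an algebra to a Hopf algebra\<close>

lemma extend_simps [simp]:
  fixes A :: "('k, 'a) module"
  shows
  "carrier (module.extend A m) = carrier A"
  "monoid.mult (module.extend A m) = monoid.mult A"
  "\<one>\<^bsub>module.extend A m\<^esub> = \<one>\<^bsub>A\<^esub>"
  "\<zero>\<^bsub>module.extend A m\<^esub> = \<zero>\<^bsub>A\<^esub>"
  "add (module.extend A m) = add A"
  "module.smult (module.extend A m) = module.smult A"
  by (simp_all add: module.defs)

lemma extend_hopf_simps [simp]:
  fixes A :: "('k::field, 'a) module"
  shows "comult (module.extend A (hopf.fields \<Delta> \<epsilon> S)) = \<Delta>"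
    "counit (module.extend A (hopf.fields \<Delta> \<epsilon> S)) = \<epsilon>"
    "antipode (module.extend A (hopf.fields \<Delta> \<epsilon> S)) = S"
  by (simp_all add: module.defs hopf.defs)

text \<open>Only the carrier and the algebra operations enter the tensor product, so a
  comultiplication built over the bare algebra fits the record extended by coalgebra data.\<close>

lemma tensor_extend [simp]:
  fixes A :: "('k::field, 'a) module" and B :: "('k, 'b) module"
  shows "tensor (module.extend A m) (module.extend B m') = tensor A B"
    and "pure_tensor (module.extend A m) (module.extend B m') = pure_tensor A B"
proof -
  have D: "module.extend A m \<times>\<times> module.extend B m' = A \<times>\<times> B" by (simp add: DirProd_def)
  have I: "tensor_ideal (module.extend A m) (module.extend B m') = tensor_ideal A B"
    by (simp add: tensor_ideal_def tensor_relations_def D)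
  show "tensor (module.extend A m) (module.extend B m') = tensor A B"
    and "pure_tensor (module.extend A m) (module.extend B m') = pure_tensor A B"
    by (simp_all add: tensor_def pure_tensor_def I D fun_eq_iff)
qed

lemma algebra_hom_extend [simp]:
  "algebra_hom (module.extend A m) C = algebra_hom A C"
  "algebra_hom C (opposite_algebra (module.extend B m)) = algebra_hom C (opposite_algebra B)"
  "algebra_hom C (module.extend B m) = algebra_hom C B"
  by (auto simp: algebra_hom_def linear_hom_def ring_hom_def)

lemma assoc_algebra_extend:
  assumes "assoc_algebra A"
  shows "assoc_algebra (module.extend A m)"
proof -
  interpret A: assoc_algebra A by fact
  show ?thesis
    by (rule assoc_algebraI) (simp_all add: A.a_ac A.m_assoc A.l_distr A.r_distr A.scale_add_left A.scale_add_right
        A.smult_mult_left A.smult_mult_right)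
qed

lemma extend_pow [simp]: "a [^]\<^bsub>module.extend A m\<^esub> (k::nat) = a [^]\<^bsub>A\<^esub> k"
  by (simp add: nat_pow_def)

lemma extend_a_inv [simp]: "\<ominus>\<^bsub>module.extend A m\<^esub> a = \<ominus>\<^bsub>A\<^esub> a"
  by (simp add: a_inv_def m_inv_def)

lemma generates_extend [simp]: "generates (module.extend A m) G \<longleftrightarrow> generates A G"
  by (simp add: generates_def)

lemma pre_hopf_extend:
  fixes A :: "('k::field, 'a) module"
  assumes "assoc_algebra A" "\<Delta> \<in> algebra_hom A (tensor A A)" "\<epsilon> \<in> algebra_hom A ground_algebra"
    and "S \<in> algebra_hom A (opposite_algebra A)"
  shows "pre_hopf (module.extend A (hopf.fields \<Delta> \<epsilon> S))"
  using assms by (intro pre_hopf.intro algebra_pairI assoc_algebra_extend pre_hopf_axioms.intro) simp_all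

lemma pre_hopf_presented:
  assumes "\<And>s. \<Delta> s \<in> carrier (tensor (presented_algebra R) (presented_algebra R))"
    and "\<And>r. r \<in> R \<Longrightarrow> eval_free (tensor (presented_algebra R) (presented_algebra R)) \<Delta> r
      = \<zero>\<^bsub>tensor (presented_algebra R) (presented_algebra R)\<^esub>"
    and "\<And>r. r \<in> R \<Longrightarrow> eval_free ground_algebra \<epsilon> r = \<zero>\<^bsub>ground_algebra\<^esub>"
    and "\<And>s. S s \<in> carrier (presented_algebra R)"
    and "\<And>r. r \<in> R \<Longrightarrow> eval_free (opposite_algebra (presented_algebra R)) S r
      = \<zero>\<^bsub>opposite_algebra (presented_algebra R)\<^esub>"
  shows "pre_hopf (presented_hopf R \<Delta> \<epsilon> S)"
    and "comult (presented_hopf R \<Delta> \<epsilon> S) (presented_gen R s) = \<Delta> s"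
    and "counit (presented_hopf R \<Delta> \<epsilon> S) (presented_gen R s) = \<epsilon> s"
    and "antipode (presented_hopf R \<Delta> \<epsilon> S) (presented_gen R s) = S s"
proof -
  let ?A = "presented_algebra R"
  interpret AA: algebra_pair ?A ?A by (intro algebra_pairI assoc_algebra_presented)
  note D = presented_lift[of "tensor ?A ?A" \<Delta> R, OF AA.T.assoc_algebra_axioms assms(1,2)]
  have E_in: "\<epsilon> s \<in> carrier ground_algebra" and S_in: "S s \<in> carrier (opposite_algebra ?A)" for s
    using assms(4) by simp_all
  note E = presented_lift[of ground_algebra \<epsilon> R, OF assoc_algebra_ground E_in assms(3)]
  note S = presented_lift[of "opposite_algebra ?A" S R, OF assoc_algebra_opposite[OF assoc_algebra_presented]
      S_in assms(5)]
  show "pre_hopf (presented_hopf R \<Delta> \<epsilon> S)"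
    unfolding presented_hopf_def Let_def
    by (intro pre_hopf_extend assoc_algebra_presented D E S)
  show "comult (presented_hopf R \<Delta> \<epsilon> S) (presented_gen R s) = \<Delta> s"
    "counit (presented_hopf R \<Delta> \<epsilon> S) (presented_gen R s) = \<epsilon> s"
    "antipode (presented_hopf R \<Delta> \<epsilon> S) (presented_gen R s) = S s"
    by (simp_all add: presented_hopf_def Let_def D E S)
qed

section \<open>Group algebras as Hopf algebras\<close>

lemma generates_monoid_algebra:
  assumes "Group.monoid M"
  shows "generates (monoid_algebra M :: ('k::field, 'm \<Rightarrow>\<^sub>0 'k) module) ((\<lambda>a. Poly_Mapping.single a 1) ` carrier M)"
  unfolding generates_def
proof (intro conjI allI impI)
  let ?A = "monoid_algebra M :: ('k, 'm \<Rightarrow>\<^sub>0 'k) module" and ?G = "(\<lambda>a. Poly_Mapping.single a 1) ` carrier M"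
  interpret Group.monoid M by fact
  show "?G \<subseteq> carrier ?A" by auto
  fix S assume S: "S \<subseteq> carrier ?A" "\<one>\<^bsub>?A\<^esub> \<in> S" "\<forall>a\<in>S. \<forall>b\<in>S. a \<oplus>\<^bsub>?A\<^esub> b \<in> S"
    "\<forall>c. \<forall>a\<in>S. c \<odot>\<^bsub>?A\<^esub> a \<in> S" "\<forall>g\<in>?G. \<forall>a\<in>S. g \<otimes>\<^bsub>?A\<^esub> a \<in> S"
  have single: "Poly_Mapping.single a c \<in> S" if "a \<in> carrier M" for a c
  proof -
    have "c \<odot>\<^bsub>?A\<^esub> (Poly_Mapping.single a 1 \<otimes>\<^bsub>?A\<^esub> \<one>\<^bsub>?A\<^esub>) \<in> S" using S(2,4,5) that by blast
    then show ?thesis using that by simp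
  qed
  have "p \<in> S" if "Poly_Mapping.keys p \<subseteq> carrier M" for p
    using that
  proof (induction p rule: poly_mapping_induct_keys)
    case zero
    show ?case using single[OF one_closed, of 0] by simp
  next
    case (add a c p)
    then show ?case using S(3) single by fastforce
  qed
  then show "S = carrier ?A" using S(1) by auto
qed

lemma group_hopf_simps:
  fixes G :: "('g, 'z) monoid_scheme"
  defines "A \<equiv> monoid_algebra G :: ('k::field, 'g \<Rightarrow>\<^sub>0 'k) module"
    and "H \<equiv> group_hopf_algebra G :: ('k, 'g \<Rightarrow>\<^sub>0 'k) hopf"
  assumes "group G"
  shows pre_hopf_group: "pre_hopf H"
    and group_hopf_comult: "a \<in> carrier G \<Longrightarrow> comult H (Poly_Mapping.single a 1)
      = pure_tensor H H (Poly_Mapping.single a 1) (Poly_Mapping.single a 1)"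
    and group_hopf_counit: "a \<in> carrier G \<Longrightarrow> counit H (Poly_Mapping.single a 1) = 1"
    and group_hopf_antipode: "a \<in> carrier G \<Longrightarrow>
      antipode H (Poly_Mapping.single a 1) = Poly_Mapping.single (inv\<^bsub>G\<^esub> a) 1"
proof -
  interpret G: group G by fact
  have A: "assoc_algebra A" unfolding A_def by (rule assoc_algebra_monoid_algebra) (rule G.monoid_axioms)
  interpret AA: algebra_pair A A using A A by (rule algebra_pairI)
  interpret O: assoc_algebra "opposite_algebra A" using A by (rule assoc_algebra_opposite)
  interpret K: assoc_algebra "ground_algebra :: ('k, 'k) module" by (rule assoc_algebra_ground)
  let ?s = "\<lambda>g. Poly_Mapping.single g 1 :: 'g \<Rightarrow>\<^sub>0 'k"
  have s: "?s g \<in> carrier A" if "g \<in> carrier G" for g using that by (simp add: A_def)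
  let ?D = "linear_extension (tensor A A) (\<lambda>g. pure_tensor A A (?s g) (?s g))"
  let ?E = "linear_extension (ground_algebra :: ('k, 'k) module) (\<lambda>g. 1)"
  let ?S = "linear_extension A (\<lambda>g. ?s (inv\<^bsub>G\<^esub> g))"
  have D: "?D (?s g) = pure_tensor A A (?s g) (?s g)" if "g \<in> carrier G" for g
    using AA.pure_closed[OF s[OF that] s[OF that]] by simp
  have S: "?S (?s g) = ?s (inv\<^bsub>G\<^esub> g)" if "g \<in> carrier G" for g
    using s[of "inv\<^bsub>G\<^esub> g"] that by simp
  have H: "H = module.extend A (hopf.fields ?D ?E ?S)"
    by (simp add: H_def A_def group_hopf_algebra_def Let_def)
  have mult: "?s (a \<otimes>\<^bsub>G\<^esub> b) = ?s a \<otimes>\<^bsub>A\<^esub> ?s b" for a b by (simp add: A_def)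
  have one: "?s \<one>\<^bsub>G\<^esub> = \<one>\<^bsub>A\<^esub>" by (simp add: A_def)
  have Dh: "?D \<in> algebra_hom A (tensor A A)"
  proof -
    have "?D \<in> algebra_hom (monoid_algebra G) (tensor A A)"
    proof (rule monoid_algebra_homI[OF G.monoid_axioms AA.T.assoc_algebra_axioms AA.T.linear_extension_linear])
      show "(\<lambda>g. pure_tensor A A (?s g) (?s g)) \<in> carrier G \<rightarrow> carrier (tensor A A)" using s by auto
      fix a b assume ab: "a \<in> carrier G" "b \<in> carrier G"
      show "?D (?s (a \<otimes>\<^bsub>G\<^esub> b)) = ?D (?s a) \<otimes>\<^bsub>tensor A A\<^esub> ?D (?s b)"
        unfolding D[OF ab(1)] D[OF ab(2)] D[OF G.m_closed[OF ab]] unfolding mult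
        using s ab by (simp only: AA.pure_mult)
    next
      show "?D (?s \<one>\<^bsub>G\<^esub>) = \<one>\<^bsub>tensor A A\<^esub>"
        unfolding D[OF G.one_closed] unfolding one by (rule AA.pure_one)
    qed
    then show ?thesis by (simp add: A_def)
  qed
  have Eh: "?E \<in> algebra_hom A ground_algebra"
    unfolding A_def
    by (rule monoid_algebra_homI[OF G.monoid_axioms assoc_algebra_ground K.linear_extension_linear]) auto
  have "?S \<in> linear_hom (monoid_algebra G) A" by (rule AA.A.linear_extension_linear) (auto intro: s)
  then have Sl: "?S \<in> linear_hom (monoid_algebra G) (opposite_algebra A)" by (simp add: linear_hom_def)
  have Sh: "?S \<in> algebra_hom A (opposite_algebra A)"
  proof -
    have "?S \<in> algebra_hom (monoid_algebra G) (opposite_algebra A)"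
    proof (rule monoid_algebra_homI[OF G.monoid_axioms O.assoc_algebra_axioms Sl])
      fix a b assume "a \<in> carrier G" "b \<in> carrier G"
      then show "?S (?s (a \<otimes>\<^bsub>G\<^esub> b)) = ?S (?s a) \<otimes>\<^bsub>opposite_algebra A\<^esub> ?S (?s b)"
        by (simp only: S G.m_closed G.inv_mult_group opposite_algebra_simps) (simp only: mult)
    next
      show "?S (?s \<one>\<^bsub>G\<^esub>) = \<one>\<^bsub>opposite_algebra A\<^esub>"
        by (simp only: S G.one_closed G.inv_one opposite_algebra_simps) (rule one)
    qed
    then show ?thesis by (simp add: A_def)
  qed
  show "pre_hopf H" unfolding H by (rule pre_hopf_extend[OF A Dh Eh Sh])
  show "a \<in> carrier G \<Longrightarrow> comult H (?s a) = pure_tensor H H (?s a) (?s a)"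
    by (simp only: H extend_hopf_simps tensor_extend D)
  show "a \<in> carrier G \<Longrightarrow> counit H (?s a) = 1" by (simp add: H)
  show "a \<in> carrier G \<Longrightarrow> antipode H (?s a) = ?s (inv\<^bsub>G\<^esub> a)" by (simp only: H extend_hopf_simps S)
qed

lemma group_hopf_algebra_simps [simp]:
  "carrier (group_hopf_algebra G :: ('k::field, 'g \<Rightarrow>\<^sub>0 'k) hopf) = {p. Poly_Mapping.keys p \<subseteq> carrier G}"
  "monoid.mult (group_hopf_algebra G :: ('k, 'g \<Rightarrow>\<^sub>0 'k) hopf) = monoid.mult (monoid_algebra G :: ('k, 'g \<Rightarrow>\<^sub>0 'k) module)"
  "\<one>\<^bsub>group_hopf_algebra G :: ('k, 'g \<Rightarrow>\<^sub>0 'k) hopf\<^esub> = Poly_Mapping.single \<one>\<^bsub>G\<^esub> 1"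
  "add (group_hopf_algebra G :: ('k, 'g \<Rightarrow>\<^sub>0 'k) hopf) = (+)"
  "\<zero>\<^bsub>group_hopf_algebra G :: ('k, 'g \<Rightarrow>\<^sub>0 'k) hopf\<^esub> = 0"
  "module.smult (group_hopf_algebra G :: ('k, 'g \<Rightarrow>\<^sub>0 'k) hopf) = (\<lambda>c. Poly_Mapping.map ((*) c))"
  by (simp_all add: group_hopf_algebra_def Let_def)

lemma hopf_algebra_group:
  assumes "group G"
  shows "hopf_algebra (group_hopf_algebra G :: ('k::field, 'g \<Rightarrow>\<^sub>0 'k) hopf)"
proof -
  interpret G: group G by fact
  interpret pre_hopf "group_hopf_algebra G :: ('k, 'g \<Rightarrow>\<^sub>0 'k) hopf" using assms by (rule pre_hopf_group)
  show ?thesis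
  proof (rule hopf_algebraI)
    show "generates (group_hopf_algebra G :: ('k, 'g \<Rightarrow>\<^sub>0 'k) hopf)
        ((\<lambda>a. Poly_Mapping.single a 1) ` carrier G)"
      by (simp add: group_hopf_algebra_def Let_def generates_monoid_algebra G.monoid_axioms)
    fix s :: "'g \<Rightarrow>\<^sub>0 'k" assume "s \<in> (\<lambda>a. Poly_Mapping.single a 1) ` carrier G"
    then obtain a where "a \<in> carrier G" "s = Poly_Mapping.single a 1" by blast
    then show "hopf_axioms_at (group_hopf_algebra G) s"
      using assms
      by (intro hopf_axioms_at_grouplike)
        (simp_all add: group_hopf_comult group_hopf_counit group_hopf_antipode)
  qed
qed


section \<open>Hopf algebra maps\<close>

lemma hopf_homD:
  assumes "f \<in> hopf_hom H L"
  shows "f \<in> algebra_hom H L" "a \<in> carrier H \<Longrightarrow> comult L (f a) = tensor_map L L f f (comult H a)"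
    "a \<in> carrier H \<Longrightarrow> counit L (f a) = counit H a"
    "a \<in> carrier H \<Longrightarrow> antipode L (f a) = f (antipode H a)"
  using assms by (auto simp: hopf_hom_def)

lemma hopf_algebra_assoc: "hopf_algebra H \<Longrightarrow> assoc_algebra H"
  by (simp add: hopf_algebra_def)

lemma hopf_algebraD:
  assumes "hopf_algebra H" "a \<in> carrier H"
  shows "comult H a \<in> carrier (tensor H H)" "antipode H a \<in> carrier H"
  using hopf_algebra.comult_hom[OF assms(1)] hopf_algebra.antipode_linear[OF assms(1)] assms(2)
  by (simp_all add: algebra_homD(4) linear_homD(1))

lemma hopf_hom_comp:
  assumes "hopf_algebra H" "hopf_algebra L" "hopf_algebra M"
    and f: "f \<in> hopf_hom H L" and g: "g \<in> hopf_hom L M"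
  shows "(\<lambda>a. g (f a)) \<in> hopf_hom H M"
proof -
  note h = hopf_homD[OF f] and k = hopf_homD[OF g]
  note A = hopf_algebra_assoc[OF assms(1)] hopf_algebra_assoc[OF assms(2)] hopf_algebra_assoc[OF assms(3)]
  note hl = algebra_homD(1)[OF h(1)] and kl = algebra_homD(1)[OF k(1)]
  show ?thesis
    unfolding hopf_hom_def mem_Collect_eq
  proof (intro conjI ballI algebra_hom_comp[OF h(1) k(1)])
    fix a assume a: "a \<in> carrier H"
    have fa: "f a \<in> carrier L" by (rule linear_homD(1)[OF hl a])
    show "comult M (g (f a)) = tensor_map M M (\<lambda>a. g (f a)) (\<lambda>a. g (f a)) (comult H a)"
      using tensor_map_comp[OF A(1,1,2,2,3,3) hl hl kl kl hopf_algebraD(1)[OF assms(1) a]]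
      by (simp add: k(2)[OF fa] h(2)[OF a])
    show "counit M (g (f a)) = counit H a" by (simp add: k(3)[OF fa] h(3)[OF a])
    show "antipode M (g (f a)) = g (f (antipode H a))" by (simp add: k(4)[OF fa] h(4)[OF a])
  qed
qed

lemma hopf_hom_inv:
  assumes H: "hopf_algebra H" and L: "hopf_algebra L" and f: "f \<in> hopf_hom H L"
    and bij: "bij_betw f (carrier H) (carrier L)"
  shows "inv_into (carrier H) f \<in> hopf_hom L H"
proof -
  let ?g = "inv_into (carrier H) f"
  note h = hopf_homD[OF f] and A = hopf_algebra_assoc[OF H] hopf_algebra_assoc[OF L]
  note ha = algebra_homD[OF h(1)]
  interpret H: assoc_algebra H by (rule A)
  have g_in: "?g b \<in> carrier H" if "b \<in> carrier L" for b
    using bij that by (metis bij_betw_def inv_into_into)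
  have fg: "f (?g b) = b" if "b \<in> carrier L" for b using bij that by (rule bij_betw_inv_into_right)
  have gf: "?g (f a) = a" if "a \<in> carrier H" for a using bij that by (rule bij_betw_inv_into_left)
  have g: "?g \<in> algebra_hom L H"
  proof (rule algebra_homI[OF linear_hom_inv[OF A(1) ha(1) bij]])
    show "?g \<one>\<^bsub>L\<^esub> = \<one>\<^bsub>H\<^esub>" using gf[OF H.one_closed] by (simp add: ha)
    fix a b assume a: "a \<in> carrier L" and b: "b \<in> carrier L"
    show "?g (a \<otimes>\<^bsub>L\<^esub> b) = ?g a \<otimes>\<^bsub>H\<^esub> ?g b"
      using gf[of "?g a \<otimes>\<^bsub>H\<^esub> ?g b"] g_in[OF a] g_in[OF b] by (simp add: ha fg[OF a] fg[OF b])
  qed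
  note gl = algebra_homD(1)[OF g]
  show ?thesis
    unfolding hopf_hom_def mem_Collect_eq
  proof (intro conjI ballI g)
    fix b assume b: "b \<in> carrier L"
    have c: "comult H (?g b) \<in> carrier (tensor H H)" using hopf_algebraD(1)[OF H] g_in[OF b] by blast
    have "tensor_map H H ?g ?g (comult L b) = tensor_map H H ?g ?g (tensor_map L L f f (comult H (?g b)))"
      using h(2)[OF g_in[OF b]] by (simp add: fg[OF b])
    also have "\<dots> = comult H (?g b)"
      unfolding tensor_map_comp[OF A(1,1,2,2,1,1) ha(1) ha(1) gl gl c]
      by (rule tensor_map_ident[OF A(1,1) c]) (simp_all add: gf)
    finally show "comult H (?g b) = tensor_map H H ?g ?g (comult L b)" by simp
    show "counit H (?g b) = counit L b" using h(3)[OF g_in[OF b]] by (simp add: fg[OF b])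
    have "?g (antipode L b) = ?g (f (antipode H (?g b)))" using h(4)[OF g_in[OF b]] by (simp add: fg[OF b])
    then show "antipode H (?g b) = ?g (antipode L b)"
      using gf hopf_algebraD(2)[OF H g_in[OF b]] by simp
  qed
qed

lemma hopf_algebra_bil:
  assumes "hopf_algebra H"
  shows "(\<lambda>b c. counit H b \<odot>\<^bsub>H\<^esub> c) \<in> bilinear_maps H H H"
    and "(\<lambda>b c. counit H c \<odot>\<^bsub>H\<^esub> b) \<in> bilinear_maps H H H"
    and "(\<lambda>b c. antipode H b \<otimes>\<^bsub>H\<^esub> c) \<in> bilinear_maps H H H"
    and "(\<lambda>b c. b \<otimes>\<^bsub>H\<^esub> antipode H c) \<in> bilinear_maps H H H"
proof -
  note A = hopf_algebra_assoc[OF assms]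
  note E = algebra_homD(1)[OF hopf_algebra.counit_hom[OF assms]]
  note S = hopf_algebra.antipode_linear[OF assms]
  show "(\<lambda>b c. counit H b \<odot>\<^bsub>H\<^esub> c) \<in> bilinear_maps H H H"
    "(\<lambda>b c. counit H c \<odot>\<^bsub>H\<^esub> b) \<in> bilinear_maps H H H"
    by (intro bilinear_mapsI linear_hom_scale linear_hom_scale_fixed E linear_hom_id A; assumption)+
  show "(\<lambda>b c. antipode H b \<otimes>\<^bsub>H\<^esub> c) \<in> bilinear_maps H H H"
    by (rule bilinear_maps_precomp[OF bilinear_mult[OF A] S linear_hom_id(2)])
  show "(\<lambda>b c. b \<otimes>\<^bsub>H\<^esub> antipode H c) \<in> bilinear_maps H H H"
    by (rule bilinear_maps_precomp[OF bilinear_mult[OF A] linear_hom_id(2) S])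
qed

text \<open>Both \<open>f \<circ> S\<^sub>H\<close> and \<open>S\<^sub>L \<circ> f\<close> are convolution inverse to \<open>f\<close>.\<close>

lemma hopf_hom_if_bialgebra_hom:
  assumes H: "hopf_algebra H" and L: "hopf_algebra L" and f: "f \<in> algebra_hom H L"
    and comult: "\<And>a. a \<in> carrier H \<Longrightarrow> comult L (f a) = tensor_map L L f f (comult H a)"
    and counit: "\<And>a. a \<in> carrier H \<Longrightarrow> counit L (f a) = counit H a"
  shows "f \<in> hopf_hom H L"
proof -
  interpret H: hopf_algebra H by fact
  interpret L: hopf_algebra L by fact
  note HA = hopf_algebra_assoc[OF H] and LA = hopf_algebra_assoc[OF L]
  interpret HH: algebra_pair H H using HA HA by (rule algebra_pairI)
  interpret LL: algebra_pair L L using LA LA by (rule algebra_pairI)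
  note TA = HH.T.assoc_algebra_axioms
  interpret TH: algebra_pair "tensor H H" H using TA HA by (rule algebra_pairI)
  interpret HT: algebra_pair H "tensor H H" using HA TA by (rule algebra_pairI)
  note fl = algebra_homD(1)[OF f] and f' = algebra_homD[OF f]
  note D = algebra_homD[OF H.comult_hom]
  let ?F = "\<lambda>a. f (antipode H a)" and ?G = "\<lambda>a. antipode L (f a)"
  have F: "?F \<in> linear_hom H L" by (rule linear_hom_comp[OF H.antipode_linear fl])
  have G: "?G \<in> linear_hom H L" by (rule linear_hom_comp[OF fl L.antipode_linear])
  have Ff: "(\<lambda>b c. ?F b \<otimes>\<^bsub>L\<^esub> f c) \<in> bilinear_maps H H L"
    by (rule bilinear_maps_precomp[OF bilinear_mult[OF LA] F fl])
  have fG: "(\<lambda>b c. f b \<otimes>\<^bsub>L\<^esub> ?G c) \<in> bilinear_maps H H L"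
    by (rule bilinear_maps_precomp[OF bilinear_mult[OF LA] fl G])
  let ?Ff = "tensor_lift L (\<lambda>b c. ?F b \<otimes>\<^bsub>L\<^esub> f c)" and ?fG = "tensor_lift L (\<lambda>b c. f b \<otimes>\<^bsub>L\<^esub> ?G c)"
  note Ff' = HH.tensor_lift[OF LA Ff] and fG' = HH.tensor_lift[OF LA fG]
  note SL = LL.tensor_lift[OF LA hopf_algebra_bil(4)[OF L]]
  note SH = HH.tensor_lift[OF HA hopf_algebra_bil(3)[OF H]]
  note ff = tensor_map[OF HA HA LA LA fl fl]
  have conv_fG: "?fG (comult H a) = counit H a \<odot>\<^bsub>L\<^esub> \<one>\<^bsub>L\<^esub>" if a: "a \<in> carrier H" for a
  proof -
    have "?fG (comult H a) = tensor_lift L (\<lambda>b c. b \<otimes>\<^bsub>L\<^esub> antipode L c) (tensor_map L L f f (comult H a))"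
      by (rule HH.tensor_hom_eqI[OF LA fG'(1) linear_hom_comp[OF ff(1) SL(1)] _ D(4)[OF a]])
        (simp add: fG'(2) ff(2) SL(2) f'(4))
    then show ?thesis using L.antipode_right[OF f'(4)[OF a]] a by (simp add: comult counit)
  qed
  have conv_Ff: "?Ff (comult H a) = counit H a \<odot>\<^bsub>L\<^esub> \<one>\<^bsub>L\<^esub>" if a: "a \<in> carrier H" for a
  proof -
    have "?Ff (comult H a) = f (tensor_lift H (\<lambda>b c. antipode H b \<otimes>\<^bsub>H\<^esub> c) (comult H a))"
      by (rule HH.tensor_hom_eqI[OF LA Ff'(1) linear_hom_comp[OF SH(1) fl] _ D(4)[OF a]])
        (simp add: Ff'(2) SH(2) f'(7) linear_homD(1)[OF H.antipode_linear])
    then show ?thesis using H.antipode_left[OF a] by (simp add: f'(3,6))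
  qed
  \<comment> \<open>The two bracketings of the triple convolution product of
    \<open>f \<circ> S\<close>, f and \<open>S \<circ> f\<close>, with S the antipode of H and of L
    respectively. Coassociativity identifies their values on iterated coproducts.\<close>
  have B: "(\<lambda>a s. ?F a \<otimes>\<^bsub>L\<^esub> ?fG s) \<in> bilinear_maps H (tensor H H) L"
    by (rule bilinear_maps_precomp[OF bilinear_mult[OF LA] F fG'(1)])
  have B': "(\<lambda>s c. ?Ff s \<otimes>\<^bsub>L\<^esub> ?G c) \<in> bilinear_maps (tensor H H) H L"
    by (rule bilinear_maps_precomp[OF bilinear_mult[OF LA] Ff'(1) G])
  let ?\<Phi> = "tensor_lift L (\<lambda>a s. ?F a \<otimes>\<^bsub>L\<^esub> ?fG s)" and ?\<Psi> = "tensor_lift L (\<lambda>s c. ?Ff s \<otimes>\<^bsub>L\<^esub> ?G c)"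
  note \<Phi> = HT.tensor_lift[OF LA B] and \<Psi> = TH.tensor_lift[OF LA B']
  note as = tensor_assoc[OF HA HA HA]
  have assoc: "?\<Phi> (tensor_assoc H H H t) = ?\<Psi> t" if t: "t \<in> carrier (tensor (tensor H H) H)" for t
  proof (rule TH.tensor_hom_eqI[OF LA _ \<Psi>(1) _ t])
    note asl = algebra_homD(1)[OF as(2)]
    show "(\<lambda>t. ?\<Phi> (tensor_assoc H H H t)) \<in> linear_hom (tensor (tensor H H) H) L"
      by (rule linear_hom_comp[OF asl \<Phi>(1)])
    fix s c assume s: "s \<in> carrier (tensor H H)" and c: "c \<in> carrier H"
    show "?\<Phi> (tensor_assoc H H H (pure_tensor (tensor H H) H s c)) = ?\<Psi> (pure_tensor (tensor H H) H s c)"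
    proof (rule HH.tensor_hom_eqI[OF LA _ _ _ s])
      note p = bilinear_mapsD(2)[OF TH.pure_bilinear c]
      show "(\<lambda>s. ?\<Phi> (tensor_assoc H H H (pure_tensor (tensor H H) H s c))) \<in> linear_hom (tensor H H) L"
        by (rule linear_hom_comp[OF p linear_hom_comp[OF asl \<Phi>(1)]])
      show "(\<lambda>s. ?\<Psi> (pure_tensor (tensor H H) H s c)) \<in> linear_hom (tensor H H) L"
        by (rule linear_hom_comp[OF p \<Psi>(1)])
      fix a b assume "a \<in> carrier H" "b \<in> carrier H"
      then show "?\<Phi> (tensor_assoc H H H (pure_tensor (tensor H H) H (pure_tensor H H a b) c))
          = ?\<Psi> (pure_tensor (tensor H H) H (pure_tensor H H a b) c)"
        using c linear_homD(1)[OF F] linear_homD(1)[OF G]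
        by (simp add: as(1) \<Phi>(2) \<Psi>(2) fG'(2) Ff'(2) f'(4) L.m_assoc)
    qed
  qed
  have "?F a = ?G a" if a: "a \<in> carrier H" for a
  proof -
    note mr = tensor_map[OF HA HA HA TA linear_hom_id(1) D(1)]
    note ml = tensor_map[OF HA HA TA HA D(1) linear_hom_id(1)]
    note el = HH.tensor_lift[OF HA hopf_algebra_bil(1)[OF H]]
    note er = HH.tensor_lift[OF HA hopf_algebra_bil(2)[OF H]]
    \<comment> \<open>The convolution of f with \<open>?G\<close> is the counit times the unit,
      which reduces one bracketing to \<open>?F\<close>; the convolution of \<open>?F\<close> with f
      is the same, which reduces the other to \<open>?G\<close>.\<close>
    have "?F a = ?F (tensor_lift H (\<lambda>b c. counit H c \<odot>\<^bsub>H\<^esub> b) (comult H a))"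
      by (simp add: H.counit_right[OF a])
    also have "\<dots> = ?\<Phi> (tensor_map H (tensor H H) id (comult H) (comult H a))"
      by (rule HH.tensor_hom_eqI[OF LA linear_hom_comp[OF er(1) F] linear_hom_comp[OF mr(1) \<Phi>(1)] _ D(4)[OF a]])
        (simp add: er(2) mr(2) \<Phi>(2) D(4) conv_fG linear_homD(3)[OF F] linear_homD(1)[OF F] L.smult_mult_right)
    also have "\<dots> = ?\<Psi> (tensor_map (tensor H H) H (comult H) id (comult H a))"
      using H.coassoc[OF a] assoc[OF linear_homD(1)[OF ml(1) D(4)[OF a]]] by simp
    also have "\<dots> = ?G (tensor_lift H (\<lambda>b c. counit H b \<odot>\<^bsub>H\<^esub> c) (comult H a))"
      by (rule HH.tensor_hom_eqI[OF LA linear_hom_comp[OF ml(1) \<Psi>(1)] linear_hom_comp[OF el(1) G] _ D(4)[OF a]])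
        (simp add: el(2) ml(2) \<Psi>(2) D(4) conv_Ff linear_homD(3)[OF G] linear_homD(1)[OF G] L.smult_mult_left)
    also have "\<dots> = ?G a" by (simp add: H.counit_left[OF a])
    finally show ?thesis .
  qed
  then show ?thesis using f comult counit by (auto simp: hopf_hom_def)
qed

text \<open>Compatibility with comultiplication and counit is an equation between algebra maps, so
  generators suffice. Compatibility with the antipodes is then automatic.\<close>

lemma hopf_homI_generators:
  assumes H: "hopf_algebra H" and L: "hopf_algebra L" and gen: "generates H G" and f: "f \<in> algebra_hom H L"
    and comult: "\<And>a. a \<in> G \<Longrightarrow> comult L (f a) = tensor_map L L f f (comult H a)"
    and counit: "\<And>a. a \<in> G \<Longrightarrow> counit L (f a) = counit H a"
  shows "f \<in> hopf_hom H L"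
proof (rule hopf_hom_if_bialgebra_hom[OF H L f])
  note HA = hopf_algebra_assoc[OF H] and LA = hopf_algebra_assoc[OF L]
  fix a assume a: "a \<in> carrier H"
  show "comult L (f a) = tensor_map L L f f (comult H a)"
    by (rule generates_hom_eqI[OF gen HA algebra_hom_comp[OF f hopf_algebra.comult_hom[OF L]]
          algebra_hom_comp[OF hopf_algebra.comult_hom[OF H] tensor_map_algebra_hom[OF HA HA LA LA f f]] comult a])
  show "counit L (f a) = counit H a"
    by (rule generates_hom_eqI[OF gen HA algebra_hom_comp[OF f hopf_algebra.counit_hom[OF L]]
          hopf_algebra.counit_hom[OF H] counit a])
qed


section \<open>Gaussian binomial coefficients\<close>

text \<open>Gaussian binomial coefficients by their Pascal recursion instead of a quotient of
  q-factorials, whose denominators can vanish at roots of unity.\<close>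

fun qbinom :: "'k::field \<Rightarrow> nat \<Rightarrow> nat \<Rightarrow> 'k" where
  "qbinom q n 0 = 1"
| "qbinom q 0 (Suc k) = 0"
| "qbinom q (Suc n) (Suc k) = qbinom q n k + q ^ Suc k * qbinom q n (Suc k)"

lemma qbinom_eq_0: "n < k \<Longrightarrow> qbinom q n k = 0"
  by (induction q n k rule: qbinom.induct) auto

lemma qbinom_self [simp]: "qbinom q n n = 1"
  by (induction n) (simp_all add: qbinom_eq_0)

text \<open>The q-analogue of \<open>(k + 1) (n+1 choose k+1) = (n + 1) (n choose k)\<close>, with
  the denominators \<open>1 - q\<close> of the q-integers cleared, so that it holds for every
  q.\<close>

lemma qbinom_absorb: "(1 - q ^ Suc k) * qbinom q (Suc n) (Suc k) = (1 - q ^ Suc n) * qbinom q n k"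
proof (induction n arbitrary: k)
  case 0
  show ?case by (cases k) auto
next
  case (Suc n)
  \<comment> \<open>The q-analogue of
    \<open>(n + 1) (n choose k) = (n + 1 - k) (n+1 choose k)\<close>, multiplied by
    \<open>q ^ k\<close> to avoid a subtraction in the exponent. It combines the recursion with the
    induction hypothesis at k - 1.\<close>
  have *: "q ^ k * ((1 - q ^ Suc n) * qbinom q n k) = (q ^ k - q ^ Suc n) * qbinom q (Suc n) k"
  proof (cases k)
    case (Suc j)
    have "q ^ k * ((1 - q ^ Suc n) * qbinom q n k)
        = (1 - q ^ Suc n) * (qbinom q (Suc n) k - qbinom q n j)"
      by (simp add: Suc algebra_simps)
    also have "\<dots> = (1 - q ^ Suc n) * qbinom q (Suc n) k - (1 - q ^ k) * qbinom q (Suc n) k"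
      using Suc.IH[of j] by (simp add: Suc right_diff_distrib del: qbinom.simps)
    finally show ?thesis by (simp add: algebra_simps)
  qed simp
  have "(1 - q ^ Suc k) * qbinom q (Suc (Suc n)) (Suc k)
      = (1 - q ^ Suc k) * qbinom q (Suc n) k + q ^ Suc k * ((1 - q ^ Suc k) * qbinom q (Suc n) (Suc k))"
    by (subst qbinom.simps(3)) (simp only: distrib_left mult_ac)
  also have "\<dots> = (1 - q ^ Suc k) * qbinom q (Suc n) k + q * (q ^ k * ((1 - q ^ Suc n) * qbinom q n k))"
    unfolding Suc.IH by (simp add: mult_ac)
  also have "\<dots> = (1 - q ^ Suc (Suc n)) * qbinom q (Suc n) k"
    unfolding * by (simp add: algebra_simps del: qbinom.simps)
  finally show ?case .
qed

text \<open>If \<open>q ^ i = 1\<close> with 0 < i < m, the powers of q take at most i values, too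
  few to exhaust the m roots of unity.\<close>

lemma primitive_rootD:
  fixes q :: "'k::field"
  assumes "primitive_root_of_unity m q" "m > 0"
  shows "q ^ m = 1" "q \<noteq> 0" "\<And>i. 0 < i \<Longrightarrow> i < m \<Longrightarrow> q ^ i \<noteq> 1"
proof -
  have c: "card (roots_of_unity m :: 'k set) = m" and r: "roots_of_unity m = range (\<lambda>i::nat. q ^ i)"
    using assms by (auto simp: primitive_root_of_unity_def)
  have "q ^ 1 \<in> roots_of_unity m" unfolding r by blast
  then show "q ^ m = 1" by (simp add: roots_of_unity_def)
  then show "q \<noteq> 0" using assms(2) by (auto simp: power_0_left)
  show "q ^ i \<noteq> 1" if "0 < i" "i < m" for i
  proof
    assume "q ^ i = 1"
    then have "q ^ j = q ^ (j mod i)" for j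
      by (metis div_mult_mod_eq mult.commute mult_1 power_add power_mult power_one)
    then have "range (\<lambda>j::nat. q ^ j) \<subseteq> (\<lambda>j. q ^ j) ` {..<i}"
      using that(1) by (metis image_eqI lessThan_iff mod_less_divisor image_subsetI)
    then have "card (roots_of_unity m :: 'k set) \<le> i"
      unfolding r by (metis card_image_le card_lessThan card_mono finite_imageI finite_lessThan le_trans)
    then show False using c that by simp
  qed
qed

text \<open>In the absorption identity \<open>q ^ m = 1\<close> makes the right side vanish, while
  \<open>1 - q ^ k\<close> is nonzero.\<close>

lemma qbinom_root_of_unity:
  assumes "primitive_root_of_unity m q" "0 < k" "k < m"
  shows "qbinom q m k = 0"
proof -
  obtain j n where k: "k = Suc j" and m: "m = Suc n" using assms by (cases k; cases m) auto
  have "(1 - q ^ k) * qbinom q m k = 0"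
    using qbinom_absorb[of q j n] primitive_rootD(1)[OF assms(1)] assms by (simp add: k m)
  then show ?thesis using primitive_rootD(3)[OF assms(1) _ assms(2,3)] assms by auto
qed

text \<open>The coefficient is the q-integer \<open>(1 - q ^ k) / (1 - q)\<close>.\<close>

lemma qbinom_1_neq_0:
  assumes "primitive_root_of_unity m q" "0 < k" "k < m"
  shows "qbinom q k 1 \<noteq> 0"
proof -
  obtain j where k: "k = Suc j" using assms by (cases k) auto
  have "(1 - q) * qbinom q k 1 = 1 - q ^ k" using qbinom_absorb[of q 0 j] by (simp add: k)
  then show ?thesis using primitive_rootD(3)[OF assms(1) _ assms(2,3)] assms by force
qed


section \<open>Elements commuting up to a scalar\<close>

context assoc_algebra
begin

text \<open>Each of the i factors a passes each of the j factors b at the cost of one c.\<close>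

lemma scalar_commute_pow:
  assumes "a \<in> carrier A" "b \<in> carrier A" "a \<otimes> b = c \<odot> (b \<otimes> a)"
  shows "a [^] (i::nat) \<otimes> b [^] (j::nat) = c ^ (i * j) \<odot> (b [^] j \<otimes> a [^] i)"
proof -
  have b: "a \<otimes> b [^] j = c ^ j \<odot> (b [^] j \<otimes> a)" for j :: nat
  proof (induction j)
    case (Suc j)
    have "a \<otimes> b [^] Suc j = (a \<otimes> b [^] j) \<otimes> b" using assms by (simp add: m_assoc)
    also have "\<dots> = c ^ j \<odot> (b [^] j \<otimes> (a \<otimes> b))" using assms(1,2) by (simp add: Suc smult_mult_left m_assoc)
    also have "\<dots> = c ^ Suc j \<odot> (b [^] Suc j \<otimes> a)"
      using assms by (simp add: smult_mult_right m_assoc mult.commute)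
    finally show ?case .
  qed (use assms in simp)
  show ?thesis
  proof (induction i)
    case (Suc i)
    have "a [^] Suc i \<otimes> b [^] j = a \<otimes> (a [^] i \<otimes> b [^] j)"
      using assms(1,2) by (simp only: nat_pow_Suc2 m_assoc nat_pow_closed)
    also have "\<dots> = c ^ (i * j) \<odot> (a \<otimes> b [^] j \<otimes> a [^] i)"
      using assms(1,2) by (simp add: Suc smult_mult_right m_assoc)
    also have "\<dots> = c ^ (Suc i * j) \<odot> (b [^] j \<otimes> (a \<otimes> a [^] i))"
      using assms(1,2) by (simp add: b smult_mult_left m_assoc power_add mult.commute)
    also have "a \<otimes> a [^] i = a [^] Suc i" using assms(1) by (simp only: nat_pow_Suc2)
    finally show ?case .
  qed (use assms in simp)
qed

text \<open>The scalar is a power of c, left unspecified because the lemma serves only to show that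
  a power of a product vanishes along with a power of one factor.\<close>

lemma scalar_commute_prod_pow:
  assumes "a \<in> carrier A" "b \<in> carrier A" "b \<otimes> a = c \<odot> (a \<otimes> b)"
  shows "\<exists>d. (a \<otimes> b) [^] (k::nat) = d \<odot> (a [^] k \<otimes> b [^] k)"
proof (induction k)
  case 0
  show ?case by (rule exI[of _ 1]) simp
next
  case (Suc k)
  then obtain d where d: "(a \<otimes> b) [^] k = d \<odot> (a [^] k \<otimes> b [^] k)" by blast
  have "(a \<otimes> b) [^] Suc k = d \<odot> (a [^] k \<otimes> (b [^] k \<otimes> a [^] (1::nat)) \<otimes> b)"
    using assms(1,2) by (simp add: d smult_mult_left m_assoc)
  also have "b [^] k \<otimes> a [^] (1::nat) = c ^ k \<odot> (a \<otimes> b [^] k)"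
    using scalar_commute_pow[OF assms(2,1,3), of k 1] assms(1,2) by simp
  also have "d \<odot> (a [^] k \<otimes> (c ^ k \<odot> (a \<otimes> b [^] k)) \<otimes> b) = (d * c ^ k) \<odot> (a [^] Suc k \<otimes> b [^] Suc k)"
    using assms(1,2) by (simp add: smult_mult_left smult_mult_right m_assoc)
  finally show ?case by blast
qed

text \<open>When \<open>u \<oplus> v\<close> is multiplied from the left, v passes
  \<open>u [^] i\<close> at the cost of \<open>q ^ i\<close>. This is the weight in the Pascal
  recursion of \<open>qbinom\<close>.\<close>

lemma qbinomial_theorem:
  assumes u: "u \<in> carrier A" and v: "v \<in> carrier A" and vu: "v \<otimes> u = q \<odot> (u \<otimes> v)"
  shows "(u \<oplus> v) [^] (n::nat) = (\<Oplus>i\<in>{..n}. qbinom q n i \<odot> (u [^] i \<otimes> v [^] (n - i)))"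
proof (induction n)
  case 0
  show ?case by simp
next
  case (Suc n)
  let ?t = "\<lambda>(i::nat) (j::nat). u [^] i \<otimes> v [^] j"
  have t [simp]: "?t i j \<in> carrier A" for i j using u v by simp
  have ut: "u \<otimes> ?t i j = ?t (Suc i) j" for i j
    using u v by (simp only: nat_pow_Suc2 m_assoc nat_pow_closed)
  have vt: "v \<otimes> ?t i j = q ^ i \<odot> ?t i (Suc j)" for i j
  proof -
    have "v \<otimes> ?t i j = (v [^] (1::nat) \<otimes> u [^] i) \<otimes> v [^] j" using u v by (simp add: m_assoc)
    also have "\<dots> = q ^ i \<odot> (u [^] i \<otimes> (v \<otimes> v [^] j))"
      using u v by (subst scalar_commute_pow[OF v u vu]) (simp add: smult_mult_left m_assoc)
    finally show ?thesis using v by (simp only: nat_pow_Suc2)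
  qed
  have sum [simp]: "(\<Oplus>i\<in>{..n}. f i \<odot> ?t (g i) (k i)) \<in> carrier A"
    for f :: "nat \<Rightarrow> _" and g k by (intro finsum_closed) auto
  let ?S = "\<lambda>n. \<Oplus>i\<in>{..n}. qbinom q n i \<odot> ?t i (n - i)"
  have S: "?S n \<in> carrier A" by (intro finsum_closed) auto
  have "(u \<oplus> v) [^] Suc n = u \<otimes> ?S n \<oplus> v \<otimes> ?S n"
    using u v S Suc by (simp only: nat_pow_Suc2 a_closed l_distr)
  also have "u \<otimes> ?S n = (\<Oplus>i\<in>{..n}. qbinom q n i \<odot> ?t (Suc i) (n - i))"
    using u by (subst finsum_rdistr) (auto simp: smult_mult_right ut intro!: finsum_cong')
  also have "v \<otimes> ?S n = (\<Oplus>i\<in>{..n}. (q ^ i * qbinom q n i) \<odot> ?t i (Suc n - i))"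
    using u v by (subst finsum_rdistr)
      (auto simp: smult_mult_right vt Suc_diff_le mult.commute simp del: nat_pow_Suc intro!: finsum_cong')
  \<comment> \<open>The range may be extended because \<open>qbinom q n (Suc n) = 0\<close>.
    Splitting off the term i = 0 then shifts the index, so that both sums run over the same
    products.\<close>
  also have "\<dots> = (\<Oplus>i\<in>{..Suc n}. (q ^ i * qbinom q n i) \<odot> ?t i (Suc n - i))"
    using u v by (subst finsum_Suc) (auto simp: qbinom_eq_0 simp del: nat_pow_Suc)
  also have "\<dots> = (\<Oplus>i\<in>{..n}. (q ^ Suc i * qbinom q n (Suc i)) \<odot> ?t (Suc i) (n - i)) \<oplus> ?t 0 (Suc n)"
    using u v by (subst finsum_Suc2) (auto simp del: nat_pow_Suc nat_pow_0)
  finally have "(u \<oplus> v) [^] Suc n = ((\<Oplus>i\<in>{..n}. qbinom q n i \<odot> ?t (Suc i) (n - i))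
      \<oplus> (\<Oplus>i\<in>{..n}. (q ^ Suc i * qbinom q n (Suc i)) \<odot> ?t (Suc i) (n - i))) \<oplus> ?t 0 (Suc n)"
    using u v by (subst a_assoc) (auto simp del: nat_pow_Suc nat_pow_0)
  also have "(\<Oplus>i\<in>{..n}. qbinom q n i \<odot> ?t (Suc i) (n - i))
      \<oplus> (\<Oplus>i\<in>{..n}. (q ^ Suc i * qbinom q n (Suc i)) \<odot> ?t (Suc i) (n - i))
      = (\<Oplus>i\<in>{..n}. qbinom q (Suc n) (Suc i) \<odot> ?t (Suc i) (n - i))"
    using u v by (subst finsum_addf [symmetric])
      (auto simp: scale_add_left simp del: nat_pow_Suc intro!: finsum_cong')
  also have "\<dots> \<oplus> ?t 0 (Suc n) = ?S (Suc n)"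
    using u v by (subst finsum_Suc2) (auto simp del: nat_pow_Suc nat_pow_0)
  finally show ?case .
qed

text \<open>All interior Gaussian binomials vanish, which leaves the terms i = 0 and i = m.\<close>

lemma root_of_unity_freshman:
  assumes "u \<in> carrier A" "v \<in> carrier A" "v \<otimes> u = q \<odot> (u \<otimes> v)"
    and "primitive_root_of_unity m q" "m > 0"
  shows "(u \<oplus> v) [^] m = u [^] m \<oplus> v [^] m"
proof -
  obtain n where m: "m = Suc n" using assms(5) by (cases m) auto
  have "(u \<oplus> v) [^] m = (\<Oplus>i\<in>{..m}. qbinom q m i \<odot> (u [^] i \<otimes> v [^] (m - i)))"
    by (rule qbinomial_theorem[OF assms(1-3)])
  also have "\<dots> = (\<Oplus>i\<in>{0, m}. qbinom q m i \<odot> (u [^] i \<otimes> v [^] (m - i)))"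
    using assms(1,2,5) qbinom_root_of_unity[OF assms(4)]
    by (intro add.finprod_mono_neutral_cong_right) (auto simp: le_less)
  also have "\<dots> = u [^] m \<oplus> v [^] m"
    using assms(1,2,5) by (simp add: a_comm del: nat_pow_Suc)
  finally show ?thesis .
qed

end

section \<open>Taft pairs\<close>

text \<open>Keeps the exponents \<open>m - 1\<close> and \<open>n - 1\<close> in the form in which the definitions state them.\<close>

declare One_nat_def [simp del]

text \<open>The defining relations as a predicate on elements of an arbitrary algebra, so that one
  statement serves the presented algebra, its tensor square, its opposite, the ground field, the
  operator algebra and E.\<close>

definition taft_pair :: "('k::field, 'a, 'z) module_scheme \<Rightarrow> nat \<Rightarrow> 'k \<Rightarrow> 'a \<Rightarrow> 'a \<Rightarrow> bool" where
  "taft_pair A m q h x \<longleftrightarrow> h \<in> carrier A \<and> x \<in> carrier A \<and>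
     h [^]\<^bsub>A\<^esub> m = \<one>\<^bsub>A\<^esub> \<and> x [^]\<^bsub>A\<^esub> m = \<zero>\<^bsub>A\<^esub> \<and> x \<otimes>\<^bsub>A\<^esub> h = q \<odot>\<^bsub>A\<^esub> (h \<otimes>\<^bsub>A\<^esub> x)"

definition taft_triple ::
  "('k::field, 'a, 'z) module_scheme \<Rightarrow> nat \<Rightarrow> nat \<Rightarrow> 'k \<Rightarrow> 'k \<Rightarrow> 'a \<Rightarrow> 'a \<Rightarrow> 'a \<Rightarrow> bool" where
  "taft_triple A n m \<omega> q g h x \<longleftrightarrow> taft_pair A m q h x \<and> g \<in> carrier A \<and>
     g [^]\<^bsub>A\<^esub> n = \<one>\<^bsub>A\<^esub> \<and> h \<otimes>\<^bsub>A\<^esub> g = g \<otimes>\<^bsub>A\<^esub> h \<and> g \<otimes>\<^bsub>A\<^esub> x = \<omega> \<odot>\<^bsub>A\<^esub> (x \<otimes>\<^bsub>A\<^esub> g)"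

definition skew_primitive_pair :: "('k::field, 'a, 'z) hopf_scheme \<Rightarrow> 'a \<Rightarrow> 'a \<Rightarrow> bool" where
  "skew_primitive_pair H h x \<longleftrightarrow> comult H h = pure_tensor H H h h \<and> counit H h = 1 \<and>
     comult H x = pure_tensor H H x h \<oplus>\<^bsub>tensor H H\<^esub> pure_tensor H H \<one>\<^bsub>H\<^esub> x \<and> counit H x = 0"

definition grouplike :: "('k::field, 'a, 'z) hopf_scheme \<Rightarrow> 'a \<Rightarrow> bool" where
  "grouplike H g \<longleftrightarrow> comult H g = pure_tensor H H g g \<and> counit H g = 1"

lemma taft_pairD:
  assumes "taft_pair A m q h x"
  shows "h \<in> carrier A" "x \<in> carrier A" "h [^]\<^bsub>A\<^esub> m = \<one>\<^bsub>A\<^esub>" "x [^]\<^bsub>A\<^esub> m = \<zero>\<^bsub>A\<^esub>"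
    "x \<otimes>\<^bsub>A\<^esub> h = q \<odot>\<^bsub>A\<^esub> (h \<otimes>\<^bsub>A\<^esub> x)"
  using assms by (auto simp: taft_pair_def)

lemma taft_tripleD:
  assumes "taft_triple A n m \<omega> q g h x"
  shows "taft_pair A m q h x" "g \<in> carrier A" "g [^]\<^bsub>A\<^esub> n = \<one>\<^bsub>A\<^esub>"
    "h \<otimes>\<^bsub>A\<^esub> g = g \<otimes>\<^bsub>A\<^esub> h" "g \<otimes>\<^bsub>A\<^esub> x = \<omega> \<odot>\<^bsub>A\<^esub> (x \<otimes>\<^bsub>A\<^esub> g)"
  using assms by (auto simp: taft_triple_def)

lemma taft_pair_hom:
  assumes "assoc_algebra A" "assoc_algebra B" "f \<in> algebra_hom A B" "taft_pair A m q h x"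
  shows "taft_pair B m q (f h) (f x)"
proof -
  interpret A: assoc_algebra A by fact
  note f = algebra_homD[OF assms(3)] and p = taft_pairD[OF assms(4)]
  have "f x \<otimes>\<^bsub>B\<^esub> f h = f (x \<otimes>\<^bsub>A\<^esub> h)" using p(1,2) by (simp add: f)
  also have "\<dots> = q \<odot>\<^bsub>B\<^esub> (f h \<otimes>\<^bsub>B\<^esub> f x)" using p(1,2) by (simp add: p(5) f)
  finally show ?thesis
    using p(1-4) algebra_hom_pow[OF assms(1-3) p(1), of m] algebra_hom_pow[OF assms(1-3) p(2), of m]
      linear_hom_zero[OF assms(1,2) f(1)]
    by (simp add: taft_pair_def f(3,4))
qed

lemma (in algebra_pair) pure_sum_mult:
  assumes "a \<in> carrier A" "b \<in> carrier B" "c \<in> carrier A" "d \<in> carrier B" "u \<in> carrier A" "v \<in> carrier B"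
  shows "(pure a b \<oplus>\<^bsub>tensor A B\<^esub> pure c d) \<otimes>\<^bsub>tensor A B\<^esub> pure u v
      = pure (a \<otimes>\<^bsub>A\<^esub> u) (b \<otimes>\<^bsub>B\<^esub> v) \<oplus>\<^bsub>tensor A B\<^esub> pure (c \<otimes>\<^bsub>A\<^esub> u) (d \<otimes>\<^bsub>B\<^esub> v)"
    and "pure u v \<otimes>\<^bsub>tensor A B\<^esub> (pure a b \<oplus>\<^bsub>tensor A B\<^esub> pure c d)
      = pure (u \<otimes>\<^bsub>A\<^esub> a) (v \<otimes>\<^bsub>B\<^esub> b) \<oplus>\<^bsub>tensor A B\<^esub> pure (u \<otimes>\<^bsub>A\<^esub> c) (v \<otimes>\<^bsub>B\<^esub> d)"
  using assms by (simp_all add: T.l_distr T.r_distr)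

context assoc_algebra
begin

text \<open>With \<open>u = x \<otimes> h\<close> and \<open>v = 1 \<otimes> x\<close> one has
  \<open>vu = quv\<close>, hence \<open>(u + v)^m = x^m \<otimes> h^m + 1 \<otimes> x^m = 0\<close>.
  This is why the comultiplication respects the relation for \<open>x^m\<close>.\<close>

lemma taft_pair_tensor:
  assumes p: "taft_pair A m q h x" and q: "primitive_root_of_unity m q" "m > 0"
  shows "taft_pair (tensor A A) m q (pure_tensor A A h h)
    (pure_tensor A A x h \<oplus>\<^bsub>tensor A A\<^esub> pure_tensor A A \<one> x)"
proof -
  interpret AA: algebra_pair A A by (intro algebra_pairI assoc_algebra_axioms)
  note p' = taft_pairD[OF p]
  note [simp] = p'(1,2)
  let ?u = "pure_tensor A A x h" and ?v = "pure_tensor A A \<one> x"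
  have vu: "?v \<otimes>\<^bsub>tensor A A\<^esub> ?u = q \<odot>\<^bsub>tensor A A\<^esub> (?u \<otimes>\<^bsub>tensor A A\<^esub> ?v)"
    by (simp add: p'(5) AA.pure_scale_right)
  have "(?u \<oplus>\<^bsub>tensor A A\<^esub> ?v) [^]\<^bsub>tensor A A\<^esub> m = \<zero>\<^bsub>tensor A A\<^esub>"
    by (subst AA.T.root_of_unity_freshman[OF _ _ vu q])
      (simp_all add: p'(3,4) AA.pure_zero_left AA.pure_zero_right)
  then show ?thesis
    by (simp add: taft_pair_def p'(3,5) AA.pure_one AA.pure_sum_mult AA.pure_scale_left AA.pure_scale_right
        AA.T.scale_add_right)
qed

text \<open>The two elements are the antipodes of h and x; that they satisfy the relations in the
  opposite algebra lets the antipode be defined as an antihomomorphism. Up to a scalar, the m-th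
  power of \<open>x h^(m-1)\<close> contains the factor \<open>x^m\<close>.\<close>

lemma taft_pair_opposite:
  assumes p: "taft_pair A m q h x" and q: "primitive_root_of_unity m q" "m > 0"
  shows "taft_pair (opposite_algebra A) m q (h [^] (m - 1)) (\<ominus> (x \<otimes> h [^] (m - 1)))"
    and "h [^] (m - 1) \<otimes> h = \<one>" "h \<otimes> h [^] (m - 1) = \<one>"
proof -
  note p' = taft_pairD[OF p]
  note [simp] = p'(1,2)
  let ?h = "h [^] (m - 1)"
  obtain k where m: "m = Suc k" using q by (cases m) auto
  show hh: "?h \<otimes> h = \<one>" "h \<otimes> ?h = \<one>"
    using p'(3) by (simp_all only: m nat_pow_Suc diff_Suc_1 p'(1)) (simp flip: nat_pow_Suc2)
  have xh: "x \<otimes> h [^] k = q ^ k \<odot> (h [^] k \<otimes> x)"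
    using scalar_commute_pow[OF p'(2,1,5), of 1 k] by simp
  \<comment> \<open>Moving x past \<open>h^(m-1)\<close> costs \<open>q^(m-1)\<close>, the inverse
    of q.\<close>
  have hx: "?h \<otimes> x = q \<odot> (x \<otimes> ?h)"
    using primitive_rootD(1)[OF q] by (simp add: m xh)
  have "(\<ominus> (x \<otimes> ?h)) [^] m = \<zero>"
  proof -
    obtain d where "(x \<otimes> ?h) [^] m = d \<odot> (x [^] m \<otimes> ?h [^] m)"
      using scalar_commute_prod_pow[OF p'(2) _ hx] by auto
    then have "(x \<otimes> ?h) [^] m = \<zero>" by (simp add: p'(4))
    moreover have "\<ominus> (x \<otimes> ?h) = (- 1) \<odot> (x \<otimes> ?h)" by (simp add: scale_minus_one)
    ultimately show ?thesis by (simp add: scale_nat_pow)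
  qed
  moreover have "?h [^] m = \<one>"
  proof -
    have "?h [^] m = (h [^] m) [^] (m - 1)" by (simp add: nat_pow_pow mult.commute)
    then show ?thesis by (simp add: p'(3))
  qed
  moreover have "?h \<otimes> (\<ominus> (x \<otimes> ?h)) = q \<odot> ((\<ominus> (x \<otimes> ?h)) \<otimes> ?h)"
  proof -
    have "?h \<otimes> (x \<otimes> ?h) = q \<odot> (x \<otimes> ?h \<otimes> ?h)"
      by (simp add: hx smult_mult_left flip: m_assoc)
    then show ?thesis by (simp add: r_minus l_minus scale_minus_right)
  qed
  ultimately show "taft_pair (opposite_algebra A) m q ?h (\<ominus> (x \<otimes> ?h))"
    by (simp add: taft_pair_def opposite_algebra_pow[OF assoc_algebra_axioms])
qed

lemma taft_triple_tensor:
  assumes t: "taft_triple A n m \<omega> q g h x" and q: "primitive_root_of_unity m q" "m > 0"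
  shows "taft_triple (tensor A A) n m \<omega> q (pure_tensor A A g g) (pure_tensor A A h h)
    (pure_tensor A A x h \<oplus>\<^bsub>tensor A A\<^esub> pure_tensor A A \<one> x)"
proof -
  interpret AA: algebra_pair A A by (intro algebra_pairI assoc_algebra_axioms)
  note t' = taft_tripleD[OF t]
  note p' = taft_pairD[OF t'(1)]
  note [simp] = p'(1,2) t'(2)
  show ?thesis
    using taft_pair_tensor[OF t'(1) q]
    by (simp add: taft_triple_def t'(3,5) t'(4) AA.pure_one AA.pure_sum_mult AA.pure_scale_left AA.pure_scale_right
        AA.T.scale_add_right)
qed

lemma taft_triple_opposite:
  assumes t: "taft_triple A n m \<omega> q g h x" and q: "primitive_root_of_unity m q" "m > 0"
    and \<omega>: "\<omega> ^ n = 1" and n: "n > 0"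
  shows "taft_triple (opposite_algebra A) n m \<omega> q (g [^] (n - 1)) (h [^] (m - 1)) (\<ominus> (x \<otimes> h [^] (m - 1)))"
    and "g [^] (n - 1) \<otimes> g = \<one>" "g \<otimes> g [^] (n - 1) = \<one>"
proof -
  note t' = taft_tripleD[OF t]
  note p' = taft_pairD[OF t'(1)]
  note [simp] = p'(1,2) t'(2)
  let ?g = "g [^] (n - 1)" and ?h = "h [^] (m - 1)"
  obtain k where k: "n = Suc k" using n by (cases n) auto
  show gg: "?g \<otimes> g = \<one>" "g \<otimes> ?g = \<one>"
    using t'(3) by (simp_all only: k nat_pow_Suc diff_Suc_1 t'(2)) (simp flip: nat_pow_Suc2)
  have "?g [^] n = (g [^] n) [^] (n - 1)" by (simp add: nat_pow_pow mult.commute)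
  then have 1: "?g [^] n = \<one>" by (simp add: t'(3))
  have hg: "?g \<otimes> ?h = ?h \<otimes> ?g"
    using scalar_commute_pow[of g h 1 "n - 1" "m - 1"] by (simp add: t'(4))
  have "?g \<otimes> x = \<omega> ^ (n - 1) \<odot> (x \<otimes> ?g)"
    using scalar_commute_pow[OF t'(2) p'(2) t'(5), of "n - 1" 1] by simp
  \<comment> \<open>\<open>\<omega> ^ (n - 1)\<close> inverts \<omega>, because
    \<open>\<omega> ^ n = 1\<close>.\<close>
  then have gx: "\<omega> \<odot> (?g \<otimes> x) = x \<otimes> ?g" using \<omega> by (simp add: k)
  have "x \<otimes> ?h \<otimes> ?g = \<omega> \<odot> (?g \<otimes> (x \<otimes> ?h))"
  proof -
    have "x \<otimes> ?h \<otimes> ?g = x \<otimes> ?g \<otimes> ?h" by (simp only: m_assoc hg p'(1,2) t'(2) nat_pow_closed)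
    also have "\<dots> = \<omega> \<odot> (?g \<otimes> x) \<otimes> ?h" by (simp only: gx)
    also have "\<dots> = \<omega> \<odot> (?g \<otimes> (x \<otimes> ?h))" by (simp add: smult_mult_left m_assoc)
    finally show ?thesis .
  qed
  then have 2: "(\<ominus> (x \<otimes> ?h)) \<otimes> ?g = \<omega> \<odot> (?g \<otimes> (\<ominus> (x \<otimes> ?h)))"
    by (simp add: l_minus r_minus scale_minus_right)
  show "taft_triple (opposite_algebra A) n m \<omega> q ?g ?h (\<ominus> (x \<otimes> ?h))"
    using taft_pair_opposite(1)[OF t'(1) q]
    by (simp add: taft_triple_def opposite_algebra_pow[OF assoc_algebra_axioms] 1 2 hg)
qed

lemma eval_free_diff:
  assumes \<phi>: "\<And>s. \<phi> s \<in> carrier A"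
  shows "eval_free A \<phi> (Poly_Mapping.single v c - Poly_Mapping.single w d)
    = (c \<odot> eval_word A \<phi> v) \<ominus> (d \<odot> eval_word A \<phi> w)"
proof -
  have single: "eval_free A \<phi> (Poly_Mapping.single w c) = c \<odot> eval_word A \<phi> w" for w c
    using linear_extension_single[where f = "eval_word A \<phi>" and a = w and c = c]
      eval_word_closed[of \<phi> w, OF \<phi>] by simp
  have "eval_free A \<phi> (Poly_Mapping.single v c \<ominus>\<^bsub>free_algebra\<^esub> Poly_Mapping.single w d)
    = eval_free A \<phi> (Poly_Mapping.single v c) \<ominus> eval_free A \<phi> (Poly_Mapping.single w d)"
    by (rule linear_hom_diff[OF assoc_algebra_free assoc_algebra_axioms algebra_homD(1)[OF eval_free_hom]])
      (simp_all add: \<phi> free_algebra_def)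
  then show ?thesis
    by (simp add: single free_algebra_def monoid_algebra_minus[OF monoid_word_monoid])
qed

lemma eval_free_single:
  assumes \<phi>: "\<And>s. \<phi> s \<in> carrier A"
  shows "eval_free A \<phi> (Poly_Mapping.single w c) = c \<odot> eval_word A \<phi> w"
  using linear_extension_single[where f = "eval_word A \<phi>" and a = w and c = c]
      eval_word_closed[of \<phi> w, OF \<phi>] by simp

text \<open>Connects the encoded words with the predicate: an assignment of the generators extends
  to the presented algebra exactly when its values form a Taft pair.\<close>

lemma taft_relations_iff:
  assumes \<phi>: "\<And>s. \<phi> s \<in> carrier A"
  shows "(\<forall>r\<in>taft_relations m q. eval_free A \<phi> r = \<zero>) \<longleftrightarrow> taft_pair A m q (\<phi> Taft_h) (\<phi> Taft_x)"
  by (simp add: taft_relations_def eval_free_diff[of \<phi>, OF \<phi>] eval_free_single[of \<phi>, OF \<phi>] \<phi>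
      taft_pair_def r_right_minus_eq conj_ac del: foldr_replicate)

lemma taft_ext_relations_iff:
  assumes \<phi>: "\<And>s. \<phi> s \<in> carrier A"
  shows "(\<forall>r\<in>taft_ext_relations n m \<omega> q. eval_free A \<phi> r = \<zero>)
    \<longleftrightarrow> taft_triple A n m \<omega> q (\<phi> Ext_g) (\<phi> Ext_h) (\<phi> Ext_x)"
  by (simp add: taft_ext_relations_def eval_free_diff[of \<phi>, OF \<phi>] eval_free_single[of \<phi>, OF \<phi>] \<phi>
      taft_triple_def taft_pair_def r_right_minus_eq conj_ac del: foldr_replicate)

end

lemma presented_hopf_simps [simp]:
  "carrier (presented_hopf R \<Delta> \<epsilon> S) = carrier (presented_algebra R)"
  "monoid.mult (presented_hopf R \<Delta> \<epsilon> S) = monoid.mult (presented_algebra R)"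
  "\<one>\<^bsub>presented_hopf R \<Delta> \<epsilon> S\<^esub> = \<one>\<^bsub>presented_algebra R\<^esub>"
  "\<zero>\<^bsub>presented_hopf R \<Delta> \<epsilon> S\<^esub> = \<zero>\<^bsub>presented_algebra R\<^esub>"
  "add (presented_hopf R \<Delta> \<epsilon> S) = add (presented_algebra R)"
  "module.smult (presented_hopf R \<Delta> \<epsilon> S) = module.smult (presented_algebra R)"
  "\<ominus>\<^bsub>presented_hopf R \<Delta> \<epsilon> S\<^esub> a = \<ominus>\<^bsub>presented_algebra R\<^esub> a"
  "a [^]\<^bsub>presented_hopf R \<Delta> \<epsilon> S\<^esub> (k::nat) = a [^]\<^bsub>presented_algebra R\<^esub> k"
  "tensor (presented_hopf R \<Delta> \<epsilon> S) (presented_hopf R \<Delta> \<epsilon> S) = tensor (presented_algebra R) (presented_algebra R)"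
  "pure_tensor (presented_hopf R \<Delta> \<epsilon> S) (presented_hopf R \<Delta> \<epsilon> S)
    = pure_tensor (presented_algebra R) (presented_algebra R)"
  "generates (presented_hopf R \<Delta> \<epsilon> S) G = generates (presented_algebra R) G"
  "algebra_hom (presented_hopf R \<Delta> \<epsilon> S) C = algebra_hom (presented_algebra R) C"
  "taft_pair (presented_hopf R \<Delta> \<epsilon> S) m q h x = taft_pair (presented_algebra R) m q h x"
  "taft_triple (presented_hopf R \<Delta> \<epsilon> S) n m \<omega> q g h x = taft_triple (presented_algebra R) n m \<omega> q g h x"
  by (simp_all add: presented_hopf_def Let_def taft_triple_def taft_pair_def)

section \<open>The Taft algebra as a Hopf algebra\<close>

abbreviation taft_h :: "nat \<Rightarrow> 'k::field \<Rightarrow> (taft_gen list \<Rightarrow>\<^sub>0 'k) set" where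
  "taft_h m q \<equiv> presented_gen (taft_relations m q) Taft_h"

abbreviation taft_x :: "nat \<Rightarrow> 'k::field \<Rightarrow> (taft_gen list \<Rightarrow>\<^sub>0 'k) set" where
  "taft_x m q \<equiv> presented_gen (taft_relations m q) Taft_x"

lemma taft_pair_presented: "taft_pair (presented_algebra (taft_relations m q)) m q (taft_h m q) (taft_x m q)"
  using assoc_algebra.taft_relations_iff[OF assoc_algebra_presented,
      of "presented_gen (taft_relations m q)" "taft_relations m q" m q] presented_relation
  by auto

lemma range_taft_gen: "range f = {f Taft_h, f Taft_x}"
  by (auto, metis taft_gen.exhaust)

lemma taft_hopf:
  assumes q: "primitive_root_of_unity m (q :: 'k::field)" "m > 0"
  shows hopf_algebra_taft: "hopf_algebra (taft_hopf m q)"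
    and skew_primitive_pair_taft: "skew_primitive_pair (taft_hopf m q) (taft_h m q) (taft_x m q)"
    and taft_pair_taft: "taft_pair (taft_hopf m q) m q (taft_h m q) (taft_x m q)"
    and generates_taft: "generates (taft_hopf m q) {taft_h m q, taft_x m q}"
proof -
  let ?R = "taft_relations m q" and ?A = "presented_algebra (taft_relations m q)"
  let ?h = "taft_h m q" and ?x = "taft_x m q" and ?t = "pure_tensor ?A ?A"
  interpret A: assoc_algebra ?A by (rule assoc_algebra_presented)
  interpret AA: algebra_pair ?A ?A by (intro algebra_pairI assoc_algebra_presented)
  note p = taft_pair_presented[of m q]
  define \<Delta> where "\<Delta> = (\<lambda>s. case s of Taft_h \<Rightarrow> ?t ?h ?h
      | Taft_x \<Rightarrow> ?t ?x ?h \<oplus>\<^bsub>tensor ?A ?A\<^esub> ?t \<one>\<^bsub>?A\<^esub> ?x)"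
  define \<epsilon> :: "taft_gen \<Rightarrow> 'k" where "\<epsilon> = (\<lambda>s. case s of Taft_h \<Rightarrow> 1 | Taft_x \<Rightarrow> 0)"
  define S where "S = (\<lambda>s. case s of Taft_h \<Rightarrow> inv\<^bsub>?A\<^esub> ?h | Taft_x \<Rightarrow> \<ominus>\<^bsub>?A\<^esub> (?x \<otimes>\<^bsub>?A\<^esub> inv\<^bsub>?A\<^esub> ?h))"
  have H: "taft_hopf m q = presented_hopf ?R \<Delta> \<epsilon> S"
    by (simp add: taft_hopf_def Let_def \<Delta>_def \<epsilon>_def S_def)
  note o = A.taft_pair_opposite[OF p q]
  \<comment> \<open>The antipode is defined with \<open>inv\<close>; replacing it by a power of h
    makes the commutation rules applicable.\<close>
  have inv: "inv\<^bsub>?A\<^esub> ?h = ?h [^]\<^bsub>?A\<^esub> (m - 1)"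
    by (rule A.inv_char) (simp_all add: o(2,3))
  have D_in: "\<Delta> s \<in> carrier (tensor ?A ?A)" and S_in: "S s \<in> carrier ?A"
    and E_in: "\<epsilon> s \<in> carrier ground_algebra" for s
    by (cases s; simp add: \<Delta>_def S_def inv)+
  interpret K: assoc_algebra "ground_algebra :: ('k, 'k) module" by (rule assoc_algebra_ground)
  interpret O: assoc_algebra "opposite_algebra ?A" by (rule assoc_algebra_opposite[OF assoc_algebra_presented])
  have kpow: "a [^]\<^bsub>(ground_algebra :: ('k, 'k) module)\<^esub> (k::nat) = a ^ k" for a k
    by (induction k) (simp_all add: mult.commute)
  have "taft_pair (tensor ?A ?A) m q (\<Delta> Taft_h) (\<Delta> Taft_x)"
    using A.taft_pair_tensor[OF p q] by (simp add: \<Delta>_def)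
  with AA.T.taft_relations_iff[of \<Delta>, OF D_in]
  have D_rel: "eval_free (tensor ?A ?A) \<Delta> r = \<zero>\<^bsub>tensor ?A ?A\<^esub>" if "r \<in> ?R" for r using that by blast
  \<comment> \<open>The counit sends x to 0, and \<open>0 ^ m = 0\<close> uses
    \<open>m > 0\<close>.\<close>
  have "taft_pair ground_algebra m q (\<epsilon> Taft_h) (\<epsilon> Taft_x)"
    using q(2) by (simp add: taft_pair_def kpow \<epsilon>_def)
  with K.taft_relations_iff[of \<epsilon>, OF E_in]
  have E_rel: "eval_free ground_algebra \<epsilon> r = \<zero>\<^bsub>ground_algebra\<^esub>" if "r \<in> ?R" for r using that by blast
  have "taft_pair (opposite_algebra ?A) m q (S Taft_h) (S Taft_x)" using o(1) by (simp add: S_def inv)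
  moreover have "S s \<in> carrier (opposite_algebra ?A)" for s using S_in by simp
  note O.taft_relations_iff[of S, OF this]
  ultimately have S_rel: "eval_free (opposite_algebra ?A) S r = \<zero>\<^bsub>opposite_algebra ?A\<^esub>" if "r \<in> ?R" for r
    using that by blast
  note pre = pre_hopf_presented[of \<Delta> ?R \<epsilon> S, OF D_in D_rel E_rel S_in S_rel]
  interpret P: pre_hopf "taft_hopf m q" unfolding H by (rule pre(1))
  show "taft_pair (taft_hopf m q) m q ?h ?x" using p by (simp add: H)
  show s: "skew_primitive_pair (taft_hopf m q) ?h ?x"
    by (simp add: skew_primitive_pair_def H pre(2,3)) (simp add: \<Delta>_def \<epsilon>_def)
  have gen: "generates (taft_hopf m q) (range (presented_gen ?R))"
    by (simp add: H generates_presented)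
  then show "generates (taft_hopf m q) {?h, ?x}" unfolding range_taft_gen .
  have Sh: "antipode (taft_hopf m q) ?h = ?h [^]\<^bsub>?A\<^esub> (m - 1)"
    "antipode (taft_hopf m q) ?x = \<ominus>\<^bsub>?A\<^esub> (?x \<otimes>\<^bsub>?A\<^esub> ?h [^]\<^bsub>?A\<^esub> (m - 1))"
    by (simp_all only: H pre(4)) (simp_all add: S_def inv)
  show "hopf_algebra (taft_hopf m q)"
  proof (rule P.hopf_algebraI[OF gen])
    have "hopf_axioms_at (taft_hopf m q) ?h"
      using s by (intro P.hopf_axioms_at_grouplike) (simp_all add: skew_primitive_pair_def Sh, simp_all add: H o)
    moreover have "hopf_axioms_at (taft_hopf m q) ?x"
      using s by (intro P.hopf_axioms_at_skew_primitive[of _ ?h])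
        (simp_all add: skew_primitive_pair_def Sh, simp_all add: H o)
    ultimately show "hopf_axioms_at (taft_hopf m q) g" if "g \<in> range (presented_gen ?R)" for g
      using that by (auto simp: range_taft_gen)
  qed
qed

section \<open>The extension by a grouplike generator as a Hopf algebra\<close>

abbreviation ext_g :: "nat \<Rightarrow> nat \<Rightarrow> 'k::field \<Rightarrow> 'k \<Rightarrow> (taft_ext_gen list \<Rightarrow>\<^sub>0 'k) set" where
  "ext_g n m \<omega> q \<equiv> presented_gen (taft_ext_relations n m \<omega> q) Ext_g"

abbreviation ext_h :: "nat \<Rightarrow> nat \<Rightarrow> 'k::field \<Rightarrow> 'k \<Rightarrow> (taft_ext_gen list \<Rightarrow>\<^sub>0 'k) set" where
  "ext_h n m \<omega> q \<equiv> presented_gen (taft_ext_relations n m \<omega> q) Ext_h"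

abbreviation ext_x :: "nat \<Rightarrow> nat \<Rightarrow> 'k::field \<Rightarrow> 'k \<Rightarrow> (taft_ext_gen list \<Rightarrow>\<^sub>0 'k) set" where
  "ext_x n m \<omega> q \<equiv> presented_gen (taft_ext_relations n m \<omega> q) Ext_x"

lemma taft_triple_presented:
  "taft_triple (presented_algebra (taft_ext_relations n m \<omega> q)) n m \<omega> q
    (ext_g n m \<omega> q) (ext_h n m \<omega> q) (ext_x n m \<omega> q)"
  using assoc_algebra.taft_ext_relations_iff[OF assoc_algebra_presented,
      of "presented_gen (taft_ext_relations n m \<omega> q)" "taft_ext_relations n m \<omega> q" n m \<omega> q] presented_relation
  by auto

lemma range_taft_ext_gen: "range f = {f Ext_g, f Ext_h, f Ext_x}"
  by (auto, metis taft_ext_gen.exhaust)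

lemma taft_ext_hopf:
  assumes q: "primitive_root_of_unity m (q :: 'k::field)" "m > 0" and \<omega>: "\<omega> ^ n = 1" and n: "n > 0"
  shows hopf_algebra_taft_ext: "hopf_algebra (taft_ext_hopf n m \<omega> q)"
    and skew_primitive_pair_taft_ext: "skew_primitive_pair (taft_ext_hopf n m \<omega> q) (ext_h n m \<omega> q) (ext_x n m \<omega> q)"
    and grouplike_taft_ext: "grouplike (taft_ext_hopf n m \<omega> q) (ext_g n m \<omega> q)"
    and taft_triple_taft_ext: "taft_triple (taft_ext_hopf n m \<omega> q) n m \<omega> q
      (ext_g n m \<omega> q) (ext_h n m \<omega> q) (ext_x n m \<omega> q)"
    and generates_taft_ext: "generates (taft_ext_hopf n m \<omega> q) {ext_g n m \<omega> q, ext_h n m \<omega> q, ext_x n m \<omega> q}"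
proof -
  let ?R = "taft_ext_relations n m \<omega> q" and ?A = "presented_algebra (taft_ext_relations n m \<omega> q)"
  let ?g = "ext_g n m \<omega> q" and ?h = "ext_h n m \<omega> q" and ?x = "ext_x n m \<omega> q" and ?t = "pure_tensor ?A ?A"
  let ?H = "taft_ext_hopf n m \<omega> q"
  interpret A: assoc_algebra ?A by (rule assoc_algebra_presented)
  interpret AA: algebra_pair ?A ?A by (intro algebra_pairI assoc_algebra_presented)
  note p = taft_triple_presented[of n m \<omega> q]
  define \<Delta> where "\<Delta> = (\<lambda>s. case s of Ext_g \<Rightarrow> ?t ?g ?g | Ext_h \<Rightarrow> ?t ?h ?h
      | Ext_x \<Rightarrow> ?t ?x ?h \<oplus>\<^bsub>tensor ?A ?A\<^esub> ?t \<one>\<^bsub>?A\<^esub> ?x)"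
  define \<epsilon> :: "taft_ext_gen \<Rightarrow> 'k" where "\<epsilon> = (\<lambda>s. case s of Ext_g \<Rightarrow> 1 | Ext_h \<Rightarrow> 1 | Ext_x \<Rightarrow> 0)"
  define S where "S = (\<lambda>s. case s of Ext_g \<Rightarrow> ?g [^]\<^bsub>?A\<^esub> (n - 1) | Ext_h \<Rightarrow> ?h [^]\<^bsub>?A\<^esub> (m - 1)
      | Ext_x \<Rightarrow> \<ominus>\<^bsub>?A\<^esub> (?x \<otimes>\<^bsub>?A\<^esub> ?h [^]\<^bsub>?A\<^esub> (m - 1)))"
  have H: "?H = presented_hopf ?R \<Delta> \<epsilon> S"
    by (simp add: taft_ext_hopf_def Let_def \<Delta>_def \<epsilon>_def S_def)
  note o = A.taft_triple_opposite[OF p q \<omega> n] A.taft_pair_opposite(2,3)[OF taft_tripleD(1)[OF p] q]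
  have D_in: "\<Delta> s \<in> carrier (tensor ?A ?A)" and S_in: "S s \<in> carrier ?A"
    and E_in: "\<epsilon> s \<in> carrier ground_algebra" for s
    by (cases s; simp add: \<Delta>_def S_def)+
  interpret K: assoc_algebra "ground_algebra :: ('k, 'k) module" by (rule assoc_algebra_ground)
  interpret O: assoc_algebra "opposite_algebra ?A" by (rule assoc_algebra_opposite[OF assoc_algebra_presented])
  have kpow: "a [^]\<^bsub>(ground_algebra :: ('k, 'k) module)\<^esub> (k::nat) = a ^ k" for a k
    by (induction k) (simp_all add: mult.commute)
  have "taft_triple (tensor ?A ?A) n m \<omega> q (\<Delta> Ext_g) (\<Delta> Ext_h) (\<Delta> Ext_x)"
    using A.taft_triple_tensor[OF p q] by (simp add: \<Delta>_def)
  with AA.T.taft_ext_relations_iff[of \<Delta>, OF D_in]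
  have D_rel: "eval_free (tensor ?A ?A) \<Delta> r = \<zero>\<^bsub>tensor ?A ?A\<^esub>" if "r \<in> ?R" for r using that by blast
  have "taft_triple ground_algebra n m \<omega> q (\<epsilon> Ext_g) (\<epsilon> Ext_h) (\<epsilon> Ext_x)"
    using q(2) by (simp add: taft_triple_def taft_pair_def kpow \<epsilon>_def)
  with K.taft_ext_relations_iff[of \<epsilon>, OF E_in]
  have E_rel: "eval_free ground_algebra \<epsilon> r = \<zero>\<^bsub>ground_algebra\<^esub>" if "r \<in> ?R" for r using that by blast
  have "taft_triple (opposite_algebra ?A) n m \<omega> q (S Ext_g) (S Ext_h) (S Ext_x)" using o(1) by (simp add: S_def)
  moreover have "S s \<in> carrier (opposite_algebra ?A)" for s using S_in by simp
  note O.taft_ext_relations_iff[of S, OF this]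
  ultimately have S_rel: "eval_free (opposite_algebra ?A) S r = \<zero>\<^bsub>opposite_algebra ?A\<^esub>" if "r \<in> ?R" for r
    using that by blast
  note pre = pre_hopf_presented[of \<Delta> ?R \<epsilon> S, OF D_in D_rel E_rel S_in S_rel]
  interpret P: pre_hopf ?H unfolding H by (rule pre(1))
  show "taft_triple ?H n m \<omega> q ?g ?h ?x" using p by (simp add: H)
  show s: "skew_primitive_pair ?H ?h ?x"
    by (simp add: skew_primitive_pair_def H pre(2,3)) (simp add: \<Delta>_def \<epsilon>_def)
  show g: "grouplike ?H ?g"
    by (simp add: grouplike_def H pre(2,3)) (simp add: \<Delta>_def \<epsilon>_def)
  have gen: "generates ?H (range (presented_gen ?R))"
    by (simp add: H generates_presented)
  then show "generates ?H {?g, ?h, ?x}" unfolding range_taft_ext_gen .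
  have Sh: "antipode ?H ?g = ?g [^]\<^bsub>?A\<^esub> (n - 1)" "antipode ?H ?h = ?h [^]\<^bsub>?A\<^esub> (m - 1)"
    "antipode ?H ?x = \<ominus>\<^bsub>?A\<^esub> (?x \<otimes>\<^bsub>?A\<^esub> ?h [^]\<^bsub>?A\<^esub> (m - 1))"
    by (simp_all only: H pre(4)) (simp_all add: S_def)
  show "hopf_algebra ?H"
  proof (rule P.hopf_algebraI[OF gen])
    have "hopf_axioms_at ?H ?g"
      using g by (intro P.hopf_axioms_at_grouplike) (simp_all add: grouplike_def Sh, simp_all add: H o)
    moreover have "hopf_axioms_at ?H ?h"
      using s by (intro P.hopf_axioms_at_grouplike) (simp_all add: skew_primitive_pair_def Sh, simp_all add: H o)
    moreover have "hopf_axioms_at ?H ?x"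
      using s by (intro P.hopf_axioms_at_skew_primitive[of _ ?h])
        (simp_all add: skew_primitive_pair_def Sh, simp_all add: H o)
    ultimately show "hopf_axioms_at ?H g" if "g \<in> range (presented_gen ?R)" for g
      using that by (auto simp: range_taft_ext_gen)
  qed
qed

section \<open>Dual bases\<close>

text \<open>Linear independence is witnessed by coordinate functionals, constrained only for indices
  in I. Unlike uniqueness of coefficients, they can be pulled back along linear maps and multiplied
  on tensor products.\<close>

definition dual_bases ::
  "('k::field, 'a, 'z) module_scheme \<Rightarrow> 'i set \<Rightarrow> ('i \<Rightarrow> 'a) \<Rightarrow> ('i \<Rightarrow> 'a \<Rightarrow> 'k) \<Rightarrow> bool" where
  "dual_bases V I e d \<longleftrightarrow> finite I \<and> (\<forall>i\<in>I. e i \<in> carrier V) \<and> (\<forall>i\<in>I. d i \<in> linear_hom V ground_algebra) \<and>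
     (\<forall>i\<in>I. \<forall>j\<in>I. d i (e j) = (if i = j then 1 else 0)) \<and>
     (\<forall>v\<in>carrier V. \<exists>c. v = (\<Oplus>\<^bsub>V\<^esub>i\<in>I. c i \<odot>\<^bsub>V\<^esub> e i))"

lemma dual_basesD:
  assumes "dual_bases V I e d"
  shows "finite I" "i \<in> I \<Longrightarrow> e i \<in> carrier V" "i \<in> I \<Longrightarrow> d i \<in> linear_hom V ground_algebra"
    "i \<in> I \<Longrightarrow> j \<in> I \<Longrightarrow> d i (e j) = (if i = j then 1 else 0)"
    "v \<in> carrier V \<Longrightarrow> \<exists>c. v = (\<Oplus>\<^bsub>V\<^esub>i\<in>I. c i \<odot>\<^bsub>V\<^esub> e i)"
  using assms by (auto simp: dual_bases_def)

lemma finsum_ground: "finite I \<Longrightarrow> (\<Oplus>\<^bsub>(ground_algebra :: ('k::field, 'k) module)\<^esub>i\<in>I. f i) = (\<Sum>i\<in>I. f i)"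
proof (induction I rule: finite_induct)
  case (insert i I)
  interpret K: assoc_algebra "ground_algebra :: ('k, 'k) module" by (rule assoc_algebra_ground)
  show ?case using insert by (subst K.finsum_insert) auto
next
  case empty
  interpret K: assoc_algebra "ground_algebra :: ('k, 'k) module" by (rule assoc_algebra_ground)
  show ?case by simp
qed

lemma dual_bases_coord_sum:
  assumes V: "assoc_algebra V" and B: "dual_bases V I e d" and j: "j \<in> I"
  shows "d j (\<Oplus>\<^bsub>V\<^esub>i\<in>I. c i \<odot>\<^bsub>V\<^esub> e i) = c j"
proof -
  interpret V: assoc_algebra V by fact
  note b = dual_basesD[OF B]
  have "d j (\<Oplus>\<^bsub>V\<^esub>i\<in>I. c i \<odot>\<^bsub>V\<^esub> e i) = (\<Sum>i\<in>I. d j (c i \<odot>\<^bsub>V\<^esub> e i))"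
    using b by (subst linear_hom_finsum[OF V assoc_algebra_ground b(3)[OF j] b(1)])
      (auto simp: finsum_ground[OF b(1)])
  also have "\<dots> = (\<Sum>i\<in>I. if j = i then c i else 0)"
    using b j linear_homD(3)[OF b(3)[OF j]] by (intro sum.cong) auto
  also have "\<dots> = c j" using b(1) j by simp
  finally show ?thesis .
qed

lemma dual_bases_expand:
  assumes V: "assoc_algebra V" and B: "dual_bases V I e d" and v: "v \<in> carrier V"
  shows "v = (\<Oplus>\<^bsub>V\<^esub>i\<in>I. d i v \<odot>\<^bsub>V\<^esub> e i)"
proof -
  interpret V: assoc_algebra V by fact
  obtain c where c: "v = (\<Oplus>\<^bsub>V\<^esub>i\<in>I. c i \<odot>\<^bsub>V\<^esub> e i)" using dual_basesD(5)[OF B v] by blast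
  have "d i v = c i" if "i \<in> I" for i unfolding c by (rule dual_bases_coord_sum[OF V B that])
  then have "(\<Oplus>\<^bsub>V\<^esub>i\<in>I. d i v \<odot>\<^bsub>V\<^esub> e i) = (\<Oplus>\<^bsub>V\<^esub>i\<in>I. c i \<odot>\<^bsub>V\<^esub> e i)"
    using dual_basesD(2)[OF B] by (intro V.finsum_cong') auto
  then show ?thesis using c by simp
qed

lemma dual_bases_eqI:
  assumes V: "assoc_algebra V" and B: "dual_bases V I e d" and v: "v \<in> carrier V" and w: "w \<in> carrier V"
    and eq: "\<And>i. i \<in> I \<Longrightarrow> d i v = d i w"
  shows "v = w"
proof -
  interpret V: assoc_algebra V by fact
  have "(\<Oplus>\<^bsub>V\<^esub>i\<in>I. d i v \<odot>\<^bsub>V\<^esub> e i) = (\<Oplus>\<^bsub>V\<^esub>i\<in>I. d i w \<odot>\<^bsub>V\<^esub> e i)"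
    using dual_basesD(2)[OF B] eq by (intro V.finsum_cong') auto
  then show ?thesis using dual_bases_expand[OF V B v] dual_bases_expand[OF V B w] by simp
qed

text \<open>Only basis elements that occur in v are compared. This suits elements of which no more
  is known than that certain coordinates vanish.\<close>

lemma dual_bases_hom_eqI_support:
  assumes V: "assoc_algebra V" and W: "assoc_algebra W" and B: "dual_bases V I e d"
    and f: "f \<in> linear_hom V W" and g: "g \<in> linear_hom V W" and v: "v \<in> carrier V"
    and eq: "\<And>i. i \<in> I \<Longrightarrow> d i v \<noteq> 0 \<Longrightarrow> f (e i) = g (e i)"
  shows "f v = g v"
proof -
  interpret V: assoc_algebra V by fact
  interpret W: assoc_algebra W by fact
  note b = dual_basesD[OF B]
  have e: "(\<lambda>i. d i v \<odot>\<^bsub>V\<^esub> e i) \<in> I \<rightarrow> carrier V" using b by auto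
  note s = linear_hom_finsum[OF V W _ b(1) e]
  have "f (d i v \<odot>\<^bsub>V\<^esub> e i) = g (d i v \<odot>\<^bsub>V\<^esub> e i)" if i: "i \<in> I" for i
    using eq[OF i] b(2)[OF i] linear_homD(1)[OF f] linear_homD(1)[OF g]
      linear_hom_zero[OF V W f] linear_hom_zero[OF V W g]
    by (cases "d i v = 0") (simp_all add: linear_homD(3)[OF f] linear_homD(3)[OF g])
  then have "(\<Oplus>\<^bsub>W\<^esub>i\<in>I. f (d i v \<odot>\<^bsub>V\<^esub> e i)) = (\<Oplus>\<^bsub>W\<^esub>i\<in>I. g (d i v \<odot>\<^bsub>V\<^esub> e i))"
    using e linear_homD(1)[OF g] by (intro W.finsum_cong') auto
  then have "f (\<Oplus>\<^bsub>V\<^esub>i\<in>I. d i v \<odot>\<^bsub>V\<^esub> e i) = g (\<Oplus>\<^bsub>V\<^esub>i\<in>I. d i v \<odot>\<^bsub>V\<^esub> e i)"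
    by (simp only: s[OF f] s[OF g])
  then show ?thesis using dual_bases_expand[OF V B v] by simp
qed

lemma dual_bases_hom_eqI:
  assumes "assoc_algebra V" "assoc_algebra W" "dual_bases V I e d" "f \<in> linear_hom V W" "g \<in> linear_hom V W"
    and "\<And>i. i \<in> I \<Longrightarrow> f (e i) = g (e i)" "v \<in> carrier V"
  shows "f v = g v"
  using assms(6) by (rule dual_bases_hom_eqI_support[OF assms(1-5,7)])

lemma dual_bases_cong:
  assumes "dual_bases V I e d" "assoc_algebra V" "\<And>i. i \<in> I \<Longrightarrow> e' i = e i"
  shows "dual_bases V I e' d"
proof -
  interpret V: assoc_algebra V by fact
  have "(\<Oplus>\<^bsub>V\<^esub>i\<in>I. c i \<odot>\<^bsub>V\<^esub> e' i) = (\<Oplus>\<^bsub>V\<^esub>i\<in>I. c i \<odot>\<^bsub>V\<^esub> e i)" for c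
    using assms(1,3) by (intro V.finsum_cong') (auto simp: dual_bases_def)
  then show ?thesis using assms(1,3) by (simp add: dual_bases_def)
qed

lemma dual_bases_reindex:
  assumes V: "assoc_algebra V" and B: "dual_bases V I e d" and \<sigma>: "bij_betw \<sigma> J I"
  shows "dual_bases V J (\<lambda>j. e (\<sigma> j)) (\<lambda>j. d (\<sigma> j))"
proof -
  interpret V: assoc_algebra V by fact
  note b = dual_basesD[OF B]
  have J: "finite J" using bij_betw_finite[OF \<sigma>] b(1) by simp
  have in_I: "\<sigma> j \<in> I" if "j \<in> J" for j using \<sigma> that by (auto simp: bij_betw_def)
  have sums: "(\<Oplus>\<^bsub>V\<^esub>i\<in>I. c i \<odot>\<^bsub>V\<^esub> e i) = (\<Oplus>\<^bsub>V\<^esub>j\<in>J. c (\<sigma> j) \<odot>\<^bsub>V\<^esub> e (\<sigma> j))" for c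
    using V.add.finprod_reindex[of "\<lambda>i. c i \<odot>\<^bsub>V\<^esub> e i" \<sigma> J] \<sigma> b(2) by (auto simp: bij_betw_def finsum_def)
  have "\<sigma> i = \<sigma> j \<longleftrightarrow> i = j" if "i \<in> J" "j \<in> J" for i j
    using \<sigma> that by (auto simp: bij_betw_def inj_on_def)
  moreover have "\<exists>c. v = (\<Oplus>\<^bsub>V\<^esub>j\<in>J. c j \<odot>\<^bsub>V\<^esub> e (\<sigma> j))" if v: "v \<in> carrier V" for v
  proof -
    obtain c where "v = (\<Oplus>\<^bsub>V\<^esub>i\<in>I. c i \<odot>\<^bsub>V\<^esub> e i)" using b(5)[OF v] by blast
    then show ?thesis by (intro exI[of _ "\<lambda>j. c (\<sigma> j)"]) (simp add: sums)
  qed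
  ultimately show ?thesis
    using b(2-4) in_I J unfolding dual_bases_def by (intro conjI ballI) auto
qed

text \<open>The pulled back functionals agree with the coordinates on the basis, so
  \<open>f v\<close> determines every coordinate of v. The images of the basis need not span
  W.\<close>

lemma dual_bases_inj:
  assumes V: "assoc_algebra V" and W: "assoc_algebra W" and B: "dual_bases V I e d"
    and f: "f \<in> linear_hom V W" and d': "\<And>i. i \<in> I \<Longrightarrow> d' i \<in> linear_hom W ground_algebra"
    "\<And>i j. i \<in> I \<Longrightarrow> j \<in> I \<Longrightarrow> d' i (f (e j)) = (if i = j then 1 else 0)"
  shows "inj_on f (carrier V)"
proof (rule inj_onI)
  fix v w assume v: "v \<in> carrier V" and w: "w \<in> carrier V" and eq: "f v = f w"
  note b = dual_basesD[OF B]
  have "d i u = d' i (f u)" if i: "i \<in> I" and u: "u \<in> carrier V" for i u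
    by (rule dual_bases_hom_eqI[OF V assoc_algebra_ground B b(3)[OF i] linear_hom_comp[OF f d'(1)[OF i]] _ u])
      (simp add: b(4) d'(2) i)
  then show "v = w" using v w eq by (intro dual_bases_eqI[OF V B v w]) simp
qed

text \<open>For surjectivity, an element of W is expanded in the image basis and the same
  coefficients are used in V.\<close>

lemma dual_bases_bij:
  assumes V: "assoc_algebra V" and W: "assoc_algebra W" and B: "dual_bases V I e d"
    and f: "f \<in> linear_hom V W" and B': "dual_bases W I (\<lambda>i. f (e i)) d'"
  shows "bij_betw f (carrier V) (carrier W)"
  unfolding bij_betw_def
proof
  interpret V: assoc_algebra V by fact
  interpret W: assoc_algebra W by fact
  note b = dual_basesD[OF B] and b' = dual_basesD[OF B']
  show "inj_on f (carrier V)" by (rule dual_bases_inj[OF V W B f b'(3,4)])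
  have "w \<in> f ` carrier V" if w: "w \<in> carrier W" for w
  proof (rule image_eqI)
    let ?v = "\<Oplus>\<^bsub>V\<^esub>i\<in>I. d' i w \<odot>\<^bsub>V\<^esub> e i"
    have e: "(\<lambda>i. d' i w \<odot>\<^bsub>V\<^esub> e i) \<in> I \<rightarrow> carrier V" using b by auto
    then show "?v \<in> carrier V" by (rule V.finsum_closed)
    have "f ?v = (\<Oplus>\<^bsub>W\<^esub>i\<in>I. d' i w \<odot>\<^bsub>W\<^esub> f (e i))"
      using b(2) b'(2) unfolding linear_hom_finsum[OF V W f b(1) e]
      by (intro W.finsum_cong') (auto simp: linear_homD(3)[OF f])
    then show "w = f ?v" using dual_bases_expand[OF W B' w] by simp
  qed
  then show "f ` carrier V = carrier W" using linear_homD(1)[OF f] by auto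
qed

text \<open>Transport of a basis along a bijection, with coordinates read after the inverse. Applied
  to the product map of a factorization it produces the monomial basis of E.\<close>

lemma dual_bases_image:
  assumes V: "assoc_algebra V" and W: "assoc_algebra W" and B: "dual_bases V I e d"
    and f: "f \<in> linear_hom V W" and bij: "bij_betw f (carrier V) (carrier W)"
  shows "dual_bases W I (\<lambda>i. f (e i)) (\<lambda>i w. d i (inv_into (carrier V) f w))"
proof -
  interpret V: assoc_algebra V by fact
  interpret W: assoc_algebra W by fact
  note b = dual_basesD[OF B]
  let ?g = "inv_into (carrier V) f"
  have g: "?g \<in> linear_hom W V" by (rule linear_hom_inv[OF V f bij])
  have fg: "f (?g b) = b" if "b \<in> carrier W" for b using bij that by (rule bij_betw_inv_into_right)
  have gf: "?g (f a) = a" if "a \<in> carrier V" for a using bij that by (rule bij_betw_inv_into_left)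
  have "\<exists>c. w = (\<Oplus>\<^bsub>W\<^esub>i\<in>I. c i \<odot>\<^bsub>W\<^esub> f (e i))" if w: "w \<in> carrier W" for w
  proof -
    have e: "(\<lambda>i. d i (?g w) \<odot>\<^bsub>V\<^esub> e i) \<in> I \<rightarrow> carrier V" using b by auto
    have "f (\<Oplus>\<^bsub>V\<^esub>i\<in>I. d i (?g w) \<odot>\<^bsub>V\<^esub> e i) = (\<Oplus>\<^bsub>W\<^esub>i\<in>I. d i (?g w) \<odot>\<^bsub>W\<^esub> f (e i))"
      using b(2) unfolding linear_hom_finsum[OF V W f b(1) e]
      by (intro W.finsum_cong') (auto simp: linear_homD[OF f])
    then show ?thesis
      using dual_bases_expand[OF V B linear_homD(1)[OF g w]] fg[OF w] by (intro exI[of _ "\<lambda>i. d i (?g w)"]) simp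
  qed
  then show ?thesis
    unfolding dual_bases_def
    using b linear_homD(1)[OF f] by (intro conjI ballI linear_hom_comp[OF g]) (simp_all add: gf)
qed

section \<open>Linear spans and bases of tensor products\<close>

definition linear_span ::
  "('k::field, 'a, 'z) module_scheme \<Rightarrow> ('i \<Rightarrow> 'a) \<Rightarrow> 'i set \<Rightarrow> 'a set" where
  "linear_span A e I = {v. \<exists>c. v = (\<Oplus>\<^bsub>A\<^esub>i\<in>I. c i \<odot>\<^bsub>A\<^esub> e i)}"

lemma linear_spanI: "v = (\<Oplus>\<^bsub>A\<^esub>i\<in>I. c i \<odot>\<^bsub>A\<^esub> e i) \<Longrightarrow> v \<in> linear_span A e I"
  unfolding linear_span_def by blast

context assoc_algebra
begin

context
  fixes e :: "'i \<Rightarrow> 'a" and I :: "'i set"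
  assumes fin: "finite I" and e: "e \<in> I \<rightarrow> carrier A"
begin

lemma e_in: "i \<in> I \<Longrightarrow> e i \<in> carrier A"
  using e by blast

lemma linear_span_add:
  assumes "v \<in> linear_span A e I" "w \<in> linear_span A e I"
  shows "v \<oplus> w \<in> linear_span A e I"
proof -
  obtain c c' where c: "v = (\<Oplus>i\<in>I. c i \<odot> e i)" "w = (\<Oplus>i\<in>I. c' i \<odot> e i)"
    using assms by (auto simp: linear_span_def)
  have "v \<oplus> w = (\<Oplus>i\<in>I. c i \<odot> e i \<oplus> c' i \<odot> e i)"
    unfolding c using e_in by (intro finsum_addf [symmetric]) auto
  also have "\<dots> = (\<Oplus>i\<in>I. (c i + c' i) \<odot> e i)"
    using e_in by (intro finsum_cong') (auto simp: scale_add_left)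
  finally show ?thesis by (rule linear_spanI)
qed

lemma linear_span_scale:
  assumes "v \<in> linear_span A e I"
  shows "d \<odot> v \<in> linear_span A e I"
proof -
  obtain c where c: "v = (\<Oplus>i\<in>I. c i \<odot> e i)" using assms by (auto simp: linear_span_def)
  have "d \<odot> v = (\<Oplus>i\<in>I. d \<odot> (c i \<odot> e i))" unfolding c using fin e_in by (intro scale_finsum) auto
  also have "\<dots> = (\<Oplus>i\<in>I. (d * c i) \<odot> e i)" using e_in by (intro finsum_cong') auto
  finally show ?thesis by (rule linear_spanI)
qed

lemma linear_span_base:
  assumes "j \<in> I"
  shows "e j \<in> linear_span A e I"
proof -
  have "(\<Oplus>i\<in>I. (if j = i then 1 else 0) \<odot> e i) = (\<Oplus>i\<in>I. if j = i then e i else \<zero>)"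
    using e_in by (intro finsum_cong') auto
  also have "\<dots> = e j" using e fin assms by (intro finsum_singleton) auto
  finally have "e j = (\<Oplus>i\<in>I. (if j = i then 1 else 0) \<odot> e i)" by (rule sym)
  then show ?thesis by (rule linear_spanI)
qed

lemma linear_span_zero: "\<zero> \<in> linear_span A e I"
proof -
  have "(\<Oplus>i\<in>I. 0 \<odot> e i) = (\<Oplus>i\<in>I. \<zero>)" using e_in by (intro finsum_cong') auto
  then have "\<zero> = (\<Oplus>i\<in>I. 0 \<odot> e i)" by simp
  then show ?thesis by (rule linear_spanI)
qed

lemma linear_span_finsum:
  assumes "finite J" "\<And>j. j \<in> J \<Longrightarrow> f j \<in> linear_span A e I" "f \<in> J \<rightarrow> carrier A"
  shows "(\<Oplus>j\<in>J. f j) \<in> linear_span A e I"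
  using assms by (induction J rule: finite_induct) (auto intro: linear_span_zero linear_span_add)

text \<open>By linearity, stability under left multiplication by generators need only be checked on
  the spanning family; the one-sided form of \<open>generates\<close> then applies.\<close>

lemma linear_spanI_generates:
  assumes gen: "generates A G" and one: "\<one> \<in> linear_span A e I"
    and mult: "\<And>g i. g \<in> G \<Longrightarrow> i \<in> I \<Longrightarrow> g \<otimes> e i \<in> linear_span A e I"
    and v: "v \<in> carrier A"
  shows "v \<in> linear_span A e I"
  using gen v
proof (induction rule: generates_induct)
  case (mult g a)
  then obtain c where c: "a = (\<Oplus>i\<in>I. c i \<odot> e i)" by (auto simp: linear_span_def)
  have "g \<otimes> a = (\<Oplus>i\<in>I. g \<otimes> (c i \<odot> e i))"
    unfolding c using fin e_in mult(2) by (intro finsum_rdistr) auto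
  also have "\<dots> \<in> linear_span A e I"
    using e_in mult(2) assms(3)[OF mult(1)]
    by (intro linear_span_finsum fin) (auto simp: smult_mult_right intro: linear_span_scale)
  finally show ?case .
qed (use one in \<open>auto intro: linear_span_add linear_span_scale assoc_algebra_axioms\<close>)

end

end

text \<open>Products of coordinates are bilinear and hence define functionals on the tensor product.
  Spanning follows by expanding one factor at a time.\<close>

lemma dual_bases_tensor:
  assumes A: "assoc_algebra A" and B: "assoc_algebra B" and BA: "dual_bases A I e d" and BB: "dual_bases B J f d'"
  shows "dual_bases (tensor A B) (I \<times> J) (\<lambda>(i, j). pure_tensor A B (e i) (f j))
    (\<lambda>(i, j). tensor_lift ground_algebra (\<lambda>a b. d i a * d' j b))"
proof -
  interpret AB: algebra_pair A B using A B by (rule algebra_pairI)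
  interpret K: assoc_algebra ground_algebra by (rule assoc_algebra_ground)
  note a = dual_basesD[OF BA] and b = dual_basesD[OF BB]
  have bil: "(\<lambda>x y. d i x * d' j y) \<in> bilinear_maps A B ground_algebra" if "i \<in> I" "j \<in> J" for i j
    using bilinear_maps_precomp[OF bilinear_mult[OF assoc_algebra_ground] a(3)[OF that(1)] b(3)[OF that(2)]]
    by simp
  note l = AB.tensor_lift[OF assoc_algebra_ground bil]
  let ?e = "\<lambda>(i, j). pure_tensor A B (e i) (f j)"
  have e_in: "?e p \<in> carrier (tensor A B)" if "p \<in> I \<times> J" for p using that a b by auto
  have fin: "finite (I \<times> J)" using a b by simp
  have ePi: "?e \<in> I \<times> J \<rightarrow> carrier (tensor A B)" using e_in by blast
  let ?L = "linear_span (tensor A B) ?e (I \<times> J)"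
  note T = AB.T.assoc_algebra_axioms
  note span_intros = AB.T.linear_span_finsum[OF fin ePi] AB.T.linear_span_scale[OF fin ePi]
    AB.T.linear_span_add[OF fin ePi] AB.T.linear_span_zero[OF fin ePi]
  have pure1: "pure_tensor A B (e i) y \<in> ?L" if i: "i \<in> I" and y: "y \<in> carrier B" for i y
  proof -
    have fy: "(\<lambda>j. d' j y \<odot>\<^bsub>B\<^esub> f j) \<in> J \<rightarrow> carrier B" using b by auto
    have "pure_tensor A B (e i) y = (\<Oplus>\<^bsub>tensor A B\<^esub>j\<in>J. pure_tensor A B (e i) (d' j y \<odot>\<^bsub>B\<^esub> f j))"
      by (subst dual_bases_expand[OF B BB y],
          rule linear_hom_finsum[OF B T bilinear_mapsD(1)[OF AB.pure_bilinear a(2)[OF i]] b(1) fy])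
    also have "\<dots> \<in> ?L"
      using i a b AB.T.linear_span_base[OF fin ePi, of "(i, j)" for j]
      by (intro span_intros(1)) (auto simp: AB.pure_scale_right intro: span_intros(2))
    finally show ?thesis .
  qed
  have pure: "pure_tensor A B x y \<in> ?L" if x: "x \<in> carrier A" and y: "y \<in> carrier B" for x y
  proof -
    have ex: "(\<lambda>i. d i x \<odot>\<^bsub>A\<^esub> e i) \<in> I \<rightarrow> carrier A" using a by auto
    have "pure_tensor A B x y = (\<Oplus>\<^bsub>tensor A B\<^esub>i\<in>I. pure_tensor A B (d i x \<odot>\<^bsub>A\<^esub> e i) y)"
      by (subst dual_bases_expand[OF A BA x],
          rule linear_hom_finsum[OF A T bilinear_mapsD(2)[OF AB.pure_bilinear y] a(1) ex])
    also have "\<dots> \<in> ?L"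
      using a y pure1
      by (intro span_intros(1)) (auto simp: AB.pure_scale_left intro: span_intros(2))
    finally show ?thesis .
  qed
  have "t \<in> ?L" if "t \<in> carrier (tensor A B)" for t
    using that by (induction rule: AB.tensor_induct) (auto intro: span_intros pure)
  then have span: "\<exists>c. t = (\<Oplus>\<^bsub>tensor A B\<^esub>p\<in>I \<times> J. c p \<odot>\<^bsub>tensor A B\<^esub> ?e p)" if "t \<in> carrier (tensor A B)" for t
    using that by (simp add: linear_span_def)
  show ?thesis
    unfolding dual_bases_def
  proof (intro conjI ballI fin e_in span)
    fix p r assume "p \<in> I \<times> J" "r \<in> I \<times> J"
    then show "(case p of (i, j) \<Rightarrow> tensor_lift ground_algebra (\<lambda>a b. d i a * d' j b)) (?e r) = (if p = r then 1 else 0)"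
      using a b by (auto simp: l(2) split: if_splits)
  qed (use l(1) in auto)
qed


section \<open>Monomial bases\<close>

text \<open>The exponents belong to h, x, g in this order, while the arguments are listed as g, h,
  x. Keeping g on the right lets coproducts be computed without any relation between g and the other
  two.\<close>

definition monomial :: "('k::field, 'a, 'z) module_scheme \<Rightarrow> 'a \<Rightarrow> 'a \<Rightarrow> 'a \<Rightarrow> nat \<times> nat \<times> nat \<Rightarrow> 'a" where
  "monomial A g h x = (\<lambda>(a, b, c). h [^]\<^bsub>A\<^esub> a \<otimes>\<^bsub>A\<^esub> x [^]\<^bsub>A\<^esub> b \<otimes>\<^bsub>A\<^esub> g [^]\<^bsub>A\<^esub> c)"

lemma (in assoc_algebra) pow_mod:
  assumes "h \<in> carrier A" "h [^] (m::nat) = \<one>"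
  shows "h [^] (k mod m) = h [^] k"
proof -
  have "h [^] k = h [^] (m * (k div m) + k mod m)" by simp
  also have "\<dots> = (h [^] m) [^] (k div m) \<otimes> h [^] (k mod m)"
    using assms(1) by (simp only: nat_pow_mult [symmetric] nat_pow_pow)
  finally show ?thesis using assms by simp
qed

context assoc_algebra
begin

text \<open>Left multiplication by a generator sends a monomial to a scalar multiple of a monomial;
  together with \<open>x [^] m = \<zero>\<close> this makes the span of the monomials
  stable.\<close>

lemma monomial_mult:
  assumes t: "taft_triple A n m \<omega> q g h x"
  shows "h \<otimes> monomial A g h x (a, b, c) = monomial A g h x (Suc a mod m, b, c)"
    and "x \<otimes> monomial A g h x (a, b, c) = q ^ a \<odot> monomial A g h x (a, Suc b, c)"
    and "g \<otimes> monomial A g h x (a, b, c) = \<omega> ^ b \<odot> monomial A g h x (a, b, Suc c mod n)"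
    and "monomial A g h x (a, b, c) \<in> carrier A"
    and "monomial A g h x (a, m, c) = \<zero>"
proof -
  note t' = taft_tripleD[OF t]
  note p' = taft_pairD[OF t'(1)]
  note [simp] = p'(1,2) t'(2)
  have h: "h \<otimes> h [^] a = h [^] (Suc a mod m)" by (simp only: pow_mod[OF p'(1,3)] nat_pow_Suc2 p'(1))
  have g: "g \<otimes> g [^] c = g [^] (Suc c mod n)" by (simp only: pow_mod[OF t'(2,3)] nat_pow_Suc2 t'(2))
  have xh: "x \<otimes> h [^] a = q ^ a \<odot> (h [^] a \<otimes> x)"
    using scalar_commute_pow[OF p'(2,1,5), of 1 a] by simp
  have gh: "g \<otimes> h [^] a = h [^] a \<otimes> g"
    using scalar_commute_pow[of g h 1 1 a] by (simp add: t'(4))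
  have gx: "g \<otimes> x [^] b = \<omega> ^ b \<odot> (x [^] b \<otimes> g)"
    using scalar_commute_pow[OF t'(2) p'(2) t'(5), of 1 b] by simp
  show "h \<otimes> monomial A g h x (a, b, c) = monomial A g h x (Suc a mod m, b, c)"
    by (simp add: monomial_def m_assoc flip: h)
  show "x \<otimes> monomial A g h x (a, b, c) = q ^ a \<odot> monomial A g h x (a, Suc b, c)"
  proof -
    have "x \<otimes> monomial A g h x (a, b, c) = (x \<otimes> h [^] a) \<otimes> (x [^] b \<otimes> g [^] c)"
      by (simp add: monomial_def m_assoc)
    also have "\<dots> = q ^ a \<odot> (h [^] a \<otimes> (x \<otimes> x [^] b) \<otimes> g [^] c)"
      unfolding xh by (simp add: smult_mult_left m_assoc)
    also have "x \<otimes> x [^] b = x [^] Suc b" by (simp only: nat_pow_Suc2 p'(2))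
    finally show ?thesis by (simp only: monomial_def prod.case)
  qed
  show "g \<otimes> monomial A g h x (a, b, c) = \<omega> ^ b \<odot> monomial A g h x (a, b, Suc c mod n)"
  proof -
    have "g \<otimes> monomial A g h x (a, b, c) = (g \<otimes> h [^] a) \<otimes> (x [^] b \<otimes> g [^] c)"
      by (simp add: monomial_def m_assoc)
    also have "\<dots> = h [^] a \<otimes> (g \<otimes> x [^] b) \<otimes> g [^] c"
      unfolding gh by (simp add: m_assoc)
    also have "\<dots> = \<omega> ^ b \<odot> (h [^] a \<otimes> x [^] b \<otimes> (g \<otimes> g [^] c))"
      unfolding gx by (simp add: smult_mult_left smult_mult_right m_assoc)
    finally show ?thesis by (simp add: monomial_def g)
  qed
  show "monomial A g h x (a, b, c) \<in> carrier A" by (simp add: monomial_def)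
  show "monomial A g h x (a, m, c) = \<zero>" by (simp add: monomial_def p'(4))
qed

lemma monomial_span:
  assumes t: "taft_triple A n m \<omega> q g h x" and gen: "generates A {g, h, x}" and "m > 0" "n > 0"
    and v: "v \<in> carrier A"
  shows "v \<in> linear_span A (monomial A g h x) ({..<m} \<times> {..<m} \<times> {..<n})"
proof -
  let ?I = "{..<m} \<times> {..<m} \<times> {..<n}"
  let ?L = "linear_span A (monomial A g h x) ?I"
  note M = monomial_mult[OF t]
  have fin: "finite ?I" by simp
  have e: "monomial A g h x \<in> ?I \<rightarrow> carrier A" using M(4) by auto
  note base = linear_span_base[OF fin e] and scale = linear_span_scale[OF fin e]
  show ?thesis
  proof (rule linear_spanI_generates[OF fin e gen _ _ v])
    have "monomial A g h x (0, 0, 0) = \<one>" by (simp add: monomial_def)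
    with base[of "(0, 0, 0)"] show "\<one> \<in> ?L" using assms(3,4) by simp
    fix s i assume s: "s \<in> {g, h, x}" and i: "i \<in> ?I"
    obtain a b c where abc: "i = (a, b, c)" "a < m" "b < m" "c < n" using i by (cases i) auto
    \<comment> \<open>The exponents of g and h wrap around, that of x does not: at its last value
      the product is zero.\<close>
    consider "s = g" | "s = h" | "s = x" "Suc b < m" | "s = x" "Suc b = m" using s abc(3) by fastforce
    then show "s \<otimes> monomial A g h x i \<in> ?L"
    proof cases
      case 1
      then show ?thesis using abc assms(4) base[of "(a, b, Suc c mod n)"] by (simp add: M scale)
    next
      case 2
      then show ?thesis using abc assms(3) base[of "(Suc a mod m, b, c)"] by (simp add: M)
    next
      case 3
      then show ?thesis using abc base[of "(a, Suc b, c)"] by (simp add: M scale)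
    next
      case 4
      then show ?thesis using abc linear_span_zero[OF fin e] by (simp add: M)
    qed
  qed
qed

end

section \<open>A faithful representation\<close>

text \<open>Linear endomorphisms of the space of all functions on the index type. Imposing no
  condition on supports avoids a finite subtype of admissible indices.\<close>

definition operator_algebra :: "('k::field, ('i \<Rightarrow> 'k) \<Rightarrow> ('i \<Rightarrow> 'k)) module" where
  "operator_algebra =
     \<lparr>carrier = {T. (\<forall>F G. T (\<lambda>i. F i + G i) = (\<lambda>i. T F i + T G i)) \<and> (\<forall>c F. T (\<lambda>i. c * F i) = (\<lambda>i. c * T F i))},
      monoid.mult = (\<lambda>T S F. T (S F)),
      one = (\<lambda>F. F),
      ring.zero = (\<lambda>F i. 0),
      add = (\<lambda>T S F i. T F i + S F i),
      module.smult = (\<lambda>c T F i. c * T F i)\<rparr>"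

lemma operator_algebra_simps [simp]:
  "T \<in> carrier operator_algebra \<longleftrightarrow>
    (\<forall>F G. T (\<lambda>i. F i + G i) = (\<lambda>i. T F i + T G i)) \<and> (\<forall>c F. T (\<lambda>i. c * F i) = (\<lambda>i. c * T F i))"
  "T \<otimes>\<^bsub>operator_algebra\<^esub> S = (\<lambda>F. T (S F))"
  "\<one>\<^bsub>operator_algebra\<^esub> = (\<lambda>F. F)"
  "\<zero>\<^bsub>operator_algebra\<^esub> = (\<lambda>F i. 0)"
  "T \<oplus>\<^bsub>operator_algebra\<^esub> S = (\<lambda>F i. T F i + S F i)"
  "c \<odot>\<^bsub>operator_algebra\<^esub> T = (\<lambda>F i. c * T F i)"
  by (simp_all add: operator_algebra_def)

lemma assoc_algebra_operator: "assoc_algebra (operator_algebra :: ('k::field, ('i \<Rightarrow> 'k) \<Rightarrow> ('i \<Rightarrow> 'k)) module)"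
  by (rule assoc_algebraI) (auto simp: algebra_simps)

text \<open>
  The operators act on functions of the exponents \<open>(i, j, k)\<close> of a monomial \<open>h\<^sup>i x\<^sup>j g\<^sup>k\<close>.  Outside
  the range \<open>i, j < m\<close>, \<open>k < n\<close> their values are chosen so that the defining relations hold for all
  functions on \<^typ>\<open>nat \<times> nat \<times> nat\<close>.
\<close>

definition op_h :: "nat \<Rightarrow> (nat \<times> nat \<times> nat \<Rightarrow> 'k::field) \<Rightarrow> nat \<times> nat \<times> nat \<Rightarrow> 'k" where
  "op_h m F = (\<lambda>(i, j, k). if i < m then F (Suc i mod m, j, k) else F (i, j, k))"

text \<open>Origin of the weights within the index range: multiply words \<open>g^k x^j h^i\<close>
  on the right. The factor g passes \<open>x^j\<close> at the cost of \<open>\<omega>^(-j)\<close>,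
  the factor x passes \<open>h^i\<close> at the cost of \<open>q^(-i)\<close>, and h costs nothing.
  The operators are the translations of functions under these multiplications.\<close>

definition op_g :: "nat \<Rightarrow> 'k \<Rightarrow> (nat \<times> nat \<times> nat \<Rightarrow> 'k::field) \<Rightarrow> nat \<times> nat \<times> nat \<Rightarrow> 'k" where
  "op_g n \<omega> F = (\<lambda>(i, j, k). if k < n then inverse \<omega> ^ j * F (i, j, Suc k mod n) else F (i, j, k))"

definition op_x :: "nat \<Rightarrow> nat \<Rightarrow> 'k \<Rightarrow> (nat \<times> nat \<times> nat \<Rightarrow> 'k::field) \<Rightarrow> nat \<times> nat \<times> nat \<Rightarrow> 'k" where
  "op_x n m q F = (\<lambda>(i, j, k). if i < m \<and> Suc j < m \<and> k < n then inverse q ^ i * F (i, Suc j, k) else 0)"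

abbreviation "op_pow T (k::nat) \<equiv> T [^]\<^bsub>operator_algebra\<^esub> k"

lemma op_h_pow:
  assumes "m > 0"
  shows "op_pow (op_h m) a F (i, j, k) = (if i < m then F ((i + a) mod m, j, k) else F (i, j, k))"
proof (induction a arbitrary: F)
  case (Suc a)
  then show ?case using assms by (simp add: op_h_def mod_Suc_eq)
qed simp

lemma op_g_pow:
  assumes "n > 0"
  shows "op_pow (op_g n \<omega>) c F (i, j, k)
    = (if k < n then inverse \<omega> ^ (j * c) * F (i, j, (k + c) mod n) else F (i, j, k))"
proof (induction c arbitrary: F)
  case (Suc c)
  then show ?case using assms by (simp add: op_g_def mod_Suc_eq power_add mult_ac)
qed simp

text \<open>Stated for positive exponents: the zeroth power is the identity also outside the range
  of indices, where positive powers give 0.\<close>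

lemma op_x_pow:
  "op_pow (op_x n m q) (Suc b) F (i, j, k)
    = (if i < m \<and> j + Suc b < m \<and> k < n then inverse q ^ (i * Suc b) * F (i, j + Suc b, k) else 0)"
proof (induction b arbitrary: F)
  case (Suc b)
  have step: "op_pow (op_x n m q) (Suc k) F = op_pow (op_x n m q) k (op_x n m q F)" for k by simp
  show ?case unfolding step[of "Suc b"] Suc.IH by (simp add: op_x_def power_add mult_ac)
qed (simp add: op_x_def)

lemma taft_triple_operator:
  assumes q: "q ^ m = (1 :: 'k::field)" "m > 0" and \<omega>: "\<omega> ^ n = 1" "n > 0"
  shows "taft_triple operator_algebra n m \<omega> q (op_g n \<omega>) (op_h m) (op_x n m q)"
proof -
  have q0: "q \<noteq> 0" and \<omega>0: "\<omega> \<noteq> 0" using assms by (auto simp: power_0_left)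
  have in_carrier: "op_g n \<omega> \<in> carrier operator_algebra" "op_h m \<in> carrier operator_algebra"
    "op_x n m q \<in> carrier operator_algebra"
    by (auto simp: op_g_def op_h_def op_x_def fun_eq_iff algebra_simps)
  have h: "op_pow (op_h m) m = (\<lambda>F :: nat \<times> nat \<times> nat \<Rightarrow> 'k. F)"
    using q(2) by (auto simp: fun_eq_iff op_h_pow)
  have g: "op_pow (op_g n \<omega>) n = (\<lambda>F :: nat \<times> nat \<times> nat \<Rightarrow> 'k. F)"
    using \<omega> by (auto simp: fun_eq_iff op_g_pow power_inverse power_mult mult.commute[of _ n])
  obtain m' where m': "m = Suc m'" using q(2) by (cases m) auto
  have x: "op_pow (op_x n m q) m = (\<lambda>F i. 0)"
    by (auto simp: fun_eq_iff m' op_x_pow simp del: nat_pow_Suc)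
  \<comment> \<open>Shifting i adds one factor \<open>inverse q\<close>. At i = m - 1 the shifted
    index is 0, and the identity amounts to \<open>q ^ m = 1\<close>.\<close>
  have q_wrap: "inverse q ^ i = q * inverse q ^ (Suc i mod m)" if "i < m" for i
  proof (cases "Suc i = m")
    case True
    have "q * q ^ i = 1" using q(1) True by auto
    then have "inverse q ^ i = q" using q0 by (simp add: field_simps)
    then show ?thesis using True by simp
  qed (use that q0 in simp)
  have xh: "op_x n m q (op_h m F) = (\<lambda>i. q * op_h m (op_x n m q F) i)" for F
  proof -
    have "q * inverse q ^ (Suc i mod m) = inverse q ^ i" if "i < m" for i
      using q_wrap[OF that] by (rule sym)
    then show ?thesis using q(2) by (auto simp: fun_eq_iff op_x_def op_h_def)
  qed
  have hg: "op_h m (op_g n \<omega> F) = op_g n \<omega> (op_h m F)" for F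
    by (auto simp: fun_eq_iff op_g_def op_h_def)
  have gx: "op_g n \<omega> (op_x n m q F) = (\<lambda>i. \<omega> * op_x n m q (op_g n \<omega> F) i)" for F
    using \<omega>(2) \<omega>0 by (auto simp: fun_eq_iff op_g_def op_x_def)
  show ?thesis
    using in_carrier
    unfolding taft_triple_def taft_pair_def
    by (intro conjI) (simp_all only: h g x xh hg gx operator_algebra_simps(2-6))
qed

text \<open>Evaluation at the origin recovers F at (a, b, c) up to a factor that is nonzero for
  nonzero q and \<omega>; linear independence of the monomials rests on this. The factor arises from
  reordering \<open>h^a x^b g^c\<close> as \<open>g^c x^b h^a\<close>.\<close>

lemma monomial_operator:
  assumes "a < m" "b < m" "c < n"
  shows "monomial operator_algebra (op_g n \<omega>) (op_h m) (op_x n m q) (a, b, c) F (0, 0, 0)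
    = inverse q ^ (a * b) * inverse \<omega> ^ (b * c) * F (a, b, c)"
proof -
  have pos: "m > 0" "n > 0" using assms by auto
  have "op_pow (op_x n m q) b (op_pow (op_g n \<omega>) c F) (a, 0, 0)
      = inverse q ^ (a * b) * (inverse \<omega> ^ (b * c) * F (a, b, c))"
  proof (cases b)
    case 0
    then show ?thesis using assms pos by (simp add: op_g_pow)
  next
    case (Suc b')
    then show ?thesis
      using assms pos by (simp only: Suc op_x_pow op_g_pow) (simp add: mult_ac)
  qed
  then show ?thesis using assms pos by (simp add: monomial_def op_h_pow)
qed

lemma monomial_hom:
  assumes A: "assoc_algebra A" and B: "assoc_algebra B" and f: "f \<in> algebra_hom A B"
    and "g \<in> carrier A" "h \<in> carrier A" "x \<in> carrier A"
  shows "f (monomial A g h x i) = monomial B (f g) (f h) (f x) i"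
proof -
  interpret A: assoc_algebra A by fact
  show ?thesis using assms
    by (cases i) (simp add: monomial_def algebra_homD[OF f] algebra_hom_pow[OF A B f])
qed

text \<open>A matrix coefficient of the representation: the image of t is applied to the indicator
  function of i and evaluated at the origin. The scalar in front cancels the factor from
  \<open>monomial_operator\<close>.\<close>

definition ext_coord ::
  "nat \<Rightarrow> nat \<Rightarrow> 'k::field \<Rightarrow> 'k \<Rightarrow> nat \<times> nat \<times> nat \<Rightarrow> (taft_ext_gen list \<Rightarrow>\<^sub>0 'k) set \<Rightarrow> 'k" where
  "ext_coord n m \<omega> q i t = (case i of (a, b, c) \<Rightarrow> q ^ (a * b) * \<omega> ^ (b * c) *
     presented_lift operator_algebra (\<lambda>s. case s of Ext_g \<Rightarrow> op_g n \<omega> | Ext_h \<Rightarrow> op_h m | Ext_x \<Rightarrow> op_x n m q) t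
       (\<lambda>j. if j = i then 1 else 0) (0, 0, 0))"

lemma ext_coord:
  assumes q: "q ^ m = (1 :: 'k::field)" "m > 0" and \<omega>: "\<omega> ^ n = 1" "n > 0"
  shows "ext_coord n m \<omega> q i \<in> linear_hom (presented_algebra (taft_ext_relations n m \<omega> q)) ground_algebra"
    and "\<lbrakk>i \<in> {..<m} \<times> {..<m} \<times> {..<n}; j \<in> {..<m} \<times> {..<m} \<times> {..<n}\<rbrakk> \<Longrightarrow>
      ext_coord n m \<omega> q i (monomial (presented_algebra (taft_ext_relations n m \<omega> q))
        (ext_g n m \<omega> q) (ext_h n m \<omega> q) (ext_x n m \<omega> q) j) = (if i = j then 1 else 0)"
proof -
  let ?R = "taft_ext_relations n m \<omega> q" and ?A = "presented_algebra (taft_ext_relations n m \<omega> q)"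
  let ?O = "operator_algebra :: ('k, (nat \<times> nat \<times> nat \<Rightarrow> 'k) \<Rightarrow> nat \<times> nat \<times> nat \<Rightarrow> 'k) module"
  interpret O: assoc_algebra ?O by (rule assoc_algebra_operator)
  define \<phi> where "\<phi> = (\<lambda>s. case s of Ext_g \<Rightarrow> op_g n \<omega> | Ext_h \<Rightarrow> op_h m | Ext_x \<Rightarrow> op_x n m q)"
  have t: "taft_triple ?O n m \<omega> q (\<phi> Ext_g) (\<phi> Ext_h) (\<phi> Ext_x)"
    using taft_triple_operator[OF q \<omega>] by (simp add: \<phi>_def)
  have \<phi>_in: "\<phi> s \<in> carrier ?O" for s
    using taft_tripleD(2)[OF t] taft_pairD(1,2)[OF taft_tripleD(1)[OF t]] by (cases s) auto
  have rel: "eval_free ?O \<phi> r = \<zero>\<^bsub>?O\<^esub>" if "r \<in> ?R" for r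
    using O.taft_ext_relations_iff[of \<phi>, OF \<phi>_in] t that by blast
  note \<rho> = presented_lift[of ?O \<phi> ?R, OF assoc_algebra_operator \<phi>_in rel]
  let ?\<rho> = "presented_lift ?O \<phi>"
  note \<rho>' = algebra_homD[OF \<rho>(1)]
  have coord: "ext_coord n m \<omega> q (a, b, c) t = q ^ (a * b) * \<omega> ^ (b * c) *
     ?\<rho> t (\<lambda>j. if j = (a, b, c) then 1 else 0) (0, 0, 0)" for a b c t
    by (simp add: ext_coord_def \<phi>_def)
  obtain a b c where i: "i = (a, b, c)" by (cases i)
  show "ext_coord n m \<omega> q i \<in> linear_hom ?A ground_algebra"
    by (rule linear_homI) (simp_all add: i coord \<rho>'(5,6) algebra_simps)
  assume I: "i \<in> {..<m} \<times> {..<m} \<times> {..<n}" and J: "j \<in> {..<m} \<times> {..<m} \<times> {..<n}"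
  obtain a' b' c' where j: "j = (a', b', c')" "a' < m" "b' < m" "c' < n" using J by (cases j) auto
  have q0: "q \<noteq> 0" and \<omega>0: "\<omega> \<noteq> 0" using assms by (auto simp: power_0_left)
  have "?\<rho> (monomial ?A (ext_g n m \<omega> q) (ext_h n m \<omega> q) (ext_x n m \<omega> q) j)
      = monomial ?O (op_g n \<omega>) (op_h m) (op_x n m q) j"
    by (subst monomial_hom[OF assoc_algebra_presented assoc_algebra_operator \<rho>(1)]) (simp_all add: \<rho>(2), simp add: \<phi>_def)
  then show "ext_coord n m \<omega> q i (monomial ?A (ext_g n m \<omega> q) (ext_h n m \<omega> q) (ext_x n m \<omega> q) j)
      = (if i = j then 1 else 0)"
    using q0 \<omega>0 unfolding i coord j(1) by (simp add: monomial_operator[OF j(2-4)] field_simps)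
qed

lemma dual_bases_taft_ext:
  assumes q: "primitive_root_of_unity m (q :: 'k::field)" "m > 0" and \<omega>: "\<omega> ^ n = 1" "n > 0"
  shows "dual_bases (taft_ext_hopf n m \<omega> q) ({..<m} \<times> {..<m} \<times> {..<n})
    (monomial (taft_ext_hopf n m \<omega> q) (ext_g n m \<omega> q) (ext_h n m \<omega> q) (ext_x n m \<omega> q)) (ext_coord n m \<omega> q)"
proof -
  let ?L = "taft_ext_hopf n m \<omega> q"
  interpret L: assoc_algebra ?L using hopf_algebra_taft_ext[OF q \<omega>] by (rule hopf_algebra_assoc)
  note t = taft_triple_taft_ext[OF q \<omega>]
  have "linear_hom ?L ground_algebra = linear_hom (presented_algebra (taft_ext_relations n m \<omega> q)) (ground_algebra :: ('k, 'k) module)"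
    by (simp add: taft_ext_hopf_def Let_def linear_hom_def)
  moreover have "monomial ?L = monomial (presented_algebra (taft_ext_relations n m \<omega> q))"
    by (simp add: taft_ext_hopf_def Let_def monomial_def fun_eq_iff)
  ultimately have "dual_bases ?L ({..<m} \<times> {..<m} \<times> {..<n})
      (monomial ?L (ext_g n m \<omega> q) (ext_h n m \<omega> q) (ext_x n m \<omega> q)) (ext_coord n m \<omega> q)"
    if "\<And>i. monomial ?L (ext_g n m \<omega> q) (ext_h n m \<omega> q) (ext_x n m \<omega> q) i \<in> carrier ?L"
    using that ext_coord[OF primitive_rootD(1)[OF q] q(2) \<omega>]
      L.monomial_span[OF t generates_taft_ext[OF q \<omega>] q(2) \<omega>(2), unfolded linear_span_def mem_Collect_eq]
    unfolding dual_bases_def by (intro conjI ballI) simp_all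
  moreover have "monomial ?L (ext_g n m \<omega> q) (ext_h n m \<omega> q) (ext_x n m \<omega> q) i \<in> carrier ?L" for i
    using L.monomial_mult(4)[OF t] by (cases i) auto
  ultimately show ?thesis .
qed

lemma generates_mono:
  assumes "generates A G" "G \<subseteq> G'" "G' \<subseteq> carrier A"
  shows "generates A G'"
  unfolding generates_def
proof (intro conjI allI impI assms(3))
  fix S assume S: "S \<subseteq> carrier A" "\<one>\<^bsub>A\<^esub> \<in> S" "\<forall>a\<in>S. \<forall>b\<in>S. a \<oplus>\<^bsub>A\<^esub> b \<in> S"
    "\<forall>c. \<forall>a\<in>S. c \<odot>\<^bsub>A\<^esub> a \<in> S" "\<forall>g\<in>G'. \<forall>a\<in>S. g \<otimes>\<^bsub>A\<^esub> a \<in> S"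
  then have "\<forall>g\<in>G. \<forall>a\<in>S. g \<otimes>\<^bsub>A\<^esub> a \<in> S" using assms(2) by (simp add: subset_iff)
  with S(1-4) assms(1) show "S = carrier A" unfolding generates_def by simp
qed

text \<open>The extension with \<open>n = 1\<close> and \<open>\<omega> = 1\<close> has g = 1. The
  map from the Taft algebra into it therefore carries monomials to monomials, and the coordinates
  can be pulled back.\<close>

lemma dual_bases_taft:
  assumes q: "primitive_root_of_unity m (q :: 'k::field)" "m > 0"
  shows "\<exists>d. dual_bases (taft_hopf m q) ({..<m} \<times> {..<m} \<times> {..<1})
    (monomial (taft_hopf m q) \<one>\<^bsub>taft_hopf m q\<^esub> (taft_h m q) (taft_x m q)) d"
proof -
  let ?T = "taft_hopf m q" and ?L = "taft_ext_hopf 1 m 1 q"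
  let ?h = "taft_h m q" and ?x = "taft_x m q"
  let ?g' = "ext_g 1 m 1 q" and ?h' = "ext_h 1 m 1 q" and ?x' = "ext_x 1 m 1 q"
  have 1: "(1 :: 'k) ^ 1 = 1" "(0::nat) < 1" by auto
  note TA = hopf_algebra_assoc[OF hopf_algebra_taft[OF q]]
  note LA = hopf_algebra_assoc[OF hopf_algebra_taft_ext[OF q 1]]
  interpret T: assoc_algebra ?T by (rule TA)
  interpret L: assoc_algebra ?L by (rule LA)
  note p = taft_pair_taft[OF q]
  note t = taft_triple_taft_ext[OF q 1]
  have t': "taft_triple ?T 1 m 1 q \<one>\<^bsub>?T\<^esub> ?h ?x" using p by (simp add: taft_triple_def taft_pair_def)
  have gen: "generates ?T {\<one>\<^bsub>?T\<^esub>, ?h, ?x}"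
    by (rule generates_mono[OF generates_taft[OF q]]) (use taft_pairD[OF p] in auto)
  define \<phi> where "\<phi> = (\<lambda>s. case s of Taft_h \<Rightarrow> ?h' | Taft_x \<Rightarrow> ?x')"
  have p': "taft_pair ?L m q (\<phi> Taft_h) (\<phi> Taft_x)" using taft_tripleD(1)[OF t] by (simp add: \<phi>_def)
  have \<phi>_in: "\<phi> s \<in> carrier ?L" for s using taft_pairD(1,2)[OF p'] by (cases s) auto
  have rel: "eval_free ?L \<phi> r = \<zero>\<^bsub>?L\<^esub>" if "r \<in> taft_relations m q" for r
    using L.taft_relations_iff[of \<phi>, OF \<phi>_in] p' that by blast
  note \<iota> = presented_lift[of ?L \<phi> "taft_relations m q", OF LA \<phi>_in rel]
  have \<iota>_hom: "presented_lift ?L \<phi> \<in> algebra_hom ?T ?L" using \<iota>(1) by (simp add: taft_hopf_def Let_def)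
  have g1: "?g' = \<one>\<^bsub>?L\<^esub>" using taft_tripleD(3)[OF t] taft_tripleD(2)[OF t] by simp
  have img: "presented_lift ?L \<phi> (monomial ?T \<one>\<^bsub>?T\<^esub> ?h ?x i) = monomial ?L ?g' ?h' ?x' i" for i
    using taft_pairD(1,2)[OF p]
    by (subst monomial_hom[OF TA LA \<iota>_hom]) (simp_all add: algebra_homD(3)[OF \<iota>_hom] \<iota>(2), simp add: \<phi>_def g1)
  note b = dual_basesD[OF dual_bases_taft_ext[OF q 1]]
  have "dual_bases ?T ({..<m} \<times> {..<m} \<times> {..<1}) (monomial ?T \<one>\<^bsub>?T\<^esub> ?h ?x)
    (\<lambda>i t. ext_coord 1 m 1 q i (presented_lift ?L \<phi> t))"
    unfolding dual_bases_def
  proof (intro conjI ballI linear_hom_comp[OF algebra_homD(1)[OF \<iota>_hom]] b(3))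
    show "monomial ?T \<one>\<^bsub>?T\<^esub> ?h ?x i \<in> carrier ?T" for i
      using T.monomial_mult(4)[OF t'] by (cases i) auto
    show "\<exists>c. v = (\<Oplus>\<^bsub>?T\<^esub>i\<in>{..<m} \<times> {..<m} \<times> {..<1}. c i \<odot>\<^bsub>?T\<^esub> monomial ?T \<one>\<^bsub>?T\<^esub> ?h ?x i)"
      if "v \<in> carrier ?T" for v
      using T.monomial_span[OF t' gen q(2) 1(2) that] unfolding linear_span_def by blast
  qed (simp_all only: img b(4) finite_cartesian_product finite_lessThan)
  then show ?thesis by blast
qed

section \<open>The cyclic group algebra and the product map\<close>

lemma group_integer_mod: "group (integer_mod_group n)"
  by (rule group_integer_mod_group)

lemma single_pow_integer_mod:
  assumes "n \<ge> 2" "c < n"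
  shows "(Poly_Mapping.single 1 1 :: int \<Rightarrow>\<^sub>0 'k::field) [^]\<^bsub>group_hopf_algebra (integer_mod_group n)\<^esub> (c::nat)
    = Poly_Mapping.single (int c) 1"
  using assms(2)
proof (induction c)
  case 0
  show ?case by simp
next
  case (Suc c)
  then show ?case using assms(1) by (simp add: add.commute)
qed

lemma dual_bases_group:
  assumes "n \<ge> 2"
  shows "dual_bases (group_hopf_algebra (integer_mod_group n) :: ('k::field, int \<Rightarrow>\<^sub>0 'k) hopf) {..<n}
    (\<lambda>c. Poly_Mapping.single (int c) 1) (\<lambda>c p. Poly_Mapping.lookup p (int c))"
proof -
  let ?H = "group_hopf_algebra (integer_mod_group n) :: ('k, int \<Rightarrow>\<^sub>0 'k) hopf"
  interpret H: assoc_algebra ?H by (rule hopf_algebra_assoc[OF hopf_algebra_group[OF group_integer_mod]])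
  let ?e = "\<lambda>c. Poly_Mapping.single (int c) 1 :: int \<Rightarrow>\<^sub>0 'k"
  have carr: "carrier (integer_mod_group n) = {0..<int n}" using assms by (simp add: carrier_integer_mod_group)
  have e: "?e \<in> {..<n} \<rightarrow> carrier ?H" by (auto simp: carr)
  have "p \<in> linear_span ?H ?e {..<n}" if "Poly_Mapping.keys p \<subseteq> carrier (integer_mod_group n)" for p
    using that
  proof (induction p rule: poly_mapping_induct_keys)
    case zero
    show ?case using H.linear_span_zero[OF finite_lessThan e] by simp
  next
    case (add k c p)
    have "nat k < n" "int (nat k) = k" using add(1) by (auto simp: carr)
    then have "c \<odot>\<^bsub>?H\<^esub> Poly_Mapping.single k 1 \<in> linear_span ?H ?e {..<n}"
      using H.linear_span_base[OF finite_lessThan e, of "nat k"] by (intro H.linear_span_scale[OF finite_lessThan e]) simp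
    then show ?case using H.linear_span_add[OF finite_lessThan e _ add(3)] by simp
  qed
  then show ?thesis
    unfolding dual_bases_def
    by (auto simp: carr linear_span_def lookup_add lookup_single when_def intro!: linear_homI)
qed

lemma dual_bases_taft_tensor_group:
  assumes q: "primitive_root_of_unity m (q :: 'k::field)" "m > 0" and n: "n \<ge> 2"
  shows "\<exists>d. dual_bases (tensor (taft_hopf m q) (group_hopf_algebra (integer_mod_group n)))
    ({..<m} \<times> {..<m} \<times> {..<n})
    (\<lambda>(a, b, c). pure_tensor (taft_hopf m q) (group_hopf_algebra (integer_mod_group n))
      (monomial (taft_hopf m q) \<one>\<^bsub>taft_hopf m q\<^esub> (taft_h m q) (taft_x m q) (a, b, 0))
      (Poly_Mapping.single (int c) 1)) d"
proof -
  let ?T = "taft_hopf m q" and ?G = "group_hopf_algebra (integer_mod_group n) :: ('k, int \<Rightarrow>\<^sub>0 'k) hopf"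
  note TA = hopf_algebra_assoc[OF hopf_algebra_taft[OF q]]
  note GA = hopf_algebra_assoc[OF hopf_algebra_group[OF group_integer_mod, where 'k = 'k]]
  interpret TG: algebra_pair ?T ?G using TA GA by (rule algebra_pairI)
  obtain d where d: "dual_bases ?T ({..<m} \<times> {..<m} \<times> {..<1})
    (monomial ?T \<one>\<^bsub>?T\<^esub> (taft_h m q) (taft_x m q)) d" using dual_bases_taft[OF q] by blast
  \<comment> \<open>The third exponent of a Taft monomial is always 0; reindexing drops it and puts
    the exponent of the group generator in its place.\<close>
  have "bij_betw (\<lambda>(a, b, c). ((a, b, 0::nat), c)) ({..<m} \<times> {..<m} \<times> {..<n}) (({..<m} \<times> {..<m} \<times> {..<1}) \<times> {..<n})"
    by (rule bij_betwI[of _ _ _ "\<lambda>((a, b, z), c). (a, b, c)"]) auto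
  from dual_bases_reindex[OF TG.T.assoc_algebra_axioms dual_bases_tensor[OF TA GA d dual_bases_group[OF n]] this]
  show ?thesis
    by (intro exI) (rule dual_bases_cong[OF _ TG.T.assoc_algebra_axioms], assumption, auto)
qed

text \<open>The product map sends the tensor basis to the monomials in the images of h, x and the
  group generator. Its bijectivity and the basis property of these monomials thus imply each other,
  and both implications are used.\<close>

lemma product_map:
  assumes q: "primitive_root_of_unity m (q :: 'k::field)" "m > 0" and n: "n \<ge> 2"
    and E: "assoc_algebra E" and i: "i \<in> algebra_hom (taft_hopf m q) E"
    and j: "j \<in> algebra_hom (group_hopf_algebra (integer_mod_group n)) E"
  defines "P \<equiv> tensor_lift E (\<lambda>a y. i a \<otimes>\<^bsub>E\<^esub> j y)"
  shows "P \<in> linear_hom (tensor (taft_hopf m q) (group_hopf_algebra (integer_mod_group n))) E"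
    and "(a, b, c) \<in> {..<m} \<times> {..<m} \<times> {..<n} \<Longrightarrow>
      P (pure_tensor (taft_hopf m q) (group_hopf_algebra (integer_mod_group n))
      (monomial (taft_hopf m q) \<one>\<^bsub>taft_hopf m q\<^esub> (taft_h m q) (taft_x m q) (a, b, 0))
      (Poly_Mapping.single (int c) 1))
      = monomial E (j (Poly_Mapping.single 1 1)) (i (taft_h m q)) (i (taft_x m q)) (a, b, c)"
proof -
  let ?T = "taft_hopf m q" and ?G = "group_hopf_algebra (integer_mod_group n) :: ('k, int \<Rightarrow>\<^sub>0 'k) hopf"
  note TA = hopf_algebra_assoc[OF hopf_algebra_taft[OF q]]
  note GA = hopf_algebra_assoc[OF hopf_algebra_group[OF group_integer_mod, where 'k = 'k]]
  interpret TG: algebra_pair ?T ?G using TA GA by (rule algebra_pairI)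
  interpret E: assoc_algebra E by fact
  have bil: "(\<lambda>a y. i a \<otimes>\<^bsub>E\<^esub> j y) \<in> bilinear_maps ?T ?G E"
    by (rule bilinear_maps_precomp[OF bilinear_mult[OF E] algebra_homD(1)[OF i] algebra_homD(1)[OF j]])
  note P = TG.tensor_lift[OF E bil]
  show "P \<in> linear_hom (tensor ?T ?G) E" unfolding P_def by (rule P(1))
  assume abc: "(a, b, c) \<in> {..<m} \<times> {..<m} \<times> {..<n}"
  have carr: "carrier (integer_mod_group n) = {0..<int n}" using n by (simp add: carrier_integer_mod_group)
  note p = taft_pairD[OF taft_pair_taft[OF q]]
  have mono: "monomial ?T \<one>\<^bsub>?T\<^esub> (taft_h m q) (taft_x m q) (a, b, 0) \<in> carrier ?T"
    using p by (simp add: monomial_def)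
  have s1: "Poly_Mapping.single 1 1 \<in> carrier ?G" using n by (simp add: carr)
  have s: "Poly_Mapping.single (int c) 1 \<in> carrier ?G" using abc by (simp add: carr)
  have "j (Poly_Mapping.single (int c) 1) = j (Poly_Mapping.single 1 1) [^]\<^bsub>E\<^esub> c"
    using abc n by (subst single_pow_integer_mod[symmetric]) (auto intro!: algebra_hom_pow[OF GA E j s1])
  moreover have "i (monomial ?T \<one>\<^bsub>?T\<^esub> (taft_h m q) (taft_x m q) (a, b, 0))
      = monomial E \<one>\<^bsub>E\<^esub> (i (taft_h m q)) (i (taft_x m q)) (a, b, 0)"
    using p by (subst monomial_hom[OF TA E i]) (simp_all add: algebra_homD(3)[OF i])
  ultimately show "P (pure_tensor ?T ?G (monomial ?T \<one>\<^bsub>?T\<^esub> (taft_h m q) (taft_x m q) (a, b, 0))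
      (Poly_Mapping.single (int c) 1))
      = monomial E (j (Poly_Mapping.single 1 1)) (i (taft_h m q)) (i (taft_x m q)) (a, b, c)"
    unfolding P_def P(2)[OF mono s] using p algebra_homD(4)[OF i] by (simp add: monomial_def)
qed

section \<open>Factorizable Hopf algebras\<close>

lemma ground_minus: "a \<ominus>\<^bsub>(ground_algebra :: ('k::field, 'k) module)\<^esub> b = a - b"
proof -
  interpret K: assoc_algebra "ground_algebra :: ('k, 'k) module" by (rule assoc_algebra_ground)
  have "\<ominus>\<^bsub>(ground_algebra :: ('k, 'k) module)\<^esub> b = - b" by (rule K.minus_equality) simp_all
  then show ?thesis by (simp add: a_minus_def)
qed

text \<open>The data kept from a factorization, expressed by elements of E. No relation between g
  and h or x is assumed; these relations are what has to be derived.\<close>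

locale taft_factorized =
  fixes E :: "('k::field, 'e, 'z) hopf_scheme" (structure)
    and m n :: nat and q :: 'k and g h x :: 'e and d :: "nat \<times> nat \<times> nat \<Rightarrow> 'e \<Rightarrow> 'k"
  assumes hopf: "hopf_algebra E" and m: "m \<ge> 2" and n: "n > 0" and q: "primitive_root_of_unity m q"
    and pair: "taft_pair E m q h x" and skew: "skew_primitive_pair E h x"
    and g_in: "g \<in> carrier E" and g_pow: "g [^]\<^bsub>E\<^esub> n = \<one>" and g_grouplike: "grouplike E g"
    and basis: "dual_bases E ({..<m} \<times> {..<m} \<times> {..<n}) (monomial E g h x) d"
begin

sublocale E: hopf_algebra E by (rule hopf)
sublocale EE: algebra_pair E E by (intro algebra_pairI hopf_algebra_assoc hopf)

abbreviation "I \<equiv> {..<m} \<times> {..<m} \<times> {..<n}"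
abbreviation "e \<equiv> monomial E g h x"

lemmas EA = E.assoc_algebra_axioms
lemmas TA = EE.T.assoc_algebra_axioms
lemmas b = dual_basesD[OF basis]
lemmas p = taft_pairD[OF pair]
lemmas \<Delta> = algebra_homD[OF E.comult_hom]

lemma hx_in [simp]: "h \<in> carrier E" "x \<in> carrier E" "g \<in> carrier E"
  using p g_in by auto

lemma e_in [simp]: "e i \<in> carrier E"
  by (cases i) (simp add: monomial_def)

lemma e_one: "e (0, 0, 0) = \<one>" and e_h: "e (1, 0, 0) = h" and e_x: "e (0, 1, 0) = x"
  by (simp_all add: monomial_def)

definition coord2 :: "nat \<times> nat \<times> nat \<Rightarrow> nat \<times> nat \<times> nat \<Rightarrow> ('e \<times> 'e \<Rightarrow>\<^sub>0 'k) set \<Rightarrow> 'k" where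
  "coord2 i j = tensor_lift ground_algebra (\<lambda>u v. d i u * d j v)"

lemma coord2:
  assumes "i \<in> I" "j \<in> I"
  shows "coord2 i j \<in> linear_hom (tensor E E) ground_algebra"
    and "u \<in> carrier E \<Longrightarrow> v \<in> carrier E \<Longrightarrow> coord2 i j (pure_tensor E E u v) = d i u * d j v"
proof -
  have "(\<lambda>u v. d i u * d j v) \<in> bilinear_maps E E ground_algebra"
    using bilinear_maps_precomp[OF bilinear_mult[OF assoc_algebra_ground] b(3)[OF assms(1)] b(3)[OF assms(2)]]
    by simp
  note l = EE.tensor_lift[OF assoc_algebra_ground this]
  show "coord2 i j \<in> linear_hom (tensor E E) ground_algebra"
    and "u \<in> carrier E \<Longrightarrow> v \<in> carrier E \<Longrightarrow> coord2 i j (pure_tensor E E u v) = d i u * d j v"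
    unfolding coord2_def by (rule l(1), rule l(2))
qed

lemma comult_h: "comult E h = pure_tensor E E h h"
  and comult_x: "comult E x = pure_tensor E E x h \<oplus>\<^bsub>tensor E E\<^esub> pure_tensor E E \<one> x"
  and comult_g: "comult E g = pure_tensor E E g g"
  using skew g_grouplike by (simp_all add: skew_primitive_pair_def grouplike_def)

text \<open>The summands of the q-binomial expansion are multiples of distinct pairs of basis
  elements, so a coordinate selects the single summand k = b1, if the pair matches at all.\<close>

lemma coord2_comult_monomial:
  assumes i: "(a1, b1, c1) \<in> I" and j: "(a2, b2, c2) \<in> I" and abc: "(a, b, c) \<in> I"
  shows "coord2 (a1, b1, c1) (a2, b2, c2) (comult E (e (a, b, c)))
    = (if c1 = c2 \<and> a2 = (a1 + b1) mod m \<and> (a, b, c) = (a1, b1 + b2, c1) then qbinom q b b1 else 0)"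
proof -
  let ?T = "tensor E E" and ?t = "pure_tensor E E"
  let ?u = "?t x h" and ?v = "?t \<one> x" and ?hh = "?t (h [^]\<^bsub>E\<^esub> a) (h [^]\<^bsub>E\<^esub> a)" and ?gg = "?t (g [^]\<^bsub>E\<^esub> c) (g [^]\<^bsub>E\<^esub> c)"
  let ?f = "coord2 (a1, b1, c1) (a2, b2, c2)"
  note f = coord2[OF i j]
  have vu: "?v \<otimes>\<^bsub>?T\<^esub> ?u = q \<odot>\<^bsub>?T\<^esub> (?u \<otimes>\<^bsub>?T\<^esub> ?v)"
    by (simp add: p(5) EE.pure_scale_right)
  have "comult E (e (a, b, c)) = ?hh \<otimes>\<^bsub>?T\<^esub> (?u \<oplus>\<^bsub>?T\<^esub> ?v) [^]\<^bsub>?T\<^esub> b \<otimes>\<^bsub>?T\<^esub> ?gg"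
    by (simp add: monomial_def \<Delta> algebra_hom_pow[OF EA TA E.comult_hom] comult_h comult_x comult_g)
  also have "\<dots> = ?hh \<otimes>\<^bsub>?T\<^esub> (\<Oplus>\<^bsub>?T\<^esub>k\<in>{..b}. qbinom q b k \<odot>\<^bsub>?T\<^esub> (?u [^]\<^bsub>?T\<^esub> k \<otimes>\<^bsub>?T\<^esub> ?v [^]\<^bsub>?T\<^esub> (b - k))) \<otimes>\<^bsub>?T\<^esub> ?gg"
    by (subst EE.T.qbinomial_theorem[OF _ _ vu]) simp_all
  finally have 1: "comult E (e (a, b, c)) = \<dots>" .
  let ?L = "\<lambda>t. ?f (?hh \<otimes>\<^bsub>?T\<^esub> t \<otimes>\<^bsub>?T\<^esub> ?gg)"
  have L: "?L \<in> linear_hom ?T ground_algebra"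
    by (intro linear_hom_comp[OF _ f(1)] linear_hom_mult_right linear_hom_mult_left TA linear_hom_id(2)) simp_all
  have summand: "?L (qbinom q b k \<odot>\<^bsub>?T\<^esub> (?u [^]\<^bsub>?T\<^esub> k \<otimes>\<^bsub>?T\<^esub> ?v [^]\<^bsub>?T\<^esub> (b - k)))
      = (if k = b1 then (if c1 = c2 \<and> a2 = (a1 + b1) mod m \<and> (a, b, c) = (a1, b1 + b2, c1) then qbinom q b b1 else 0) else 0)"
    if k: "k \<le> b" for k
  proof -
    have "?hh \<otimes>\<^bsub>?T\<^esub> (?u [^]\<^bsub>?T\<^esub> k \<otimes>\<^bsub>?T\<^esub> ?v [^]\<^bsub>?T\<^esub> (b - k)) \<otimes>\<^bsub>?T\<^esub> ?gg
        = ?t (e (a, k, c)) (h [^]\<^bsub>E\<^esub> a \<otimes> (h [^]\<^bsub>E\<^esub> k \<otimes> x [^]\<^bsub>E\<^esub> (b - k)) \<otimes> g [^]\<^bsub>E\<^esub> c)"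
      by (simp add: monomial_def)
    \<comment> \<open>The exponent a + k is reduced modulo m to stay within the index set of the
      basis.\<close>
    also have "h [^]\<^bsub>E\<^esub> a \<otimes> (h [^]\<^bsub>E\<^esub> k \<otimes> x [^]\<^bsub>E\<^esub> (b - k)) \<otimes> g [^]\<^bsub>E\<^esub> c = e ((a + k) mod m, b - k, c)"
      by (simp add: monomial_def E.pow_mod p(3) E.m_assoc flip: E.nat_pow_mult)
    finally have "?L (qbinom q b k \<odot>\<^bsub>?T\<^esub> (?u [^]\<^bsub>?T\<^esub> k \<otimes>\<^bsub>?T\<^esub> ?v [^]\<^bsub>?T\<^esub> (b - k)))
        = qbinom q b k * (d (a1, b1, c1) (e (a, k, c)) * d (a2, b2, c2) (e ((a + k) mod m, b - k, c)))"
      using linear_homD(3)[OF L, of "?u [^]\<^bsub>?T\<^esub> k \<otimes>\<^bsub>?T\<^esub> ?v [^]\<^bsub>?T\<^esub> (b - k)" "qbinom q b k"]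
      by (simp add: f(2) del: EE.pure_pow EE.pure_mult)
    moreover have "(a, k, c) \<in> I" "((a + k) mod m, b - k, c) \<in> I" using abc k m by auto
    ultimately show ?thesis using i j k by (auto simp: b(4))
  qed
  have "?f (comult E (e (a, b, c))) = (\<Sum>k\<le>b. ?L (qbinom q b k \<odot>\<^bsub>?T\<^esub> (?u [^]\<^bsub>?T\<^esub> k \<otimes>\<^bsub>?T\<^esub> ?v [^]\<^bsub>?T\<^esub> (b - k))))"
    unfolding 1 by (subst linear_hom_finsum[OF TA assoc_algebra_ground L]) (auto simp: finsum_ground)
  also have "\<dots> = (\<Sum>k\<le>b. if k = b1 then (if c1 = c2 \<and> a2 = (a1 + b1) mod m \<and> (a, b, c) = (a1, b1 + b2, c1)
      then qbinom q b b1 else 0) else 0)"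
    by (intro sum.cong refl summand) simp
  also have "\<dots> = (if c1 = c2 \<and> a2 = (a1 + b1) mod m \<and> (a, b, c) = (a1, b1 + b2, c1) then qbinom q b b1 else 0)"
    by auto
  finally show ?thesis .
qed

text \<open>For a given pair of basis elements only one coordinate of y contributes, so a second
  expression for the coproduct of y isolates that coordinate. The condition
  \<open>b1 + b2 < m\<close> keeps its index within the basis.\<close>

lemma coord2_comult:
  assumes i: "(a1, b1, c1) \<in> I" and j: "(a2, b2, c2) \<in> I" and y: "y \<in> carrier E"
  shows "coord2 (a1, b1, c1) (a2, b2, c2) (comult E y)
    = (if c1 = c2 \<and> a2 = (a1 + b1) mod m \<and> b1 + b2 < m then qbinom q (b1 + b2) b1 * d (a1, b1 + b2, c1) y else 0)"
proof (rule dual_bases_hom_eqI[OF EA assoc_algebra_ground basis _ _ _ y])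
  show "(\<lambda>y. coord2 (a1, b1, c1) (a2, b2, c2) (comult E y)) \<in> linear_hom E ground_algebra"
    by (rule linear_hom_comp[OF \<Delta>(1) coord2(1)[OF i j]])
  show "(\<lambda>y. if c1 = c2 \<and> a2 = (a1 + b1) mod m \<and> b1 + b2 < m
      then qbinom q (b1 + b2) b1 * d (a1, b1 + b2, c1) y else 0) \<in> linear_hom E ground_algebra"
  proof (cases "b1 + b2 < m")
    case True
    then have "d (a1, b1 + b2, c1) \<in> linear_hom E ground_algebra" using i j by (intro b(3)) auto
    from linear_homD[OF this] show ?thesis by (intro linear_homI) (auto simp: algebra_simps)
  qed (auto intro: linear_homI)
  fix k assume k: "k \<in> I"
  then obtain a b' c where k': "k = (a, b', c)" "(a, b', c) \<in> I" by (cases k) auto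
  show "coord2 (a1, b1, c1) (a2, b2, c2) (comult E (e k)) = (if c1 = c2 \<and> a2 = (a1 + b1) mod m \<and> b1 + b2 < m
      then qbinom q (b1 + b2) b1 * d (a1, b1 + b2, c1) (e k) else 0)"
  proof (cases "b1 + b2 < m")
    case True
    then have "(a1, b1 + b2, c1) \<in> I" using i j by auto
    note dk = b(4)[OF this k'(2)]
    show ?thesis
    proof (cases "(a, b', c) = (a1, b1 + b2, c1)")
      case eq: True
      then show ?thesis
        unfolding k'(1) coord2_comult_monomial[OF i j k'(2)] dk using True by simp
    next
      case False
      then have "(a1, b1 + b2, c1) \<noteq> (a, b', c)" by metis
      with False True show ?thesis
        unfolding k'(1) coord2_comult_monomial[OF i j k'(2)] dk by simp
    qed
  next
    case False
    then have "b' \<noteq> b1 + b2" using k'(2) by auto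
    then show ?thesis unfolding k'(1) coord2_comult_monomial[OF i j k'(2)] using False by simp
  qed
qed

text \<open>Take both indices equal. Grouplikeness gives the square of the coordinate, while the
  general formula gives 0, since \<open>(a + b') mod m = a\<close> is impossible for 0 < b' <
  m.\<close>

lemma grouplike_coord:
  assumes k: "k \<in> carrier E" "grouplike E k" and i: "(a, b', c) \<in> I" "b' > 0"
  shows "d (a, b', c) k = 0"
proof -
  have "(a + b') mod m \<noteq> a"
    using i by (cases "a + b' < m") (auto simp: le_mod_geq not_less)
  then have "d (a, b', c) k * d (a, b', c) k = 0"
    using coord2_comult[OF i(1) i(1) k(1)] coord2(2)[OF i(1) i(1) k(1) k(1)] k(2)
    by (simp add: grouplike_def)
  then show ?thesis by simp
qed

lemma grouplike_mult:
  assumes "k \<in> carrier E" "grouplike E k" "l \<in> carrier E" "grouplike E l"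
  shows "grouplike E (k \<otimes> l)"
  using assms algebra_homD(7)[OF E.counit_hom] by (simp add: grouplike_def \<Delta>)

lemma grouplike_one: "grouplike E \<one>"
  using algebra_homD(3)[OF E.counit_hom] by (simp add: grouplike_def \<Delta> EE.pure_one)

lemma grouplike_pow: "k \<in> carrier E \<Longrightarrow> grouplike E k \<Longrightarrow> grouplike E (k [^]\<^bsub>E\<^esub> (r::nat))"
  by (induction r) (simp_all add: grouplike_one grouplike_mult)

lemma grouplike_h: "grouplike E h"
  using skew by (simp add: skew_primitive_pair_def grouplike_def)

section \<open>Conjugation of h and x by g\<close>

abbreviation "g' \<equiv> g [^]\<^bsub>E\<^esub> (n - 1)"

text \<open>Having the inverse of g as a power makes its grouplikeness an instance of that of
  powers, without recourse to the antipode.\<close>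

lemma g_inv: "g \<otimes> g' = \<one>" "g' \<otimes> g = \<one>"
proof -
  obtain k where k: "n = Suc k" using n by (cases n) auto
  show "g' \<otimes> g = \<one>" using g_pow by (simp add: k)
  show "g \<otimes> g' = \<one>" using g_pow by (simp only: k diff_Suc_1 E.nat_pow_Suc2 hx_in)
qed

definition y where "y = g \<otimes> x \<otimes> g'"
definition k where "k = g \<otimes> h \<otimes> g'"

lemma y_in [simp]: "y \<in> carrier E" and k_in [simp]: "k \<in> carrier E"
  by (simp_all add: y_def k_def)

lemma k_grouplike: "grouplike E k"
  unfolding k_def by (intro grouplike_mult grouplike_pow grouplike_h g_grouplike) simp_all

lemma comult_y: "comult E y = pure_tensor E E y k \<oplus>\<^bsub>tensor E E\<^esub> pure_tensor E E \<one> y"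
  by (simp add: y_def k_def \<Delta> algebra_hom_pow[OF EA TA E.comult_hom] comult_x comult_g
      EE.pure_sum_mult g_inv)

lemma coord_one: "i \<in> I \<Longrightarrow> d i \<one> = (if i = (0, 0, 0) then 1 else 0)"
  using b(4)[of i "(0, 0, 0)"] m n by (simp add: e_one)

text \<open>Second evaluation of the coordinates, from
  \<open>\<Delta>(y) = y \<otimes> k + 1 \<otimes> y\<close>. Equating it with
  \<open>coord2_comult\<close> yields the equations for y and k.\<close>

lemma coord2_y:
  assumes i: "i \<in> I" and j: "j \<in> I"
  shows "coord2 i j (comult E y) = d i y * d j k + (if i = (0, 0, 0) then d j y else 0)"
  using linear_homD(2)[OF coord2(1)[OF i j], of "pure_tensor E E y k" "pure_tensor E E \<one> y"]
  by (simp add: comult_y coord2(2)[OF i j] coord_one[OF i])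

text \<open>Pair the indices (a, 1, c) and ((a + 1) mod m, b' - 1, c). The term
  \<open>1 \<otimes> y\<close> does not contribute, and k has no coordinates of positive x-degree,
  so \<open>[b' choose 1]_q\<close> times the coordinate is 0.\<close>

lemma coord_y_ge_2:
  assumes "(a, b', c) \<in> I" "b' \<ge> 2"
  shows "d (a, b', c) y = 0"
proof -
  obtain b1 where b1: "b' = 1 + b1" "b1 > 0" using assms(2) by (cases b') auto
  have i: "(a, 1, c) \<in> I" and j: "((a + 1) mod m, b1, c) \<in> I" using assms m b1 by auto
  have "qbinom q b' 1 * d (a, b', c) y = 0"
    using coord2_comult[OF i j y_in] coord2_y[OF i j] grouplike_coord[OF k_in k_grouplike j b1(2)] assms
    by (simp add: b1)
  then show ?thesis using qbinom_1_neq_0[OF q, of b'] assms by auto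
qed

text \<open>Pair the indices (a, 0, c) and (a, 1, c), where the Gaussian coefficient is 1. The term
  in k vanishes by grouplikeness, and \<open>1 \<otimes> y\<close> contributes only when (a, c) =
  (0, 0).\<close>

lemma coord_y_1:
  assumes "(a, 1, c) \<in> I" "(a, c) \<noteq> (0, 0)"
  shows "d (a, 1, c) y = 0"
proof -
  have i: "(a, 0, c) \<in> I" using assms m by auto
  show ?thesis
    using coord2_comult[OF i assms(1) y_in] coord2_y[OF i assms(1)]
      grouplike_coord[OF k_in k_grouplike assms(1)] assms m by auto
qed

definition \<omega> where "\<omega> = d (0, 1, 0) y"

lemma coord_y: "(a, b', c) \<in> I \<Longrightarrow> b' > 0 \<Longrightarrow> d (a, b', c) y = (if (a, b', c) = (0, 1, 0) then \<omega> else 0)"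
  using coord_y_ge_2[of a b' c] coord_y_1[of a c] by (cases "b' = 1") (auto simp: \<omega>_def)

lemma coord_x: "i \<in> I \<Longrightarrow> d i x = (if i = (0, 1, 0) then 1 else 0)"
  using b(4)[of i "(0, 1, 0)"] m n by (simp add: e_x)

lemma x_neq_zero: "x \<noteq> \<zero>"
proof
  assume "x = \<zero>"
  then have "d (0, 1, 0) x = 0"
    using linear_hom_zero[OF EA assoc_algebra_ground b(3)[of "(0, 1, 0)"]] m n by simp
  then show False using coord_x[of "(0, 1, 0)"] m n by simp
qed

lemma grouplike_e: "grouplike E (e (a, 0, c))"
  by (simp add: monomial_def grouplike_mult grouplike_pow grouplike_h g_grouplike)

text \<open>Otherwise \<open>y\<close>, hence also \<open>x\<close>, would be a linear combination of grouplike elements.\<close>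

lemma omega_neq_zero: "\<omega> \<noteq> 0"
proof
  assume "\<omega> = 0"
  have i: "(0, 1, 0) \<in> I" using m n by auto
  have "d (0, 1, 0) (g' \<otimes> y \<otimes> g) = 0"
  proof (rule dual_bases_hom_eqI_support[OF EA assoc_algebra_ground basis _ _ y_in])
    show "(\<lambda>y. d (0, 1, 0) (g' \<otimes> y \<otimes> g)) \<in> linear_hom E ground_algebra"
      by (intro linear_hom_comp[OF _ b(3)[OF i]] linear_hom_mult_right linear_hom_mult_left EA linear_hom_id(2)) simp_all
    show "(\<lambda>y. 0 :: 'k) \<in> linear_hom E ground_algebra" by (auto intro: linear_homI)
    fix j assume j: "j \<in> I" "d j y \<noteq> 0"
    then obtain a c where "j = (a, 0, c)"
      using coord_y \<open>\<omega> = 0\<close> by (cases j) (metis neq0_conv)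
    then have "grouplike E (g' \<otimes> e j \<otimes> g)"
      by (simp add: grouplike_mult grouplike_pow grouplike_e g_grouplike)
    then show "d (0, 1, 0) (g' \<otimes> e j \<otimes> g) = 0"
      using i by (intro grouplike_coord) simp_all
  qed
  moreover have "g' \<otimes> y \<otimes> g = x"
  proof -
    have "g' \<otimes> y \<otimes> g = (g' \<otimes> g) \<otimes> x \<otimes> (g' \<otimes> g)" unfolding y_def by (simp add: E.m_assoc del: E.nat_pow_Suc)
    then show ?thesis by (simp add: g_inv)
  qed
  ultimately show False using coord_x[OF i] by simp
qed

text \<open>Pair (0, 1, 0) with j = (a, 0, c). One evaluation gives \<omega> times the coordinate of
  k at j, the other gives \<omega> if j = (1, 0, 0) and 0 otherwise; then \<omega> cancels.
  Coordinates of positive x-degree vanish for k and h alike.\<close>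

lemma k_eq_h: "k = h"
proof (rule dual_bases_eqI[OF EA basis])
  have i: "(0, 1, 0) \<in> I" and h: "(1, 0, 0) \<in> I" using m n by auto
  fix j assume j: "j \<in> I"
  obtain a b' c where abc: "j = (a, b', c)" by (cases j)
  have dh: "d j h = (if j = (1, 0, 0) then 1 else 0)" using b(4)[OF j h] by (simp only: e_h)
  show "d j k = d j h"
  proof (cases "b' = 0")
    case True
    have "\<omega> * d j k = (if c = 0 \<and> a = 1 then \<omega> else 0)"
      using coord2_comult[OF i _ y_in, of a b' c] coord2_y[OF i j] j m True abc
      by (auto simp: \<omega>_def)
    then show ?thesis using omega_neq_zero by (auto simp: dh[unfolded abc True] abc True split: if_splits)
  next
    case False
    then show ?thesis using grouplike_coord[OF k_in k_grouplike, of a b' c] j by (simp add: dh[unfolded abc] abc)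
  qed
qed simp_all

lemma hg: "h \<otimes> g = g \<otimes> h"
proof -
  have "h \<otimes> g = (g \<otimes> h \<otimes> g') \<otimes> g" using k_eq_h by (simp add: k_def)
  also have "\<dots> = g \<otimes> h \<otimes> (g' \<otimes> g)" by (simp add: E.m_assoc del: E.nat_pow_Suc)
  finally show ?thesis by (simp add: g_inv)
qed

text \<open>The difference z of the two sides has coordinates only at monomials
  \<open>h^a g^c\<close>, which commute with h. On the other hand z inherits \<open>zh = qhz\<close>
  from y and x, so \<open>(1 - q) hz = 0\<close>; here q is not 1 and h is invertible.\<close>

lemma y_eq: "y = \<omega> \<odot> x"
proof -
  define z where "z = y \<ominus> \<omega> \<odot> x"
  have z [simp]: "z \<in> carrier E" by (simp add: z_def)
  have hg': "g' \<otimes> h = h \<otimes> g'"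
    using E.scalar_commute_pow[of g h 1 "n - 1" 1] by (simp add: hg)
  have "y \<otimes> h = g \<otimes> x \<otimes> (g' \<otimes> h)" by (simp add: y_def E.m_assoc)
  also have "\<dots> = g \<otimes> (x \<otimes> h) \<otimes> g'" by (simp add: hg' E.m_assoc)
  also have "\<dots> = q \<odot> ((g \<otimes> h) \<otimes> x \<otimes> g')" by (simp add: p(5) E.smult_mult_left E.smult_mult_right E.m_assoc)
  also have "\<dots> = q \<odot> (h \<otimes> y)" by (simp add: hg[symmetric] y_def E.m_assoc)
  finally have yh: "y \<otimes> h = q \<odot> (h \<otimes> y)" .
  have zh: "z \<otimes> h = q \<odot> (h \<otimes> z)"
    by (simp add: z_def a_minus_def E.l_distr E.r_distr E.l_minus E.r_minus yh p(5) E.smult_mult_left E.smult_mult_right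
        E.scale_add_right E.scale_minus_right mult.commute)
  have "z \<otimes> h = h \<otimes> z"
  proof (rule dual_bases_hom_eqI_support[OF EA EA basis _ _ z])
    show "(\<lambda>z. z \<otimes> h) \<in> linear_hom E E" "(\<lambda>z. h \<otimes> z) \<in> linear_hom E E"
      by (intro linear_hom_mult_left linear_hom_mult_right EA linear_hom_id(2); simp)+
    fix i assume i: "i \<in> I" "d i z \<noteq> 0"
    obtain a b' c where abc: "i = (a, b', c)" by (cases i)
    have "d i z = d i y - \<omega> * d i x"
      using linear_hom_diff[OF EA assoc_algebra_ground b(3)[OF i(1)], of y "\<omega> \<odot> x"]
        linear_homD(3)[OF b(3)[OF i(1)], of x \<omega>]
      by (simp add: z_def ground_minus)
    then have b0: "b' = 0" using i coord_y[of a b' c] coord_x[OF i(1)] abc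
      by (cases "b' = 0") (auto split: if_splits)
    have "g [^]\<^bsub>E\<^esub> c \<otimes> h = h \<otimes> g [^]\<^bsub>E\<^esub> c"
      using E.scalar_commute_pow[of g h 1 c 1] by (simp add: hg)
    moreover have "h [^]\<^bsub>E\<^esub> a \<otimes> h = h \<otimes> h [^]\<^bsub>E\<^esub> a"
      using E.scalar_commute_pow[of h h 1 a 1] by simp
    ultimately show "e i \<otimes> h = h \<otimes> e i"
      by (simp add: abc b0 monomial_def E.m_assoc) (simp flip: E.m_assoc)
  qed
  then have "(1 - q) \<odot> (h \<otimes> z) = \<zero>"
    using E.scale_add_left[of "h \<otimes> z" 1 "- q"] zh by (simp add: E.scale_minus_left E.r_neg)
  moreover have "1 - q \<noteq> 0" using primitive_rootD(3)[OF q, of 1] m by auto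
  ultimately have "h \<otimes> z = \<zero>" using E.scale_cancel[of "h \<otimes> z" "1 - q"] by simp
  moreover obtain m' where "m = Suc m'" using m by (cases m) auto
  then have "h [^]\<^bsub>E\<^esub> m' \<otimes> h = \<one>" using p(3) by simp
  then have "z = h [^]\<^bsub>E\<^esub> m' \<otimes> (h \<otimes> z)" by (simp flip: E.m_assoc)
  ultimately have "z = \<zero>" by simp
  then show ?thesis unfolding z_def by (simp add: E.r_right_minus_eq)
qed

lemma gx: "g \<otimes> x = \<omega> \<odot> (x \<otimes> g)"
proof -
  have "g \<otimes> x = g \<otimes> x \<otimes> (g' \<otimes> g)" by (simp add: g_inv)
  also have "\<dots> = y \<otimes> g" by (simp add: y_def E.m_assoc del: E.nat_pow_Suc)
  finally show ?thesis by (simp add: y_eq E.smult_mult_left)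
qed

lemma omega_pow: "\<omega> ^ n = 1"
proof -
  have "g [^]\<^bsub>E\<^esub> n \<otimes> x [^]\<^bsub>E\<^esub> (1::nat) = \<omega> ^ (n * 1) \<odot> (x [^]\<^bsub>E\<^esub> (1::nat) \<otimes> g [^]\<^bsub>E\<^esub> n)"
    by (rule E.scalar_commute_pow) (simp_all add: gx)
  then have "x = \<omega> ^ n \<odot> x" by (simp add: g_pow)
  then have "(1 - \<omega> ^ n) \<odot> x = \<zero>"
    using E.scale_add_left[of x 1 "- (\<omega> ^ n)"] by (simp add: E.scale_minus_left E.r_neg)
  then show ?thesis using E.scale_cancel[of x "1 - \<omega> ^ n"] x_neq_zero by auto
qed

lemma taft_triple: "taft_triple E n m \<omega> q g h x"
  using pair g_pow hg gx by (simp add: taft_triple_def)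

end

section \<open>Hopf algebra maps prescribed on generators\<close>

lemma taft_coalgebra_hom:
  assumes H: "hopf_algebra H" and L: "hopf_algebra L" and f: "f \<in> algebra_hom H L"
    and "h \<in> carrier H" "x \<in> carrier H"
    and "skew_primitive_pair H h x" "skew_primitive_pair L (f h) (f x)"
  shows "comult L (f h) = tensor_map L L f f (comult H h)" "counit L (f h) = counit H h"
    "comult L (f x) = tensor_map L L f f (comult H x)" "counit L (f x) = counit H x"
proof -
  note HA = hopf_algebra_assoc[OF H] and LA = hopf_algebra_assoc[OF L]
  interpret HH: algebra_pair H H using HA HA by (rule algebra_pairI)
  note t = tensor_map[OF HA HA LA LA algebra_homD(1)[OF f] algebra_homD(1)[OF f]]
  show "comult L (f h) = tensor_map L L f f (comult H h)" "counit L (f h) = counit H h"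
    "comult L (f x) = tensor_map L L f f (comult H x)" "counit L (f x) = counit H x"
    using assms by (simp_all add: skew_primitive_pair_def t linear_homD(2)[OF t(1)] algebra_homD(3)[OF f])
qed

lemma skew_primitive_pair_hom:
  assumes H: "hopf_algebra H" and L: "hopf_algebra L" and f: "f \<in> hopf_hom H L"
    and "h \<in> carrier H" "x \<in> carrier H" "skew_primitive_pair H h x"
  shows "skew_primitive_pair L (f h) (f x)"
proof -
  note HA = hopf_algebra_assoc[OF H] and LA = hopf_algebra_assoc[OF L]
  interpret HH: algebra_pair H H using HA HA by (rule algebra_pairI)
  note f' = hopf_homD[OF f]
  note t = tensor_map[OF HA HA LA LA algebra_homD(1)[OF f'(1)] algebra_homD(1)[OF f'(1)]]
  show ?thesis
    using assms(4-) by (simp add: skew_primitive_pair_def f'(2,3) t linear_homD(2)[OF t(1)] algebra_homD(3)[OF f'(1)])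
qed

lemma grouplike_hom:
  assumes H: "hopf_algebra H" and L: "hopf_algebra L" and f: "f \<in> hopf_hom H L"
    and "g \<in> carrier H" "grouplike H g"
  shows "grouplike L (f g)"
proof -
  note HA = hopf_algebra_assoc[OF H] and LA = hopf_algebra_assoc[OF L]
  note f' = hopf_homD[OF f]
  note t = tensor_map[OF HA HA LA LA algebra_homD(1)[OF f'(1)] algebra_homD(1)[OF f'(1)]]
  show ?thesis using assms(4-) by (simp add: grouplike_def f'(2,3) t)
qed

lemma grouplike_comult_hom:
  assumes H: "hopf_algebra H" and L: "hopf_algebra L" and f: "f \<in> algebra_hom H L"
    and "g \<in> carrier H" "grouplike H g" "grouplike L (f g)"
  shows "comult L (f g) = tensor_map L L f f (comult H g)" "counit L (f g) = counit H g"
proof -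
  note HA = hopf_algebra_assoc[OF H] and LA = hopf_algebra_assoc[OF L]
  note t = tensor_map[OF HA HA LA LA algebra_homD(1)[OF f] algebra_homD(1)[OF f]]
  show "comult L (f g) = tensor_map L L f f (comult H g)" "counit L (f g) = counit H g"
    using assms by (simp_all add: grouplike_def t)
qed

lemma taft_lift:
  assumes q: "primitive_root_of_unity m (q :: 'k::field)" "m > 0" and L: "hopf_algebra L"
    and p: "taft_pair L m q h x" and s: "skew_primitive_pair L h x"
  shows "\<exists>f \<in> hopf_hom (taft_hopf m q) L. f (taft_h m q) = h \<and> f (taft_x m q) = x"
proof -
  note LA = hopf_algebra_assoc[OF L] and T = hopf_algebra_taft[OF q]
  define \<phi> where "\<phi> = (\<lambda>s. case s of Taft_h \<Rightarrow> h | Taft_x \<Rightarrow> x)"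
  have \<phi>: "taft_pair L m q (\<phi> Taft_h) (\<phi> Taft_x)" using p by (simp add: \<phi>_def)
  have \<phi>_in: "\<phi> s \<in> carrier L" for s using taft_pairD(1,2)[OF \<phi>] by (cases s) auto
  have rel: "eval_free L \<phi> r = \<zero>\<^bsub>L\<^esub>" if "r \<in> taft_relations m q" for r
    using assoc_algebra.taft_relations_iff[OF LA, of \<phi>, OF \<phi>_in] \<phi> that by blast
  note f = presented_lift[of L \<phi> "taft_relations m q", OF LA \<phi>_in rel]
  let ?f = "presented_lift L \<phi>"
  have hom: "?f \<in> algebra_hom (taft_hopf m q) L" using f(1) by (simp add: taft_hopf_def Let_def)
  have fhx: "?f (taft_h m q) = h" "?f (taft_x m q) = x" by (simp_all only: f(2)) (simp_all add: \<phi>_def)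
  note c = taft_coalgebra_hom[OF T L hom taft_pairD(1,2)[OF taft_pair_taft[OF q]] skew_primitive_pair_taft[OF q],
      unfolded fhx, OF s]
  have "?f \<in> hopf_hom (taft_hopf m q) L"
    by (rule hopf_homI_generators[OF T L generates_taft[OF q] hom]) (auto simp: fhx c)
  then show ?thesis using fhx by blast
qed

lemma taft_ext_lift:
  assumes q: "primitive_root_of_unity m (q :: 'k::field)" "m > 0" and \<omega>: "\<omega> ^ n = 1" "n > 0" and E: "hopf_algebra E"
    and t: "taft_triple E n m \<omega> q g h x" and s: "skew_primitive_pair E h x" and g: "grouplike E g"
  shows "\<exists>f \<in> hopf_hom (taft_ext_hopf n m \<omega> q) E.
    f (ext_g n m \<omega> q) = g \<and> f (ext_h n m \<omega> q) = h \<and> f (ext_x n m \<omega> q) = x"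
proof -
  note EA = hopf_algebra_assoc[OF E] and L = hopf_algebra_taft_ext[OF q \<omega>]
  define \<phi> where "\<phi> = (\<lambda>s. case s of Ext_g \<Rightarrow> g | Ext_h \<Rightarrow> h | Ext_x \<Rightarrow> x)"
  have \<phi>: "taft_triple E n m \<omega> q (\<phi> Ext_g) (\<phi> Ext_h) (\<phi> Ext_x)" using t by (simp add: \<phi>_def)
  have \<phi>_in: "\<phi> s \<in> carrier E" for s
    using taft_pairD(1,2)[OF taft_tripleD(1)[OF \<phi>]] taft_tripleD(2)[OF \<phi>] by (cases s) auto
  have rel: "eval_free E \<phi> r = \<zero>\<^bsub>E\<^esub>" if "r \<in> taft_ext_relations n m \<omega> q" for r
    using assoc_algebra.taft_ext_relations_iff[OF EA, of \<phi>, OF \<phi>_in] \<phi> that by blast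
  note f = presented_lift[of E \<phi> "taft_ext_relations n m \<omega> q", OF EA \<phi>_in rel]
  let ?f = "presented_lift E \<phi>"
  have hom: "?f \<in> algebra_hom (taft_ext_hopf n m \<omega> q) E" using f(1) by (simp add: taft_ext_hopf_def Let_def)
  have fg: "?f (ext_g n m \<omega> q) = g" "?f (ext_h n m \<omega> q) = h" "?f (ext_x n m \<omega> q) = x"
    by (simp_all only: f(2)) (simp_all add: \<phi>_def)
  note T = taft_triple_taft_ext[OF q \<omega>]
  note c = taft_coalgebra_hom[OF L E hom taft_pairD(1,2)[OF taft_tripleD(1)[OF T]] skew_primitive_pair_taft_ext[OF q \<omega>],
      unfolded fg, OF s]
    grouplike_comult_hom[OF L E hom taft_tripleD(2)[OF T] grouplike_taft_ext[OF q \<omega>], unfolded fg, OF g]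
  have "?f \<in> hopf_hom (taft_ext_hopf n m \<omega> q) E"
    by (rule hopf_homI_generators[OF L E generates_taft_ext[OF q \<omega>] hom]) (auto simp: fg c)
  then show ?thesis using fg by blast
qed

lemma group_lift:
  assumes n: "n \<ge> 2" and L: "hopf_algebra (L :: ('k::field, 'l, 'z) hopf_scheme)"
    and g: "g \<in> carrier L" "g [^]\<^bsub>L\<^esub> n = \<one>\<^bsub>L\<^esub>" "grouplike L g"
  shows "\<exists>f \<in> hopf_hom (group_hopf_algebra (integer_mod_group n) :: ('k, int \<Rightarrow>\<^sub>0 'k) hopf) L.
    f (Poly_Mapping.single 1 1) = g"
proof -
  let ?G = "integer_mod_group n" and ?H = "group_hopf_algebra (integer_mod_group n) :: ('k, int \<Rightarrow>\<^sub>0 'k) hopf"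
  note LA = hopf_algebra_assoc[OF L]
  interpret L: assoc_algebra L by (rule LA)
  interpret G: group ?G by (rule group_integer_mod)
  have carr: "carrier ?G = {0..<int n}" using n by (simp add: carrier_integer_mod_group)
  note H = hopf_algebra_group[OF group_integer_mod[of n], where 'k = 'k]
  let ?w = "\<lambda>k. g [^]\<^bsub>L\<^esub> nat k"
  let ?f = "linear_extension L ?w"
  have w: "?w \<in> carrier ?G \<rightarrow> carrier L" using g by auto
  have single: "?f (Poly_Mapping.single k 1) = g [^]\<^bsub>L\<^esub> nat k" for k
    using L.linear_extension_single[where f = ?w and a = k and c = 1] g by simp
  have "?f \<in> algebra_hom (monoid_algebra ?G) L"
  proof (rule monoid_algebra_homI[OF G.monoid_axioms LA L.linear_extension_linear[OF w]])
    fix a b assume ab: "a \<in> carrier ?G" "b \<in> carrier ?G"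
    \<comment> \<open>Addition in the group is reduced modulo n; the reduction is absorbed by
      \<open>g [^] n = \<one>\<close>.\<close>
    have "nat ((a + b) mod int n) = (nat a + nat b) mod n"
      using ab by (simp add: carr nat_mod_distrib nat_add_distrib)
    then show "?f (Poly_Mapping.single (a \<otimes>\<^bsub>?G\<^esub> b) 1) = ?f (Poly_Mapping.single a 1) \<otimes>\<^bsub>L\<^esub> ?f (Poly_Mapping.single b 1)"
      unfolding single using g by (simp add: L.pow_mod L.nat_pow_mult)
  next
    show "?f (Poly_Mapping.single \<one>\<^bsub>?G\<^esub> 1) = \<one>\<^bsub>L\<^esub>" unfolding single by simp
  qed
  then have hom: "?f \<in> algebra_hom ?H L" by (simp add: group_hopf_algebra_def Let_def)
  have gpow: "grouplike L (g [^]\<^bsub>L\<^esub> (r::nat))" for r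
  proof (induction r)
    interpret LL: algebra_pair L L using LA LA by (rule algebra_pairI)
    note D = algebra_homD[OF hopf_algebra.comult_hom[OF L]] and E = algebra_homD[OF hopf_algebra.counit_hom[OF L]]
    case 0
    show ?case by (simp add: grouplike_def D E LL.pure_one)
    case (Suc r)
    then show ?case using g by (simp add: grouplike_def D E)
  qed
  have "?f \<in> hopf_hom ?H L"
  proof (rule hopf_homI_generators[OF H L _ hom])
    show "generates ?H ((\<lambda>a. Poly_Mapping.single a 1) ` carrier ?G)"
      by (simp add: group_hopf_algebra_def Let_def generates_monoid_algebra G.monoid_axioms)
    fix s :: "int \<Rightarrow>\<^sub>0 'k" assume "s \<in> (\<lambda>a. Poly_Mapping.single a 1) ` carrier ?G"
    then obtain a where a: "a \<in> carrier ?G" "s = Poly_Mapping.single a 1" by blast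
    have s: "s \<in> carrier ?H" using a by simp
    have "grouplike ?H s"
      using a by (simp add: grouplike_def group_hopf_comult group_hopf_counit)
    moreover have "grouplike L (?f s)" unfolding a(2) single by (rule gpow)
    ultimately show "comult L (?f s) = tensor_map L L ?f ?f (comult ?H s)" "counit L (?f s) = counit ?H s"
      using grouplike_comult_hom[OF H L hom s] by blast+
  qed
  moreover have "?f (Poly_Mapping.single 1 1) = g" unfolding single using g by simp
  ultimately show ?thesis by blast
qed

section \<open>The two directions of the classification\<close>

text \<open>The inclusions come from the universal properties of the two factors. Their injectivity
  is read off from the coordinates with c = 0 and with a = b = 0, and the product map is bijective
  because it sends basis to basis.\<close>

lemma factorizes_through_taft_ext:
  assumes q: "primitive_root_of_unity m (q :: 'k::field)" "m > 0" and n: "n \<ge> 2" and \<omega>: "\<omega> ^ n = 1"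
  shows "factorizes_through (taft_ext_hopf n m \<omega> q) (taft_hopf m q)
    (group_hopf_algebra (integer_mod_group n) :: ('k, int \<Rightarrow>\<^sub>0 'k) hopf)"
proof -
  let ?L = "taft_ext_hopf n m \<omega> q" and ?T = "taft_hopf m q"
  let ?G = "group_hopf_algebra (integer_mod_group n) :: ('k, int \<Rightarrow>\<^sub>0 'k) hopf"
  let ?g = "ext_g n m \<omega> q" and ?h = "ext_h n m \<omega> q" and ?x = "ext_x n m \<omega> q"
  have n0: "n > 0" using n by simp
  note L = hopf_algebra_taft_ext[OF q \<omega> n0] and T = hopf_algebra_taft[OF q]
  note G = hopf_algebra_group[OF group_integer_mod[of n], where 'k = 'k]
  note A = hopf_algebra_assoc[OF L] hopf_algebra_assoc[OF T] hopf_algebra_assoc[OF G]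
  interpret TG: algebra_pair ?T ?G using A(2,3) by (rule algebra_pairI)
  note t = taft_tripleD[OF taft_triple_taft_ext[OF q \<omega> n0]]
  obtain i where i: "i \<in> hopf_hom ?T ?L" "i (taft_h m q) = ?h" "i (taft_x m q) = ?x"
    using taft_lift[OF q L t(1) skew_primitive_pair_taft_ext[OF q \<omega> n0]] by blast
  obtain j where j: "j \<in> hopf_hom ?G ?L" "j (Poly_Mapping.single 1 1) = ?g"
    using group_lift[OF n L t(2,3) grouplike_taft_ext[OF q \<omega> n0]] by blast
  note i' = hopf_homD(1)[OF i(1)] and j' = hopf_homD(1)[OF j(1)]
  note B = dual_bases_taft_ext[OF q \<omega> n0]
  note b = dual_basesD[OF B]
  obtain dT where dT: "dual_bases ?T ({..<m} \<times> {..<m} \<times> {..<1})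
    (monomial ?T \<one>\<^bsub>?T\<^esub> (taft_h m q) (taft_x m q)) dT" using dual_bases_taft[OF q] by blast
  \<comment> \<open>The third exponent is 0, so it makes no difference that the grouplike argument
    is the unit on one side and g on the other.\<close>
  have iT: "i (monomial ?T \<one>\<^bsub>?T\<^esub> (taft_h m q) (taft_x m q) k) = monomial ?L ?g ?h ?x k"
    if "k \<in> {..<m} \<times> {..<m} \<times> {..<1}" for k
  proof -
    interpret L: assoc_algebra ?L by (rule A)
    obtain a b where k: "k = (a, b, 0)" using \<open>k \<in> _\<close> by auto
    show ?thesis
      using taft_pairD(1,2)[OF taft_pair_taft[OF q]]
      by (subst monomial_hom[OF A(2,1) i']) (simp_all add: i algebra_homD(3)[OF i'], simp add: k monomial_def)
  qed
  have inj_i: "inj_on i (carrier ?T)"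
    by (rule dual_bases_inj[OF A(2,1) dT algebra_homD(1)[OF i'], where d' = "ext_coord n m \<omega> q"])
      (use n b(3,4) in \<open>auto simp: iT split: if_splits\<close>)
  have jG: "j (Poly_Mapping.single (int c) 1) = monomial ?L ?g ?h ?x (0, 0, c)" if "c \<in> {..<n}" for c
  proof -
    interpret L: assoc_algebra ?L by (rule A)
    have s1: "Poly_Mapping.single 1 1 \<in> carrier ?G" using n by simp
    have "j (Poly_Mapping.single (int c) 1) = ?g [^]\<^bsub>?L\<^esub> c"
      using algebra_hom_pow[OF A(3,1) j' s1, of c] that
      unfolding j(2) by (subst single_pow_integer_mod[OF n, symmetric]) simp_all
    then show ?thesis using t(2) by (simp add: monomial_def)
  qed
  have inj_j: "inj_on j (carrier ?G)"
    by (rule dual_bases_inj[OF A(3,1) dual_bases_group[OF n] algebra_homD(1)[OF j'],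
          where d' = "\<lambda>c. ext_coord n m \<omega> q (0, 0, c)"])
      (use q(2) b(3,4) in \<open>auto simp: jG\<close>)
  note P = product_map[OF q n A(1) i' j', unfolded i(2,3) j(2)]
  obtain d where d: "dual_bases (tensor ?T ?G) ({..<m} \<times> {..<m} \<times> {..<n})
    (\<lambda>(a, b, c). pure_tensor ?T ?G (monomial ?T \<one>\<^bsub>?T\<^esub> (taft_h m q) (taft_x m q) (a, b, 0))
      (Poly_Mapping.single (int c) 1)) d"
    using dual_bases_taft_tensor_group[OF q n] by blast
  have "bij_betw (tensor_lift ?L (\<lambda>a y. i a \<otimes>\<^bsub>?L\<^esub> j y)) (carrier (tensor ?T ?G)) (carrier ?L)"
    by (rule dual_bases_bij[OF TG.T.assoc_algebra_axioms A(1) d P(1) dual_bases_cong[OF B A(1)]])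
      (auto simp: P(2))
  then show ?thesis
    unfolding factorizes_through_def using L T G i(1) j(1) inj_i inj_j by blast
qed

text \<open>Both inclusions are composed with f; as f is multiplicative, the new product map is f
  after the old one.\<close>

lemma factorizes_through_iso:
  assumes fac: "factorizes_through L A H" and E: "hopf_algebra E" and f: "f \<in> hopf_hom L E"
    and bij: "bij_betw f (carrier L) (carrier E)"
  shows "factorizes_through E A H"
proof -
  obtain i j where L: "hopf_algebra L" and A: "hopf_algebra A" and H: "hopf_algebra H"
    and i: "i \<in> hopf_hom A L" "inj_on i (carrier A)" and j: "j \<in> hopf_hom H L" "inj_on j (carrier H)"
    and b: "bij_betw (tensor_lift L (\<lambda>a y. i a \<otimes>\<^bsub>L\<^esub> j y)) (carrier (tensor A H)) (carrier L)"
    using fac by (auto simp: factorizes_through_def)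
  note aa = hopf_algebra_assoc[OF A] hopf_algebra_assoc[OF H] hopf_algebra_assoc[OF L] hopf_algebra_assoc[OF E]
  interpret AH: algebra_pair A H using aa by (intro algebra_pairI)
  note f' = algebra_homD[OF hopf_homD(1)[OF f]] and i' = algebra_homD[OF hopf_homD(1)[OF i(1)]]
    and j' = algebra_homD[OF hopf_homD(1)[OF j(1)]]
  have bil: "(\<lambda>a y. i a \<otimes>\<^bsub>L\<^esub> j y) \<in> bilinear_maps A H L"
    by (rule bilinear_maps_precomp[OF bilinear_mult[OF aa(3)] i'(1) j'(1)])
  have bilE: "(\<lambda>a y. f (i a) \<otimes>\<^bsub>E\<^esub> f (j y)) \<in> bilinear_maps A H E"
    by (rule bilinear_maps_precomp[OF bilinear_mult[OF aa(4)] linear_hom_comp[OF i'(1) f'(1)] linear_hom_comp[OF j'(1) f'(1)]])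
  note lL = AH.tensor_lift[OF aa(3) bil]
  have eq: "tensor_lift E (\<lambda>a y. f (i a) \<otimes>\<^bsub>E\<^esub> f (j y)) t = f (tensor_lift L (\<lambda>a y. i a \<otimes>\<^bsub>L\<^esub> j y) t)"
    if "t \<in> carrier (tensor A H)" for t
    by (rule AH.tensor_lift_eqI[OF aa(4) bilE linear_hom_comp[OF lL(1) f'(1)] _ that])
      (simp add: lL(2) f'(7) i'(4) j'(4))
  have fi: "(\<lambda>a. f (i a)) \<in> hopf_hom A E" by (rule hopf_hom_comp[OF A L E i(1) f])
  have fj: "(\<lambda>a. f (j a)) \<in> hopf_hom H E" by (rule hopf_hom_comp[OF H L E j(1) f])
  have injf: "inj_on f (carrier L)" using bij by (simp add: bij_betw_def)
  have "inj_on (\<lambda>a. f (i a)) (carrier A)" "inj_on (\<lambda>a. f (j a)) (carrier H)"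
    using i(2) j(2) injf i'(4) j'(4) by (auto simp: inj_on_def)
  moreover have "bij_betw (tensor_lift E (\<lambda>a y. f (i a) \<otimes>\<^bsub>E\<^esub> f (j y))) (carrier (tensor A H)) (carrier E)"
    using bij_betw_trans[OF b bij] eq by (subst bij_betw_cong[where g = "f \<circ> tensor_lift L (\<lambda>a y. i a \<otimes>\<^bsub>L\<^esub> j y)"]) auto
  ultimately show ?thesis
    unfolding factorizes_through_def using E A H fi fj by blast
qed

text \<open>The map starts from the extension because the universal property provides maps out of
  it. It is bijective since it carries the monomial basis of the extension to the one that the
  factorization gives in E.\<close>

lemma taft_ext_if_factorizes_through:
  assumes q: "primitive_root_of_unity m (q :: 'k::field)" and m: "m \<ge> 2" and n: "n \<ge> 2"
    and fac: "factorizes_through E (taft_hopf m q) (group_hopf_algebra (integer_mod_group n) :: ('k, int \<Rightarrow>\<^sub>0 'k) hopf)"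
  shows "\<exists>\<omega>. \<omega> ^ n = 1 \<and> (\<exists>f \<in> hopf_hom (taft_ext_hopf n m \<omega> q) E. bij_betw f (carrier (taft_ext_hopf n m \<omega> q)) (carrier E))"
proof -
  let ?T = "taft_hopf m q" and ?G = "group_hopf_algebra (integer_mod_group n) :: ('k, int \<Rightarrow>\<^sub>0 'k) hopf"
  have m0: "m > 0" and n0: "n > 0" using m n by auto
  obtain i j where E: "hopf_algebra E" and T: "hopf_algebra ?T" and G: "hopf_algebra ?G"
    and i: "i \<in> hopf_hom ?T E" and j: "j \<in> hopf_hom ?G E"
    and b: "bij_betw (tensor_lift E (\<lambda>a y. i a \<otimes>\<^bsub>E\<^esub> j y)) (carrier (tensor ?T ?G)) (carrier E)"
    using fac by (auto simp: factorizes_through_def)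
  note A = hopf_algebra_assoc[OF E] hopf_algebra_assoc[OF T] hopf_algebra_assoc[OF G]
  interpret E: assoc_algebra E by (rule A)
  interpret TG: algebra_pair ?T ?G using A(2,3) by (rule algebra_pairI)
  note i' = hopf_homD(1)[OF i] and j' = hopf_homD(1)[OF j]
  let ?c = "Poly_Mapping.single 1 1 :: int \<Rightarrow>\<^sub>0 'k"
  let ?g = "j ?c" and ?h = "i (taft_h m q)" and ?x = "i (taft_x m q)"
  have c: "?c \<in> carrier ?G" using n by simp
  note tp = taft_pair_taft[OF q m0]
  note P = product_map[OF q m0 n A(1) i' j']
  obtain d where "dual_bases (tensor ?T ?G) ({..<m} \<times> {..<m} \<times> {..<n})
    (\<lambda>(a, b, c). pure_tensor ?T ?G (monomial ?T \<one>\<^bsub>?T\<^esub> (taft_h m q) (taft_x m q) (a, b, 0))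
      (Poly_Mapping.single (int c) 1)) d"
    using dual_bases_taft_tensor_group[OF q m0 n] by blast
  from dual_bases_image[OF TG.T.assoc_algebra_axioms A(1) this P(1) b]
  obtain d' where "dual_bases E ({..<m} \<times> {..<m} \<times> {..<n})
    (\<lambda>k. tensor_lift E (\<lambda>a y. i a \<otimes>\<^bsub>E\<^esub> j y) ((\<lambda>(a, b, c). pure_tensor ?T ?G
      (monomial ?T \<one>\<^bsub>?T\<^esub> (taft_h m q) (taft_x m q) (a, b, 0)) (Poly_Mapping.single (int c) 1)) k)) d'"
    by blast
  then have basis: "dual_bases E ({..<m} \<times> {..<m} \<times> {..<n}) (monomial E ?g ?h ?x) d'"
    by (rule dual_bases_cong[OF _ A(1)]) (auto simp: P(2))
  have "?c [^]\<^bsub>?G\<^esub> n = \<one>\<^bsub>?G\<^esub>"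
  proof -
    \<comment> \<open>\<open>single_pow_integer_mod\<close> covers exponents below n only, so the
      last factor is multiplied separately and the wrap-around happens in the group
      addition.\<close>
    obtain n' where n': "n = Suc n'" using n by (cases n) auto
    have "?c [^]\<^bsub>?G\<^esub> n = ?c [^]\<^bsub>?G\<^esub> n' \<otimes>\<^bsub>?G\<^esub> ?c" by (simp add: n')
    also have "?c [^]\<^bsub>?G\<^esub> n' = Poly_Mapping.single (int n') 1"
      using n n' by (intro single_pow_integer_mod) simp_all
    finally show ?thesis by (simp add: n' add.commute)
  qed
  then have g_pow: "?g [^]\<^bsub>E\<^esub> n = \<one>\<^bsub>E\<^esub>"
    using algebra_hom_pow[OF A(3,1) j' c, of n] algebra_homD(3)[OF j'] by simp
  interpret taft_factorized E m n q ?g ?h ?x d'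
  proof (rule taft_factorized.intro)
    show "taft_pair E m q ?h ?x" by (rule taft_pair_hom[OF A(2,1) i' tp])
    show "skew_primitive_pair E ?h ?x"
      by (rule skew_primitive_pair_hom[OF T E i taft_pairD(1,2)[OF tp] skew_primitive_pair_taft[OF q m0]])
    show "grouplike E ?g"
      using n by (intro grouplike_hom[OF G E j c]) (simp add: grouplike_def group_hopf_comult group_hopf_counit)
    show "?g \<in> carrier E" by (rule algebra_homD(4)[OF j' c])
  qed (fact E m n0 q g_pow basis)+
  \<comment> \<open>Here \<omega> is the scalar defined in the locale: the coordinate at x of the
    conjugate of x by g.\<close>
  let ?L = "taft_ext_hopf n m \<omega> q"
  note L = hopf_algebra_taft_ext[OF q m0 omega_pow n0]
  note t = taft_tripleD[OF taft_triple_taft_ext[OF q m0 omega_pow n0]]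
  obtain f where f: "f \<in> hopf_hom ?L E" "f (ext_g n m \<omega> q) = ?g" "f (ext_h n m \<omega> q) = ?h" "f (ext_x n m \<omega> q) = ?x"
    using taft_ext_lift[OF q m0 omega_pow n0 E taft_triple skew g_grouplike] by blast
  note f' = hopf_homD(1)[OF f(1)]
  note LA = hopf_algebra_assoc[OF L]
  have img: "f (monomial ?L (ext_g n m \<omega> q) (ext_h n m \<omega> q) (ext_x n m \<omega> q) k) = monomial E ?g ?h ?x k" for k
    using t(2) taft_pairD(1,2)[OF t(1)] by (subst monomial_hom[OF LA A(1) f']) (simp_all add: f)
  have "bij_betw f (carrier ?L) (carrier E)"
    by (rule dual_bases_bij[OF LA A(1) dual_bases_taft_ext[OF q m0 omega_pow n0] algebra_homD(1)[OF f']
          dual_bases_cong[OF basis A(1)]]) (simp add: img)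
  then show ?thesis using omega_pow f(1) by blast
qed

theorem corollary3p2:
  fixes m n :: nat
    and q :: "'k::field"
    and E :: "('k, 'e) hopf"
  assumes "m \<ge> 3" and "n \<ge> 2"
    and "primitive_root_of_unity m q"
    and "hopf_algebra E"
  shows "factorizes_through E (taft_hopf m q) (group_hopf_algebra (integer_mod_group n))
    \<longleftrightarrow> (\<exists>\<omega> \<in> roots_of_unity n. hopf_isomorphic E (taft_ext_hopf n m \<omega> q))"
proof
  have m: "m > 0" "m \<ge> 2" and n: "n > 0" using assms by auto
  {
    assume "factorizes_through E (taft_hopf m q) (group_hopf_algebra (integer_mod_group n))"
    then obtain \<omega> f where \<omega>: "\<omega> ^ n = 1" and f: "f \<in> hopf_hom (taft_ext_hopf n m \<omega> q) E"
      and bij: "bij_betw f (carrier (taft_ext_hopf n m \<omega> q)) (carrier E)"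
      using taft_ext_if_factorizes_through[OF assms(3) m(2) assms(2)] by blast
    let ?L = "taft_ext_hopf n m \<omega> q"
    note L = hopf_algebra_taft_ext[OF assms(3) m(1) \<omega> n]
    \<comment> \<open>\<open>hopf_isomorphic\<close> asks for a map out of E, whereas the universal
      property has produced one into E.\<close>
    have "inv_into (carrier ?L) f \<in> hopf_hom E ?L" by (rule hopf_hom_inv[OF L assms(4) f bij])
    moreover have "bij_betw (inv_into (carrier ?L) f) (carrier E) (carrier ?L)"
      by (rule bij_betw_inv_into[OF bij])
    ultimately show "\<exists>\<omega> \<in> roots_of_unity n. hopf_isomorphic E (taft_ext_hopf n m \<omega> q)"
      using L assms(4) \<omega> unfolding hopf_isomorphic_def roots_of_unity_def by blast
  next
    assume "\<exists>\<omega> \<in> roots_of_unity n. hopf_isomorphic E (taft_ext_hopf n m \<omega> q)"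
    then obtain \<omega> f where \<omega>: "\<omega> ^ n = 1" and f: "f \<in> hopf_hom E (taft_ext_hopf n m \<omega> q)"
      and bij: "bij_betw f (carrier E) (carrier (taft_ext_hopf n m \<omega> q))"
      by (auto simp: hopf_isomorphic_def roots_of_unity_def)
    note L = hopf_algebra_taft_ext[OF assms(3) m(1) \<omega> n]
    show "factorizes_through E (taft_hopf m q) (group_hopf_algebra (integer_mod_group n))"
      by (rule factorizes_through_iso[OF factorizes_through_taft_ext[OF assms(3) m(1) assms(2) \<omega>] assms(4)
            hopf_hom_inv[OF assms(4) L f bij] bij_betw_inv_into[OF bij]])
  }
qed

end
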